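(* Let $p$ be a prime, let $\eta\in(0,1)$, and let $A\subseteq \mathbb{Z}/p\mathbb{Z}$ be a set with $|A|\geq \eta p>0$ and $|2A|=2|A|+r<p$. Let $$\alpha=-\tfrac54+\tfrac14\sqrt{9+8\,\eta\, p\sin(\pi/p)/\sin(\pi\eta/3)}.$$ Suppose that $$|2A|\leq (2+\alpha)|A|-3\qquad\text{and}\qquad |A|\leq \frac{p-r}{3}.$$ Then there exist arithmetic progressions $P_A,P_{2A}\subseteq \mathbb{Z}/p\mathbb{Z}$ with the same common difference such that $A\subseteq P_A$, $|P_A|\leq |A|+r+1$, $P_{2A}\subseteq 2A$, and $|P_{2A}|\geq 2|A|-1$.
   Context: For $A\subseteq \mathbb{Z}/p\mathbb{Z}$, $2A=A+A=\{x+y: x,y\in A\}$. An arithmetic progression in $\mathbb{Z}/p\mathbb{Z}$ with difference $g\neq 0$ is a set of the form $\{a, a+g, a+2g,\dots,a+(k-1)g\}$ with $1\le k\le p$. *)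

theory Defs
  imports Complex_Main "HOL-Computational_Algebra.Primes"
begin

text \<open>Z/pZ is represented by the residues {0..<p} (naturals), with addition mod p.\<close>

definition sumset_mod :: "nat \<Rightarrow> nat set \<Rightarrow> nat set \<Rightarrow> nat set" where
  "sumset_mod p A B = {(x + y) mod p | x y. x \<in> A \<and> y \<in> B}"

definition ap_mod :: "nat \<Rightarrow> nat \<Rightarrow> nat \<Rightarrow> nat \<Rightarrow> nat set" where
  "ap_mod p a g k = {(a + i * g) mod p | i. i < k}"

definition is_AP_mod :: "nat \<Rightarrow> nat set \<Rightarrow> nat \<Rightarrow> bool" where
  "is_AP_mod p P g \<longleftrightarrow> g mod p \<noteq> 0 \<and> (\<exists>a k. 1 \<le> k \<and> k \<le> p \<and> P = ap_mod p a g k)"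

end

theory Submission
  imports Defs "HOL-Analysis.Analysis" "HOL-Library.Set_Algebras" "HOL-Number_Theory.Cong"
begin

text \<open>
  Let \<open>n = |A|\<close>, \<open>s = |2A|\<close>. The last hypothesis says \<open>s + n \<le> p\<close>, and with it the Fourier identity counting
  \<open>a + b \<in> 2A\<close> yields a nontrivial coefficient of modulus at least \<open>n\<^sup>2/s\<close>. If every half circle
  contained fewer than \<open>(s + 4)/3\<close> points of every dilate of \<open>A\<close>, Lev's bound for sums of separated unit vectors would
  make all coefficients smaller than that; this is exactly what the value of \<open>\<alpha>\<close> encodes. So a part \<open>E\<close> of a
  dilate of \<open>A\<close> with \<open>3|E| \<ge> s + 4\<close> lies in a half circle, where the theorem of Lev and Smeliansky for integers
  (deduced from Kneser's theorem) puts it in a progression, say \<open>[0, L]\<close> with \<open>L \<le> |2E| - |E|\<close>.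

  Choosing \<open>E\<close> maximal over all dilates and half circles, suppose that \<open>Z = A - E\<close> is not empty. Applying the same
  integer theorem to \<open>E\<close> and the part of \<open>A\<close> in an interval of length \<open>p - L\<close> forces \<open>Z \<subseteq> [p - L, 2L]\<close>, antipodal to
  \<open>E\<close>. Then most of \<open>]2L, p[\<close> is missed by \<open>2A\<close>, which cuts a long gap into \<open>E = X \<union> Y\<close>, and the sumsets
  \<open>E + X\<close>, \<open>2Y\<close> and \<open>X + (E \<union> Z)\<close> are too large. Hence all of \<open>A\<close> is rectified. Since \<open>4s + 12 \<le> 9n\<close>, its density in
  \<open>[0, L]\<close> is so high that the long progression in \<open>2A\<close> follows from the pigeonhole principle.
\<close>

section \<open>Kneser's theorem for cyclic groups\<close>

text \<open>Where the constants come from. Put K = (s + 3)/n and T = \<eta> p sin(\<pi>/p) /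
  sin(\<pi> \<eta>/3); then 2 + \<alpha> is the positive root of K (2 K - 3) = T, so the hypothesis
  reads K (2 K - 3) \<le> T once 2 K \<ge> 3. If no half circle holds (s + 4)/3 points, Lev's bound
  is that of an arc of at most (2 (s + 3) - 3 n)/3 = (2 K - 3) n/3 points, and concavity of the sine
  compares it with an arc of n/3 points. The condition 4 s + 12 \<le> 9 n is K \<le> 9/4: here T
  \<le> \<pi>, whereas K > 9/4 would give T > 27/8. The threshold (s + 4)/3 is the least that rules
  out 3 |E| \<le> |2E| + 3 in the integer theorem. That theorem reduces modulo the diameter of a
  set, an arbitrary integer, so subgroups must be handled although p is prime. Sums with Z wrap
  around modulo p, so E and Z have no evident common integer model. The contradiction comes from two
  estimates of L: L + |E| \<le> |2E| from above, and from below the remark that any d in ]2L, p[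
  missed by 2A makes every d - z with z in Z a hole of E.\<close>

text \<open>A subset of \<open>\<int>/m\<int>\<close> is encoded as an \<open>m\<close>-periodic set of integers and a subgroup as a divisor \<open>d\<close>
  of \<open>m\<close> (it has order \<open>m div d\<close>), so that quotients only change the modulus.\<close>

definition periodic :: "int \<Rightarrow> int set \<Rightarrow> bool" where
  "periodic d X \<longleftrightarrow> (\<forall>x. x + d \<in> X \<longleftrightarrow> x \<in> X)"

definition rescount :: "int \<Rightarrow> int set \<Rightarrow> nat" where
  "rescount m X = card (X \<inter> {0..<m})"

lemma periodic_mult:
  assumes "periodic d X"
  shows "x + d * k \<in> X \<longleftrightarrow> x \<in> X"
proof -
  have shift: "y + d \<in> X \<longleftrightarrow> y \<in> X" for y by (rule assms[unfolded periodic_def, rule_format])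
  have eq: "x + d * (i + 1) = (x + d * i) + d" "x + d * i = (x + d * (i - 1)) + d" for i
    by (simp_all add: algebra_simps)
  show ?thesis
  proof (induction k rule: int_induct[where k = 0])
    case base
    show ?case by simp
  next
    case (step1 i)
    then show ?case unfolding eq(1) shift by blast
  next
    case (step2 i)
    then show ?case using shift[of "x + d * (i - 1)"] unfolding eq(2)[symmetric] by blast
  qed
qed

lemma periodic_cong:
  assumes "periodic d X" "x mod d = y mod d"
  shows "x \<in> X \<longleftrightarrow> y \<in> X"
proof -
  have "x = y + d * (x div d - y div d)"
    using assms(2) mult_div_mod_eq[of d x] mult_div_mod_eq[of d y] unfolding right_diff_distrib by linarith
  then show ?thesis using periodic_mult[OF assms(1)] by metis
qed

lemma periodic_dvd: "periodic d X \<Longrightarrow> d dvd e \<Longrightarrow> periodic e X"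
  using periodic_mult unfolding periodic_def by (auto elim!: dvdE)

lemma periodic_Un: "periodic d X \<Longrightarrow> periodic d Y \<Longrightarrow> periodic d (X \<union> Y)"
  and periodic_Int: "periodic d X \<Longrightarrow> periodic d Y \<Longrightarrow> periodic d (X \<inter> Y)"
  and periodic_Diff: "periodic d X \<Longrightarrow> periodic d Y \<Longrightarrow> periodic d (X - Y)"
  by (simp_all add: periodic_def)

lemma periodic_shift: "periodic d X \<Longrightarrow> periodic d ((+) t ` X)"
  unfolding periodic_def
proof
  fix x assume X: "\<forall>x. (x + d \<in> X) = (x \<in> X)"
  have *: "y \<in> (+) t ` X \<longleftrightarrow> y - t \<in> X" for y
    by (auto simp: image_iff intro: bexI[of _ "y - t"])
  show "(x + d \<in> (+) t ` X) = (x \<in> (+) t ` X)"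
    using X[rule_format, of "x - t"] unfolding * by (simp add: algebra_simps)
qed

lemma periodic_set_plus: "periodic d X \<Longrightarrow> periodic d (X + Y)"
  unfolding periodic_def
proof
  fix x assume X: "\<forall>x. (x + d \<in> X) = (x \<in> X)"
  have *: "y \<in> X + Y \<longleftrightarrow> (\<exists>z\<in>Y. y - z \<in> X)" for y
    unfolding set_plus_def by (auto intro!: bexI[of _ "_ :: int"])
  have "x + d - z \<in> X \<longleftrightarrow> x - z \<in> X" for z
    using X[rule_format, of "x - z"] by (simp add: algebra_simps)
  then show "(x + d \<in> X + Y) = (x \<in> X + Y)" by (simp add: *)
qed

text \<open>The standard source of lower bounds for \<open>rescount\<close>: representatives may lie
  anywhere as long as they are pairwise incongruent.\<close>

lemma rescount_ge:
  assumes "0 < m" "periodic m X" "F \<subseteq> X" "inj_on (\<lambda>x. x mod m) F"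
  shows "finite F" "card F \<le> rescount m X"
proof -
  have sub: "(\<lambda>x. x mod m) ` F \<subseteq> X \<inter> {0..<m}"
    using assms(1,3) periodic_cong[OF assms(2), of _ "_ mod m"] by auto
  show "finite F"
    by (rule finite_imageD[OF finite_subset[OF sub] assms(4)]) simp
  show "card F \<le> rescount m X"
    unfolding rescount_def using card_inj_on_le[OF assms(4) sub] by simp
qed

lemma rescount_shift_le:
  assumes "0 < m" "periodic m X"
  shows "rescount m X \<le> rescount m ((+) t ` X)"
proof -
  let ?F = "(+) t ` (X \<inter> {0..<m})"
  have "inj_on (\<lambda>x. x mod m) ?F"
  proof (rule inj_onI)
    fix x y assume "x \<in> ?F" "y \<in> ?F" and eq: "x mod m = y mod m"
    then obtain x' y' where xy: "x = t + x'" "y = t + y'" "0 \<le> x'" "x' < m" "0 \<le> y'" "y' < m"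
      by auto
    then have "x' mod m = y' mod m" using eq
      by (metis add.commute add_diff_cancel_right' mod_diff_left_eq)
    then show "x = y" using xy by simp
  qed
  then have "card ?F \<le> rescount m ((+) t ` X)"
    by (intro rescount_ge(2)[OF assms(1) periodic_shift[OF assms(2)]]) auto
  then show ?thesis by (simp add: card_image rescount_def)
qed

lemma rescount_shift:
  assumes "0 < m" "periodic m X"
  shows "rescount m ((+) t ` X) = rescount m X"
proof (rule antisym)
  have "(+) (- t) ` (+) t ` X = X" by (force simp: image_iff)
  then show "rescount m ((+) t ` X) \<le> rescount m X"
    using rescount_shift_le[OF assms(1) periodic_shift[OF assms(2)], of t "- t"] by simp
qed (rule rescount_shift_le[OF assms])

lemma rescount_Un:
  "rescount m (X \<union> Y) = rescount m X + rescount m (Y - X)"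
proof -
  have "(X \<union> Y) \<inter> {0..<m} = (X \<inter> {0..<m}) \<union> ((Y - X) \<inter> {0..<m})" by auto
  then show ?thesis unfolding rescount_def by (simp add: card_Un_disjoint Int_Diff disjoint_iff)
qed

lemma rescount_mono: "X \<subseteq> Y \<Longrightarrow> rescount m X \<le> rescount m Y"
  unfolding rescount_def by (intro card_mono) auto

text \<open>All blocks of length \<open>d\<close> look alike, so lifting from the quotient modulo
  \<open>d\<close> multiplies every count by the same index.\<close>

lemma rescount_scale:
  assumes "0 < d" "0 < k" "periodic d X"
  shows "int (rescount (d * k) X) = k * int (rescount d X)"
proof -
  let ?f = "\<lambda>(i, x). d * i + x"
  let ?S = "{0..<k} \<times> (X \<inter> {0..<d})"
  have inj: "inj_on ?f ?S"
  proof (rule inj_onI, clarsimp)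
    fix i x j y assume "0 \<le> x" "x < d" "0 \<le> y" "y < d" and eq: "d * i + x = d * j + y"
    then have "(d * i + x) mod d = (d * j + y) mod d" by simp
    then have "x = y" using \<open>0 \<le> x\<close> \<open>x < d\<close> \<open>0 \<le> y\<close> \<open>y < d\<close> by simp
    then show "i = j \<and> x = y" using eq assms by simp
  qed
  have "?f ` ?S = X \<inter> {0..<d * k}"
  proof (intro equalityI subsetI)
    fix z assume "z \<in> ?f ` ?S"
    then obtain i x where z: "z = d * i + x" "0 \<le> i" "i < k" "x \<in> X" "0 \<le> x" "x < d" by auto
    have "d * i + x < d * (i + 1)" using z by (simp add: algebra_simps)
    also have "\<dots> \<le> d * k" using z assms by (intro mult_left_mono) auto
    finally have "z < d * k" using z by simp
    moreover have "x + d * i \<in> X" using z periodic_mult[OF assms(3)] by simp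
    ultimately show "z \<in> X \<inter> {0..<d * k}" using z assms by (simp add: add.commute)
  next
    fix z assume z: "z \<in> X \<inter> {0..<d * k}"
    have "d * (z div d) < d * k"
    proof -
      have "z < d * k" using z by simp
      then show ?thesis using mult_div_mod_eq[of d z] pos_mod_sign[OF assms(1), of z] by linarith
    qed
    then have "z div d < k" using assms by simp
    moreover have "z mod d \<in> X" using z periodic_cong[OF assms(3), of z "z mod d"] by simp
    ultimately have "(z div d, z mod d) \<in> ?S" using z assms by (simp add: pos_imp_zdiv_nonneg_iff)
    moreover have "?f (z div d, z mod d) = z" by simp
    ultimately show "z \<in> ?f ` ?S" by (metis rev_image_eqI)
  qed
  then have "rescount (d * k) X = card ?S" unfolding rescount_def by (metis card_image inj)
  then show ?thesis using assms by (simp add: card_cartesian_product rescount_def)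
qed

section \<open>Unions of periodic sets\<close>

text \<open>By the Chinese remainder theorem, a coset of the subgroup generated by \<open>d1\<close>
  and \<open>d2\<close> modulo their lcm is a grid with coordinates t and u. Membership in
  \<open>C1\<close> depends on t only and membership in \<open>C2\<close> on u only, so
  \<open>C1 - C2\<close> contains a rectangle of this grid.\<close>

lemma rescount_grid:
  fixes d1 d2 x :: int
  assumes pos: "0 < d1" "0 < d2" and per: "periodic d1 C1" "periodic d2 C2"
  defines "m1 \<equiv> d2 div gcd d1 d2" and "m2 \<equiv> d1 div gcd d1 d2"
  shows "int (card {t \<in> {0..<m2}. x + t * d2 \<in> C1}) * (m1 - int (card {t \<in> {0..<m1}. x + t * d1 \<in> C2}))
           \<le> int (rescount (lcm d1 d2) (C1 - C2))"
proof -
  let ?g = "gcd d1 d2" and ?l = "lcm d1 d2"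
  let ?U = "{t \<in> {0..<m2}. x + t * d2 \<in> C1}" and ?V = "{t \<in> {0..<m1}. x + t * d1 \<in> C2}"
  let ?V' = "{t \<in> {0..<m1}. x + t * d1 \<notin> C2}"
  let ?f = "\<lambda>(t, u). x + t * d2 + u * d1"
  have g: "0 < ?g" using pos by simp
  have d1: "d1 = ?g * m2" and d2: "d2 = ?g * m1" by (simp_all add: m1_def m2_def)
  have "coprime m2 m1" unfolding m1_def m2_def by (rule div_gcd_coprime) (use pos in auto)
  then have cop: "coprime m1 m2" by (simp add: coprime_commute)
  have aux: "t = t'" if "d dvd (t - t') * e" "d = ?g * a" "e = ?g * b" "coprime b a"
      "0 \<le> t" "t < a" "0 \<le> t'" "t' < a" for t t' a b d e
  proof -
    have "?g * a dvd ?g * ((t - t') * b)" using that by (simp add: mult.left_commute)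
    then have "a dvd (t - t') * b" using pos by simp
    then have "a dvd t - t'" using that(4) by (simp add: coprime_commute coprime_dvd_mult_left_iff)
    then have "t mod a = t' mod a" by (simp add: mod_eq_dvd_iff)
    then show ?thesis using that by simp
  qed
  have key: "t = t' \<and> u = u'" if "?l dvd (t - t') * d2 + (u - u') * d1"
      "0 \<le> t" "t < m2" "0 \<le> t'" "t' < m2" "0 \<le> u" "u < m1" "0 \<le> u'" "u' < m1" for t t' u u'
  proof
    have "d1 dvd (t - t') * d2 + (u - u') * d1" "d2 dvd (t - t') * d2 + (u - u') * d1"
      using that(1) by (meson dvd_lcm1 dvd_lcm2 dvd_trans)+
    then have 1: "d1 dvd (t - t') * d2" and 2: "d2 dvd (u - u') * d1"
      by (simp_all add: dvd_add_left_iff dvd_add_right_iff)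
    show "t = t'" using aux[OF 1 d1 d2 cop] that by simp
    show "u = u'" using aux[OF 2 d2 d1] cop that by (simp add: coprime_commute)
  qed
  have inj: "inj_on ((\<lambda>x. x mod ?l) \<circ> ?f) (?U \<times> ?V')"
  proof (rule inj_onI)
    fix v v' assume v: "v \<in> ?U \<times> ?V'" "v' \<in> ?U \<times> ?V'"
      and eq: "((\<lambda>x. x mod ?l) \<circ> ?f) v = ((\<lambda>x. x mod ?l) \<circ> ?f) v'"
    obtain t u t' u' where tu: "v = (t, u)" "v' = (t', u')" by (cases v, cases v')
    have "?l dvd (x + t * d2 + u * d1) - (x + t' * d2 + u' * d1)"
      using eq tu by (simp add: mod_eq_dvd_iff)
    also have "(x + t * d2 + u * d1) - (x + t' * d2 + u' * d1) = (t - t') * d2 + (u - u') * d1"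
      by (simp add: algebra_simps)
    finally show "v = v'" using key[of t t' u u'] v tu by simp
  qed
  have sub: "?f ` (?U \<times> ?V') \<subseteq> C1 - C2"
  proof clarsimp
    fix t u assume "x + t * d2 \<in> C1" "x + u * d1 \<notin> C2"
    moreover have "x + t * d2 + u * d1 = (x + t * d2) + d1 * u" "x + t * d2 + u * d1 = (x + u * d1) + d2 * t"
      by (simp_all add: algebra_simps)
    ultimately show "x + t * d2 + u * d1 \<in> C1 \<and> x + t * d2 + u * d1 \<notin> C2"
      using periodic_mult[OF per(1)] periodic_mult[OF per(2)] by metis
  qed
  have "periodic ?l (C1 - C2)" using per by (meson dvd_lcm1 dvd_lcm2 periodic_Diff periodic_dvd)
  then have c1: "card (?f ` (?U \<times> ?V')) \<le> rescount ?l (C1 - C2)"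
    using sub inj pos by (intro rescount_ge) (auto intro: inj_on_imageI lcm_pos_int)
  have c2: "card (?f ` (?U \<times> ?V')) = card ?U * card ?V'"
    unfolding card_image[OF inj_on_imageI2[OF inj]] by (rule card_cartesian_product)
  have c3: "int (card ?V') = m1 - int (card ?V)"
  proof -
    have "?V' = {0..<m1} - ?V" by auto
    moreover have "card ({0..<m1} - ?V) = card {0..<m1} - card ?V" by (rule card_Diff_subset[OF finite_subset[of _ "{0..<m1}"]]) auto
    moreover have "card ?V \<le> card {0..<m1}" by (rule card_mono) auto
    moreover have "0 \<le> m1" using pos by (simp add: m1_def pos_imp_zdiv_nonneg_iff)
    ultimately show ?thesis by simp
  qed
  show ?thesis using c1 unfolding c2 c3[symmetric] of_nat_mult[symmetric] of_nat_le_iff .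
qed

text \<open>Kneser's union lemma. The union keeps only the period \<open>l = lcm d1 d2\<close>,
  whose subgroup is smaller than that of \<open>d1\<close> by the factor \<open>m1\<close> and than
  that of \<open>d2\<close> by the factor \<open>m2\<close>. The loss is made up if, modulo
  \<open>l\<close>, the union adds \<open>m1 - 1\<close> residues to \<open>C1\<close> or
  \<open>m2 - 1\<close> residues to \<open>C2\<close>; grids through a point of each difference
  supply them.\<close>

lemma periodic_union_count:
  fixes M :: int
  assumes M: "0 < M" and d: "0 < d1" "d1 dvd M" "0 < d2" "d2 dvd M"
    and per: "periodic d1 C1" "periodic d2 C2"
    and N: "N \<le> int (rescount M C1) + M div d1" "N \<le> int (rescount M C2) + M div d2"
  shows "\<exists>d>0. d dvd M \<and> periodic d (C1 \<union> C2) \<and> N \<le> int (rescount M (C1 \<union> C2)) + M div d"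
proof (cases "C1 \<subseteq> C2 \<or> C2 \<subseteq> C1")
  case True
  then have "C1 \<union> C2 = C2 \<or> C1 \<union> C2 = C1" by blast
  then show ?thesis using d per N by metis
next
  case False
  then obtain x y where x: "x \<in> C2" "x \<notin> C1" and y: "y \<in> C1" "y \<notin> C2" by blast
  define g l m1 m2 where "g = gcd d1 d2" and "l = lcm d1 d2" and "m1 = d2 div g" and "m2 = d1 div g"
  define K where "K = M div l"
  have g: "0 < g" using d unfolding g_def by simp
  have l: "0 < l" using d unfolding l_def by (simp add: lcm_pos_int)
  have "l dvd M" using d unfolding l_def by simp
  then have MK: "M = l * K" by (simp add: K_def)
  have K: "0 < K" using MK M l by (simp add: zero_less_mult_iff)
  have d1: "d1 = g * m2" and d2: "d2 = g * m1" by (simp_all add: m1_def m2_def g_def)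
  have pos: "0 < m1" "0 < m2" using d g d1 d2 by (simp_all add: zero_less_mult_iff)
  have "g * l = d1 * d2" using d by (simp add: g_def l_def abs_mult)
  then have "g * l = g * (d1 * m1)" "g * l = g * (d2 * m2)"
    using d1 d2 by (metis mult.left_commute mult.assoc mult.commute)+
  then have l1: "l = d1 * m1" and l2: "l = d2 * m2" using g by simp_all
  have per_l: "periodic l C1" "periodic l C2"
    using per periodic_dvd l1 l2 by (metis dvd_triv_left)+
  define a b where "a = int (rescount l (C2 - C1))" and "b = int (rescount l (C1 - C2))"
  define u1 u2 where "u1 z = int (card {t \<in> {0..<m2}. z + t * d2 \<in> C1})"
    and "u2 z = int (card {t \<in> {0..<m1}. z + t * d1 \<in> C2})" for z
  have grid: "u1 z * (m1 - u2 z) \<le> b" "u2 z * (m2 - u1 z) \<le> a" for z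
    using rescount_grid[OF d(1,3) per, of z] rescount_grid[OF d(3,1) per(2,1), of z]
    unfolding u1_def u2_def a_def b_def m1_def m2_def g_def l_def
    by (simp_all add: gcd.commute lcm.commute)
  have le: "u1 z \<le> m2" "u2 z \<le> m1" "0 \<le> u1 z" "0 \<le> u2 z" for z
    using card_mono[of "{0..<m2}" "{t \<in> {0..<m2}. z + t * d2 \<in> C1}"]
      card_mono[of "{0..<m1}" "{t \<in> {0..<m1}. z + t * d1 \<in> C2}"] pos
    unfolding u1_def u2_def by (auto simp: subset_iff)
  have lt1: "u1 z < m2" if "z \<notin> C1" for z
  proof -
    let ?S = "{t \<in> {0..<m2}. z + t * d2 \<in> C1}"
    have "0 \<notin> ?S" "0 \<in> {0..<m2}" using that pos by simp_all
    then have "?S \<subset> {0..<m2}" by blast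
    then have "card ?S < card {0..<m2}" by (rule psubset_card_mono[rotated]) simp
    then show ?thesis unfolding u1_def using pos by simp
  qed
  have lt2: "u2 z < m1" if "z \<notin> C2" for z
  proof -
    let ?S = "{t \<in> {0..<m1}. z + t * d1 \<in> C2}"
    have "0 \<notin> ?S" "0 \<in> {0..<m1}" using that pos by simp_all
    then have "?S \<subset> {0..<m1}" by blast
    then have "card ?S < card {0..<m1}" by (rule psubset_card_mono[rotated]) simp
    then show ?thesis unfolding u2_def using pos by simp
  qed
  have gt1: "0 < u1 z" if "z \<in> C1" for z
  proof -
    let ?S = "{t \<in> {0..<m2}. z + t * d2 \<in> C1}"
    have "finite ?S" by (rule finite_subset[of _ "{0..<m2}"]) auto
    moreover have "0 \<in> ?S" using that pos by simp
    ultimately have "0 < card ?S" by (metis card_gt_0_iff empty_iff)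
    then show ?thesis unfolding u1_def by simp
  qed
  have gt2: "0 < u2 z" if "z \<in> C2" for z
  proof -
    let ?S = "{t \<in> {0..<m1}. z + t * d1 \<in> C2}"
    have "finite ?S" by (rule finite_subset[of _ "{0..<m1}"]) auto
    moreover have "0 \<in> ?S" using that pos by simp
    ultimately have "0 < card ?S" by (metis card_gt_0_iff empty_iff)
    then show ?thesis unfolding u2_def by simp
  qed
  \<comment> \<open>Positive integers satisfy v w \<ge> v + w - 1. Applied to both rectangles of one
    grid this gives \<open>n1 + n2 - 2 \<le> p + q\<close>. The third disjunct is the degenerate
    case \<open>u = 0\<close>.\<close>
  have arith: "n1 - 1 \<le> p \<or> n2 - 1 \<le> q \<or> n2 \<le> p"
    if "v * (n2 - u) \<le> p" "u * (n1 - v) \<le> q" "0 < v" "v \<le> n1" "0 \<le> u" "u < n2" for u v p q n1 n2 :: int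
  proof -
    have "u = 0 \<or> v = n1 \<or> 0 < u \<and> v < n1" using that by linarith
    then consider "u = 0" | "v = n1" | "0 < u" "v < n1" by blast
    then show ?thesis
    proof cases
      case 1
      have "1 * n2 \<le> v * n2" by (rule mult_right_mono) (use that 1 in auto)
      then show ?thesis using that(1) 1 by simp
    next
      case 2
      have "n1 * 1 \<le> n1 * (n2 - u)" by (rule mult_left_mono) (use that 2 in auto)
      then show ?thesis using that(1) 2 by simp
    next
      case 3
      have "0 \<le> (v - 1) * (n2 - u - 1)" "0 \<le> (u - 1) * (n1 - v - 1)" using 3 that by simp_all
      then have "v + (n2 - u) - 1 \<le> p" "u + (n1 - v) - 1 \<le> q" using that by (simp_all add: algebra_simps)
      then show ?thesis by linarith
    qed
  qed
  have "m1 - 1 \<le> a \<or> m2 - 1 \<le> b \<or> m2 \<le> a"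
    using arith[of "u2 x" m2 "u1 x" a m1 b] grid[of x] gt2[OF x(1)] lt1[OF x(2)] le[of x] by blast
  moreover have "m2 - 1 \<le> b \<or> m1 - 1 \<le> a \<or> m1 \<le> b"
    using arith[of "u1 y" m1 "u2 y" b m2 a] grid[of y] gt1[OF y(1)] lt2[OF y(2)] le[of y] by blast
  \<comment> \<open>If both points end in the degenerate case, then \<open>m2 \<le> a\<close> and
    \<open>m1 \<le> b\<close>, and comparing \<open>m1\<close> with \<open>m2\<close> settles
    it.\<close>
  ultimately have key: "m1 - 1 \<le> a \<or> m2 - 1 \<le> b" by linarith
  have perC: "periodic l (C1 \<union> C2)" using per_l by (rule periodic_Un)
  have cnt: "int (rescount M C1) = K * int (rescount l C1)" "int (rescount M C2) = K * int (rescount l C2)"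
    "int (rescount M (C1 \<union> C2)) = K * int (rescount l (C1 \<union> C2))"
    using rescount_scale[OF l K] per_l perC unfolding MK by simp_all
  have div: "M div d1 = K * m1" "M div d2 = K * m2" "M div l = K"
    using d l MK by (simp add: l1, simp add: l2, simp)
  have union: "int (rescount l (C1 \<union> C2)) = int (rescount l C1) + a"
    "int (rescount l (C1 \<union> C2)) = int (rescount l C2) + b"
    using rescount_Un[of l C1 C2] rescount_Un[of l C2 C1] unfolding a_def b_def by (simp_all add: Un_commute)
  have "N \<le> K * (int (rescount l (C1 \<union> C2)) + 1)"
    using key
  proof
    assume "m1 - 1 \<le> a"
    have "N \<le> K * (int (rescount l C1) + m1)" using N(1) unfolding cnt div by (simp add: algebra_simps)
    also have "\<dots> \<le> K * (int (rescount l (C1 \<union> C2)) + 1)"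
      using K \<open>m1 - 1 \<le> a\<close> union by (intro mult_left_mono) auto
    finally show ?thesis .
  next
    assume "m2 - 1 \<le> b"
    have "N \<le> K * (int (rescount l C2) + m2)" using N(2) unfolding cnt div by (simp add: algebra_simps)
    also have "\<dots> \<le> K * (int (rescount l (C1 \<union> C2)) + 1)"
      using K \<open>m2 - 1 \<le> b\<close> union by (intro mult_left_mono) auto
    finally show ?thesis .
  qed
  then have "N \<le> int (rescount M (C1 \<union> C2)) + M div l" unfolding cnt div by (simp add: algebra_simps)
  then show ?thesis using l \<open>l dvd M\<close> perC by blast
qed

section \<open>Dyson transforms and Kneser's theorem\<close>

text \<open>Modulo \<open>M\<close>, \<open>- b\<close> is the multiple \<open>(M - 1) * b\<close>,
  so a set closed under adding \<open>b\<close> has \<open>b\<close> as a period. All periods are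
  multiples of the least positive one, \<open>d\<close>; hence \<open>B\<close> lies in the subgroup
  of multiples of \<open>d\<close>, which has \<open>M div d\<close> elements.\<close>

lemma stable_periodic:
  fixes M :: int
  assumes M: "0 < M" and per: "periodic M A" and AB: "\<And>a b. a \<in> A \<Longrightarrow> b \<in> B \<Longrightarrow> a + b \<in> A"
  obtains d where "0 < d" "d dvd M" "periodic d A" "\<And>b. b \<in> B \<Longrightarrow> d dvd b" "int (rescount M B) \<le> M div d"
proof -
  have perB: "periodic b A" if "b \<in> B" for b
  proof -
    have iter: "a + b * int k \<in> A" if "a \<in> A" for a k
    proof (induction k)
      case (Suc k)
      then have "(a + b * int k) + b \<in> A" using AB \<open>b \<in> B\<close> by simp
      then show ?case by (simp add: algebra_simps)
    qed (use that in simp)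
    have "x \<in> A" if "x + b \<in> A" for x
    proof -
      have "(x + b) + b * int (nat (M - 1)) \<in> A" using iter[OF that] .
      moreover have "(x + b) + b * int (nat (M - 1)) = x + M * b" using M by (simp add: algebra_simps)
      ultimately have "x + M * b \<in> A" by (simp only:)
      then show ?thesis by (simp only: periodic_mult[OF per])
    qed
    then show ?thesis unfolding periodic_def using AB \<open>b \<in> B\<close> by auto
  qed
  define n0 where "n0 = (LEAST n. 0 < n \<and> periodic (int n) A)"
  define d where "d = int n0"
  have ex: "0 < nat M \<and> periodic (int (nat M)) A" using M per by simp
  have d: "0 < d" "periodic d A"
    using LeastI[of "\<lambda>n. 0 < n \<and> periodic (int n) A", OF ex] unfolding d_def n0_def by simp_all
  have dvd: "d dvd h" if "periodic h A" for h
  proof -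
    have "x + h mod d \<in> A \<longleftrightarrow> x \<in> A" for x
    proof -
      have "x + h mod d = (x + h * 1) + d * (- (h div d))"
        by (simp add: minus_mult_div_eq_mod [symmetric])
      then show ?thesis using periodic_mult[OF d(2)] periodic_mult[OF that] by metis
    qed
    then have "periodic (int (nat (h mod d))) A" using d(1) by (simp add: periodic_def)
    moreover have "nat (h mod d) < n0"
      using pos_mod_bound[OF d(1), of h] pos_mod_sign[OF d(1), of h] unfolding d_def by linarith
    ultimately have "\<not> 0 < nat (h mod d)"
      using not_less_Least[of "nat (h mod d)" "\<lambda>n. 0 < n \<and> periodic (int n) A"] unfolding n0_def by simp
    then show ?thesis using pos_mod_sign[OF d(1), of h] by (simp add: dvd_eq_mod_eq_0)
  qed
  have dM: "d dvd M" using dvd per .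
  define D where "D = {x. d dvd x}"
  have perD: "periodic d D" unfolding D_def periodic_def by simp
  have "rescount M B \<le> rescount M D" using dvd perB by (intro rescount_mono) (auto simp: D_def)
  moreover have "int (rescount M D) = M div d"
  proof -
    have "D \<inter> {0..<d} = {0}" using d(1) zdvd_imp_le unfolding D_def by fastforce
    then have "rescount d D = 1" unfolding rescount_def by simp
    moreover have "0 < M div d" using M d(1) dM by (simp add: pos_imp_zdiv_pos_iff zdvd_imp_le)
    ultimately show ?thesis using rescount_scale[OF d(1) _ perD, of "M div d"] dM by simp
  qed
  ultimately show ?thesis using that d dM dvd perB by simp
qed

text \<open>Dyson's e-transform replaces (A, B) by (A \<union> (e + B), B \<inter> (A - e)). The
  sizes keep their sum, the sumset does not grow, \<open>a0\<close> and 0 survive, and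
  \<open>B\<close> shrinks as long as some \<open>e + b1\<close> is outside \<open>A\<close>. At the
  end \<open>A\<close> absorbs \<open>B\<close>, and \<open>A\<close> itself is the piece.\<close>

lemma Dyson_sumset_piece:
  fixes M :: int
  assumes M: "0 < M" and "periodic M A" "periodic M B" "a0 \<in> A" "0 \<in> B"
  shows "\<exists>C d. a0 \<in> C \<and> C \<subseteq> A + B \<and> 0 < d \<and> d dvd M \<and> periodic d C \<and>
    int (rescount M A) + int (rescount M B) \<le> int (rescount M C) + M div d"
  using assms(2-)
proof (induction "rescount M B" arbitrary: A B rule: less_induct)
  case less
  show ?case
  proof (cases "\<forall>a\<in>A. \<forall>b\<in>B. a + b \<in> A")
    case True
    obtain d where d: "0 < d" "d dvd M" "periodic d A" "int (rescount M B) \<le> M div d"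
      using stable_periodic[OF M less.prems(1), of B thesis] True by blast
    have "A \<subseteq> A + B" using less.prems(4) by (metis add.right_neutral set_plus_intro subsetI)
    then show ?thesis using d less.prems(3) by (intro exI[of _ A] exI[of _ d]) auto
  next
    case False
    then obtain e b1 where e: "e \<in> A" "b1 \<in> B" "e + b1 \<notin> A" by blast
    define A' B' where "A' = A \<union> (+) e ` B" and "B' = B \<inter> {x. e + x \<in> A}"
    have pE: "periodic M {x. e + x \<in> A}" using less.prems(1) unfolding periodic_def by (metis add.assoc mem_Collect_eq)
    have pA': "periodic M A'" unfolding A'_def using less.prems by (intro periodic_Un periodic_shift)
    have pB': "periodic M B'" unfolding B'_def using less.prems pE by (intro periodic_Int)
    have B: "B = B' \<union> (B - B')" "(B - B') - B' = B - B'" unfolding B'_def by auto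
    have cB: "rescount M B = rescount M B' + rescount M (B - B')" using rescount_Un[of M B' "B - B'"] B by simp
    have "b1 mod M \<in> (B - B') \<inter> {0..<M}"
      using e M periodic_cong[OF periodic_Diff[OF less.prems(2) pB'], of b1 "b1 mod M"] by (simp add: B'_def)
    then have "0 < rescount M (B - B')" unfolding rescount_def by (metis card_gt_0_iff empty_iff finite_Int finite_atLeastLessThan_int)
    then have lt: "rescount M B' < rescount M B" using cB by simp
    have "(+) e ` B - A = (+) e ` (B - B')" unfolding B'_def by auto
    then have cA: "rescount M A' = rescount M A + rescount M (B - B')"
      unfolding A'_def using rescount_Un[of M A] rescount_shift[OF M periodic_Diff[OF less.prems(2) pB']] by simp
    have "a0 \<in> A'" "0 \<in> B'" using less.prems e by (auto simp: A'_def B'_def)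
    from less.hyps[OF lt pA' pB' this] obtain C d where C: "a0 \<in> C" "C \<subseteq> A' + B'" "0 < d" "d dvd M" "periodic d C"
      "int (rescount M A') + int (rescount M B') \<le> int (rescount M C) + M div d" by blast
    have "A' + B' \<subseteq> A + B"
    proof
      fix z assume "z \<in> A' + B'"
      then obtain x y where z: "z = x + y" "x \<in> A'" "y \<in> B'" by (auto elim: set_plus_elim)
      show "z \<in> A + B"
      proof (cases "x \<in> A")
        case True
        then show ?thesis using z unfolding B'_def by (auto intro: set_plus_intro)
      next
        case False
        then obtain b where "b \<in> B" "x = e + b" using z unfolding A'_def by auto
        then have "z = (e + y) + b" "e + y \<in> A" using z by (auto simp: B'_def)
        then show ?thesis using \<open>b \<in> B\<close> by (auto intro: set_plus_intro)
      qed
    qed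
    then show ?thesis using C cA cB by (intro exI[of _ C] exI[of _ d]) auto
  qed
qed

text \<open>Every sum lies in a periodic piece of \<open>A + B\<close> that satisfies the bound with
  the same \<open>N\<close>. The union lemma preserves \<open>N\<close>, so pieces are merged until
  they cover all residues of \<open>A + B\<close>.\<close>

theorem Kneser_periodic:
  fixes M :: int
  assumes M: "0 < M" and per: "periodic M A" "periodic M B" and ne: "A \<noteq> {}" "B \<noteq> {}"
  shows "\<exists>d>0. d dvd M \<and> periodic d (A + B) \<and>
    int (rescount M A) + int (rescount M B) \<le> int (rescount M (A + B)) + M div d"
proof -
  define N where "N = int (rescount M A) + int (rescount M B)"
  have piece: "\<exists>C d. c \<in> C \<and> C \<subseteq> A + B \<and> 0 < d \<and> d dvd M \<and> periodic d C \<and> N \<le> int (rescount M C) + M div d"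
    if c: "c \<in> A + B" for c
  proof -
    obtain a0 b0 where c: "c = a0 + b0" "a0 \<in> A" "b0 \<in> B" using c by (auto elim: set_plus_elim)
    \<comment> \<open>The transform keeps a prescribed sum only in the form \<open>a0 + 0\<close>,
      so \<open>B\<close> is translated to contain 0.\<close>
    define B0 where "B0 = (+) (- b0) ` B"
    have "0 \<in> B0" using c by (force simp: B0_def)
    moreover have "periodic M B0" unfolding B0_def by (rule periodic_shift[OF per(2)])
    ultimately have B0: "periodic M B0" "0 \<in> B0" by blast+
    from Dyson_sumset_piece[OF M per(1) B0(1) c(2) B0(2)]
    obtain C d where C: "a0 \<in> C" "C \<subseteq> A + B0" "0 < d" "d dvd M" "periodic d C"
      "int (rescount M A) + int (rescount M B0) \<le> int (rescount M C) + M div d" by blast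
    have "rescount M B0 = rescount M B" unfolding B0_def using rescount_shift[OF M per(2)] .
    moreover have "rescount M ((+) b0 ` C) = rescount M C"
      using rescount_shift[OF M] C(4,5) periodic_dvd by blast
    moreover have "(+) b0 ` C \<subseteq> A + B"
    proof
      fix z assume "z \<in> (+) b0 ` C"
      then obtain x where x: "x \<in> C" "z = b0 + x" by blast
      then have "x \<in> A + B0" using C(2) by blast
      then obtain a b where "a \<in> A" "b \<in> B" "x = a + (- b0 + b)" by (auto elim!: set_plus_elim simp: B0_def)
      then show "z \<in> A + B" using x by (auto intro: set_plus_intro)
    qed
    ultimately show ?thesis using C c periodic_shift[OF C(5), of b0] unfolding N_def
      by (intro exI[of _ "(+) b0 ` C"] exI[of _ d]) auto
  qed
  have step: "R \<subseteq> A + B \<Longrightarrow> \<exists>C d. R \<subseteq> C \<and> C \<subseteq> A + B \<and> 0 < d \<and> d dvd M \<and> periodic d C \<and> N \<le> int (rescount M C) + M div d"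
    if "finite R" "R \<noteq> {}" for R
    using that
  proof (induction R rule: finite_ne_induct)
    case (singleton c)
    then show ?case using piece[of c] by auto
  next
    case (insert c R)
    from insert obtain C d where C: "R \<subseteq> C" "C \<subseteq> A + B" "0 < d" "d dvd M" "periodic d C" "N \<le> int (rescount M C) + M div d"
      by auto
    from insert.prems piece[of c] obtain C' d' where C': "c \<in> C'" "C' \<subseteq> A + B" "0 < d'" "d' dvd M" "periodic d' C'"
      "N \<le> int (rescount M C') + M div d'" by auto
    from periodic_union_count[OF M C(3,4) C'(3,4) C(5) C'(5) C(6) C'(6)]
    obtain d'' where "0 < d''" "d'' dvd M" "periodic d'' (C \<union> C')" "N \<le> int (rescount M (C \<union> C')) + M div d''" by blast
    then show ?case using C(1,2) C'(1,2) by (intro exI[of _ "C \<union> C'"] exI[of _ d'']) auto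
  qed
  have perAB: "periodic M (A + B)" using per(1) by (rule periodic_set_plus)
  define R where "R = (A + B) \<inter> {0..<M}"
  obtain a b where "a \<in> A" "b \<in> B" using ne by blast
  then have "(a + b) mod M \<in> R"
    unfolding R_def using M periodic_cong[OF perAB, of "a + b" "(a + b) mod M"] by (simp add: set_plus_intro)
  then have "R \<noteq> {}" by blast
  have "finite R" "R \<subseteq> A + B" unfolding R_def by auto
  from step[OF this(1) \<open>R \<noteq> {}\<close> this(2)] obtain C d where C: "R \<subseteq> C" "C \<subseteq> A + B" "0 < d" "d dvd M" "periodic d C" "N \<le> int (rescount M C) + M div d"
    by (elim exE conjE)
  have "A + B \<subseteq> C"
  proof
    fix z assume "z \<in> A + B"
    then have "z mod M \<in> R" unfolding R_def using M periodic_cong[OF perAB, of z "z mod M"] by simp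
    then show "z \<in> C" using C(1) periodic_cong[OF periodic_dvd[OF C(5,4)], of z "z mod M"] by auto
  qed
  then have "C = A + B" using C(2) by blast
  then show ?thesis using C(3-6) unfolding N_def by (intro exI[of _ d]) simp
qed

section \<open>The theorem of Lev and Smeliansky\<close>

text \<open>The sumset of \<open>A\<close> with the multiples of \<open>d\<close>, that is, the full
  preimage of the image of \<open>A\<close> modulo \<open>d\<close>.\<close>

definition residue_hull :: "int \<Rightarrow> int set \<Rightarrow> int set" where
  "residue_hull d A = {x. \<exists>a\<in>A. x mod d = a mod d}"

lemma periodic_residue_hull: "periodic d (residue_hull d A)"
  by (simp add: periodic_def residue_hull_def)

lemma subset_residue_hull: "A \<subseteq> residue_hull d A"
  by (auto simp: residue_hull_def)

lemma residue_hull_subset: "periodic d X \<Longrightarrow> A \<subseteq> X \<Longrightarrow> residue_hull d A \<subseteq> X"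
  using periodic_cong unfolding residue_hull_def by blast

lemma residue_hull_residue_hull: "d dvd m \<Longrightarrow> residue_hull d (residue_hull m A) = residue_hull d A"
proof -
  assume "d dvd m"
  show ?thesis
  proof
    show "residue_hull d (residue_hull m A) \<subseteq> residue_hull d A"
    proof (rule residue_hull_subset[OF periodic_residue_hull], rule residue_hull_subset)
      show "periodic m (residue_hull d A)" using periodic_dvd[OF periodic_residue_hull \<open>d dvd m\<close>] .
    qed (rule subset_residue_hull)
    show "residue_hull d A \<subseteq> residue_hull d (residue_hull m A)"
      using subset_residue_hull by (intro residue_hull_subset[OF periodic_residue_hull]) blast
  qed
qed

lemma rescount_residue_hull:
  assumes "0 < d" "d dvd M" "0 < M"
  shows "int (rescount M (residue_hull d A)) = M div d * int (card ((\<lambda>x. x mod d) ` A))"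
proof -
  have "residue_hull d A \<inter> {0..<d} = (\<lambda>x. x mod d) ` A"
    using assms(1) unfolding residue_hull_def by (auto simp: image_iff)
  then have "rescount d (residue_hull d A) = card ((\<lambda>x. x mod d) ` A)" by (simp add: rescount_def)
  moreover have "0 < M div d" using assms by (simp add: pos_imp_zdiv_pos_iff zdvd_imp_le)
  ultimately show ?thesis
    using rescount_scale[OF assms(1) _ periodic_residue_hull, of "M div d" A] assms by simp
qed

lemma residue_hull_add:
  assumes "periodic d (A + B)"
  shows "residue_hull d A + residue_hull d B = A + B"
proof
  show "residue_hull d A + residue_hull d B \<subseteq> A + B"
  proof
    fix z assume "z \<in> residue_hull d A + residue_hull d B"
    then obtain x y a b where z: "z = x + y" "a \<in> A" "x mod d = a mod d" "b \<in> B" "y mod d = b mod d"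
      by (auto elim!: set_plus_elim simp: residue_hull_def)
    have "z mod d = (a + b) mod d" unfolding z(1) by (rule mod_add_cong[OF z(3,5)])
    then show "z \<in> A + B" using periodic_cong[OF assms, of z "a + b"] set_plus_intro[OF z(2,4)] by blast
  qed
  show "A + B \<subseteq> residue_hull d A + residue_hull d B"
    by (intro set_plus_mono2 subset_residue_hull)
qed

text \<open>The strong form of Kneser's theorem, with |A + H| and |B + H|. The least period
  \<open>d\<close> belongs to the largest subgroup H. The weak form for the hulls, whose sum is
  still \<open>A + B\<close>, yields some period \<open>e\<close>; since \<open>d \<le> e\<close>,
  its subgroup is no larger than H.\<close>

theorem Kneser_residue_hull:
  fixes M :: int
  assumes M: "0 < M" and per: "periodic M A" "periodic M B" and ne: "A \<noteq> {}" "B \<noteq> {}"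
  obtains d where "0 < d" "d dvd M" "periodic d (A + B)"
    "int (rescount M (residue_hull d A)) + int (rescount M (residue_hull d B)) \<le> int (rescount M (A + B)) + M div d"
proof -
  define P where "P = {d. 0 < d \<and> d dvd M \<and> periodic d (A + B)}"
  have "P \<subseteq> {0..M}" unfolding P_def using M by (auto intro: zdvd_imp_le)
  then have finP: "finite P" by (rule finite_subset) simp
  have "M \<in> P" unfolding P_def using M per periodic_set_plus by simp
  then have neP: "P \<noteq> {}" by blast
  define d where "d = Min P"
  have "d \<in> P" unfolding d_def by (rule Min_in[OF finP neP])
  then have d: "0 < d" "d dvd M" "periodic d (A + B)" unfolding P_def by simp_all
  have hull: "periodic M (residue_hull d X)" for X
    using periodic_dvd[OF periodic_residue_hull d(2)] .
  have "residue_hull d A \<noteq> {}" "residue_hull d B \<noteq> {}" using ne subset_residue_hull by blast+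
  from Kneser_periodic[OF M hull hull this] obtain e where e: "0 < e" "e dvd M" "periodic e (A + B)"
    "int (rescount M (residue_hull d A)) + int (rescount M (residue_hull d B)) \<le> int (rescount M (A + B)) + M div e"
    unfolding residue_hull_add[OF d(3)] by (elim exE conjE)
  have "e \<in> P" unfolding P_def using e by simp
  then have "d \<le> e" unfolding d_def by (simp add: finP)
  then have "M div e \<le> M div d" using M d(1) by (intro zdiv_mono2) auto
  then show ?thesis using that d e(4) by simp
qed

section \<open>Sumsets of integers\<close>

text \<open>The sets \<open>Min A + B\<close> and \<open>Max B + A\<close> meet at most in
  \<open>Min A + Max B\<close>.\<close>

lemma card_int_sumset_ge:
  fixes A B :: "int set"
  assumes "finite A" "finite B" "A \<noteq> {}" "B \<noteq> {}"
  shows "card A + card B \<le> card (A + B) + 1"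
proof -
  let ?X = "(+) (Min A) ` B" and ?Y = "(+) (Max B) ` A"
  have sub: "?X \<union> ?Y \<subseteq> A + B"
    using Min_in[OF assms(1,3)] Max_in[OF assms(2,4)] by (auto simp: set_plus_def) (metis add.commute)
  have "?X \<inter> ?Y \<subseteq> {Min A + Max B}"
  proof
    fix z assume "z \<in> ?X \<inter> ?Y"
    then obtain a b where "z = Min A + b" "z = Max B + a" "a \<in> A" "b \<in> B" by blast
    moreover from this have "Min A \<le> a" "b \<le> Max B" using assms by simp_all
    ultimately show "z \<in> {Min A + Max B}" by simp
  qed
  then have "card (?X \<inter> ?Y) \<le> 1" using card_mono[of "{Min A + Max B}"] by fastforce
  moreover have "card ?X + card ?Y = card (?X \<union> ?Y) + card (?X \<inter> ?Y)"
    using assms by (intro card_Un_Int) auto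
  moreover have "card (?X \<union> ?Y) \<le> card (A + B)" using sub assms by (intro card_mono finite_set_plus)
  ultimately show ?thesis by (simp add: card_image)
qed

text \<open>Reduction modulo the diameter: 0 and \<open>M\<close> in \<open>A\<close> collapse to
  one residue, and each \<open>b\<close> in \<open>B\<close> yields the two congruent sums
  \<open>b\<close> and \<open>M + b\<close>. So the sumset has at least |B| elements more than its
  image modulo \<open>M\<close>, and the alternatives are whether this image is everything or is
  bounded by Kneser's theorem.\<close>

theorem Lev_Smeliansky:
  fixes A B :: "int set" and M :: int
  assumes A: "A \<subseteq> {0..M}" "0 \<in> A" "M \<in> A" "0 < M" and gcd: "\<forall>d>0. (\<forall>a\<in>A. d dvd a) \<longrightarrow> d = 1"
    and B: "B \<subseteq> {0..<M}" "B \<noteq> {}"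
  shows "M + int (card B) \<le> int (card (A + B)) \<or> card A + 2 * card B \<le> card (A + B) + 2"
proof -
  define F where "F = A + B"
  have fin: "finite A" "finite B" using A(1) B(1) finite_subset by blast+
  then have finF: "finite F" unfolding F_def by (rule finite_set_plus)
  define A' B' where "A' = residue_hull M A" and "B' = residue_hull M B"
  define C where "C = A' + B'"
  have sub: "A \<subseteq> A'" "B \<subseteq> B'" unfolding A'_def B'_def by (rule subset_residue_hull)+
  have per: "periodic M A'" "periodic M B'" unfolding A'_def B'_def by (rule periodic_residue_hull)+
  have FC: "F \<subseteq> C" unfolding F_def C_def using sub by (rule set_plus_mono2)
  have BF: "b \<in> F" "M + b \<in> F" if "b \<in> B" for b
    using that A(2,3) set_plus_intro[of 0 A b B] set_plus_intro[of M A b B] by (simp_all add: F_def)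
  have lift: "rescount M (C - P) + card B \<le> card (F - P)" if P: "periodic M P" "B \<inter> P = {}" for P
  proof -
    let ?G = "F - P" and ?T = "(+) M ` B"
    have T: "?T \<subseteq> ?G"
    proof
      fix z assume "z \<in> ?T"
      then obtain b where b: "b \<in> B" "z = M + b" by blast
      then have "z \<notin> P" using P periodic_cong[OF P(1), of z b] by auto
      then show "z \<in> ?G" using BF b by simp
    qed
    \<comment> \<open>Deleting the sums \<open>M + b\<close> loses no residue, because
      \<open>b = 0 + b\<close> is also a sum and is not deleted.\<close>
    have "(C - P) \<inter> {0..<M} \<subseteq> (\<lambda>x. x mod M) ` (?G - ?T)"
    proof
      fix z assume z: "z \<in> (C - P) \<inter> {0..<M}"
      then obtain x y a b where xy: "z = x + y" "a \<in> A" "x mod M = a mod M" "b \<in> B" "y mod M = b mod M"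
        by (auto elim!: set_plus_elim simp: C_def A'_def B'_def residue_hull_def)
      have eq: "(a + b) mod M = z mod M" unfolding xy(1) by (rule mod_add_cong[OF xy(3,5), symmetric])
      have zM: "z mod M = z" using z by simp
      have "a + b \<notin> P" using z eq periodic_cong[OF P(1), of "a + b" z] by blast
      then have G: "a + b \<in> ?G" using xy by (simp add: F_def set_plus_intro)
      show "z \<in> (\<lambda>x. x mod M) ` (?G - ?T)"
      proof (cases "a + b \<in> ?T")
        case False
        then show ?thesis using G eq zM by (intro image_eqI[of _ _ "a + b"]) auto
      next
        case True
        then obtain b' where b': "b' \<in> B" "a + b = M + b'" by blast
        have "b' \<notin> ?T"
        proof
          assume "b' \<in> ?T"
          then obtain c where "c \<in> B" "b' = M + c" by blast
          moreover from this have "0 \<le> c" using B(1) by auto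
          moreover have "b' < M" using b'(1) B(1) by auto
          ultimately show False by simp
        qed
        moreover have "b' \<in> ?G" using BF(1)[OF b'(1)] P(2) b'(1) by blast
        moreover have "b' mod M = z" using eq b'(2) zM by simp
        ultimately show ?thesis by blast
      qed
    qed
    then have "rescount M (C - P) \<le> card (?G - ?T)"
      unfolding rescount_def using finF by (meson card_image_le card_mono finite_Diff finite_imageI le_trans)
    moreover have "card ?G = card (?G - ?T) + card ?T"
      using T finF by (metis Diff_partition card_Diff_subset card_mono finite_Diff finite_subset le_add_diff_inverse2)
    ultimately show ?thesis by (simp add: card_image)
  qed
  have "A' \<noteq> {}" "B' \<noteq> {}" using sub A(2) B(2) by blast+
  from Kneser_residue_hull[OF A(4) per this] obtain d where d: "0 < d" "d dvd M" "periodic d C"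
    "int (rescount M (residue_hull d A')) + int (rescount M (residue_hull d B')) \<le> int (rescount M C) + M div d"
    unfolding C_def by metis
  define k where "k = M div d"
  define u v where "u = int (card ((\<lambda>x. x mod d) ` A))" and "v = int (card ((\<lambda>x. x mod d) ` B))"
  have hull: "int (rescount M (residue_hull d X)) = k * int (card ((\<lambda>x. x mod d) ` X))" for X
    using rescount_residue_hull[OF d(1,2) A(4)] unfolding k_def .
  have kn: "k * u + k * v \<le> int (rescount M C) + k"
    using d(4) unfolding A'_def B'_def residue_hull_residue_hull[OF d(2)] hull u_def v_def k_def .
  show ?thesis
  proof (cases "C = UNIV")
    case True
    then have "int (rescount M C) = M" using A(4) by (simp add: rescount_def)
    then show ?thesis using lift[of "{}"] unfolding F_def by (simp add: periodic_def)
  next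
    case False
    \<comment> \<open>Otherwise adding elements of \<open>A\<close> preserves the hull of
      \<open>B\<close>, so one period of this hull divides all of \<open>A\<close>. The gcd
      condition makes that period 1, and then \<open>C\<close> would be everything.\<close>
    have "\<exists>a\<in>A. \<exists>b\<in>B. a + b \<notin> residue_hull d B"
    proof (rule ccontr)
      assume "\<not> ?thesis"
      then have *: "a + b \<in> residue_hull d B" if "a \<in> A" "b \<in> B" for a b using that by blast
      have "x + a \<in> residue_hull d B" if xa: "x \<in> residue_hull d B" "a \<in> A" for x a
      proof -
        obtain b where b: "b \<in> B" "x mod d = b mod d" using xa(1) unfolding residue_hull_def by blast
        have "(x + a) mod d = (a + b) mod d" unfolding add.commute[of a b] by (rule mod_add_cong[OF b(2) refl])
        then show ?thesis using *[OF xa(2) b(1)] periodic_cong[OF periodic_residue_hull, of "x + a" d "a + b"] by blast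
      qed
      then obtain e where e: "0 < e" "periodic e (residue_hull d B)" "\<And>a. a \<in> A \<Longrightarrow> e dvd a"
        using stable_periodic[OF A(4) periodic_dvd[OF periodic_residue_hull d(2)], of B A thesis] by blast
      have "e = 1" using gcd e(1,3) by blast
      obtain b where "b \<in> B" using B(2) by blast
      then have "b \<in> residue_hull d B" using subset_residue_hull by blast
      then have all: "x \<in> residue_hull d B" for x
        using periodic_cong[OF e(2), of b x] \<open>e = 1\<close> by simp
      have "B \<subseteq> C" using BF(1) FC by blast
      then have "residue_hull d B \<subseteq> C" by (rule residue_hull_subset[OF d(3)])
      then show False using all False by blast
    qed
    then obtain a0 b0 where ab: "a0 \<in> A" "b0 \<in> B" "a0 + b0 \<notin> residue_hull d B" by blast
    \<comment> \<open>The coset \<open>P\<close> is met by sums but not by \<open>B\<close>.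
      Kneser's bound and the doubled residues are used off \<open>P\<close>; inside \<open>P\<close>
      the integer sums \<open>A1 + B1\<close> are counted directly, which recovers the subgroup
      order that Kneser's bound gives away.\<close>
    define P where "P = residue_hull d {a0 + b0}"
    have perP: "periodic M P" unfolding P_def by (rule periodic_dvd[OF periodic_residue_hull d(2)])
    have BP: "B \<inter> P = {}" using ab(3) unfolding P_def residue_hull_def by force
    have PC: "P \<subseteq> C" unfolding P_def
      using ab FC by (intro residue_hull_subset[OF d(3)]) (auto simp: F_def intro: set_plus_intro)
    have cP: "int (rescount M P) = k" unfolding P_def hull by simp
    have "rescount M C = rescount M P + rescount M (C - P)"
      using rescount_Un[of M P C] PC by (simp add: Un_absorb1)
    then have cCP: "k * u + k * v - 2 * k + int (card B) \<le> int (card (F - P))"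
      using lift[OF perP BP] kn cP by linarith
    define A1 B1 where "A1 = A \<inter> residue_hull d {a0}" and "B1 = B \<inter> residue_hull d {b0}"
    have ne: "a0 \<in> A1" "b0 \<in> B1" unfolding A1_def B1_def using ab subset_residue_hull by auto
    have "A1 + B1 \<subseteq> F \<inter> P"
    proof
      fix z assume "z \<in> A1 + B1"
      then obtain a b where z: "z = a + b" "a \<in> A" "a mod d = a0 mod d" "b \<in> B" "b mod d = b0 mod d"
        by (auto elim!: set_plus_elim simp: A1_def B1_def residue_hull_def)
      have "z mod d = (a0 + b0) mod d" unfolding z(1) by (rule mod_add_cong[OF z(3,5)])
      then show "z \<in> F \<inter> P" using set_plus_intro[OF z(2,4)] z(1) unfolding F_def P_def residue_hull_def by simp
    qed
    then have "card (A1 + B1) \<le> card (F \<inter> P)" using finF by (intro card_mono) auto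
    moreover have "card A1 + card B1 \<le> card (A1 + B1) + 1"
      using ne fin by (intro card_int_sumset_ge) (auto simp: A1_def B1_def)
    ultimately have c1: "int (card A1) + int (card B1) \<le> int (card (F \<inter> P)) + 1" by linarith
    \<comment> \<open>Each further residue class modulo \<open>d\<close> met by \<open>X\<close>
      holds at most \<open>k\<close> elements of \<open>{0..<M}\<close>.\<close>
    have count: "int (card (X - residue_hull d {x0})) \<le> k * int (card ((\<lambda>x. x mod d) ` X)) - k"
      if X: "X \<subseteq> {0..<M}" "x0 mod d \<in> (\<lambda>x. x mod d) ` X" for X x0
    proof -
      have "residue_hull d {x0} \<subseteq> residue_hull d X" using X(2) by (auto simp: residue_hull_def)
      then have "rescount M (residue_hull d X) = rescount M (residue_hull d {x0}) + rescount M (residue_hull d X - residue_hull d {x0})"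
        using rescount_Un[of M "residue_hull d {x0}" "residue_hull d X"] by (simp add: Un_absorb1)
      moreover have "card (X - residue_hull d {x0}) \<le> rescount M (residue_hull d X - residue_hull d {x0})"
        unfolding rescount_def using X(1) subset_residue_hull[of X d] by (intro card_mono) auto
      ultimately show ?thesis using hull[of X] hull[of "{x0}"] by simp
    qed
    have M1: "M \<notin> A1"
    proof
      assume "M \<in> A1"
      then have "a0 mod d = 0" using d(2) unfolding A1_def residue_hull_def by simp
      then have "(a0 + b0) mod d = b0 mod d" using mod_add_left_eq[of a0 d b0] by simp
      then show False using ab unfolding residue_hull_def by blast
    qed
    have eqA: "(A - {M}) - residue_hull d {a0} = A - {M} - A1" unfolding A1_def by blast
    have imgA: "(\<lambda>x. x mod d) ` (A - {M}) = (\<lambda>x. x mod d) ` A"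
    proof -
      have "x mod d \<in> (\<lambda>x. x mod d) ` (A - {M})" if "x \<in> A" for x
      proof (cases "x = M")
        case True
        then have "x mod d = 0 mod d" using d(2) by simp
        moreover have "0 \<in> A - {M}" using A by simp
        ultimately show ?thesis by (rule image_eqI)
      qed (use that in blast)
      then show ?thesis by blast
    qed
    have "A - {M} \<subseteq> {0..<M}" using A(1) by force
    then have "int (card (A - {M} - A1)) \<le> k * u - k"
      using count[of "A - {M}" a0] ab(1) unfolding imgA eqA u_def by blast
    moreover have "card A = card (A - {M} - A1) + card A1 + 1"
    proof -
      have "A = insert M ((A - {M} - A1) \<union> A1)" using A(3) by (auto simp: A1_def)
      moreover have "card ((A - {M} - A1) \<union> A1) = card (A - {M} - A1) + card A1"
        using fin by (intro card_Un_disjoint) (auto simp: A1_def)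
      moreover have "M \<notin> (A - {M} - A1) \<union> A1" using M1 by blast
      ultimately show ?thesis using fin by (metis Suc_eq_plus1 card_insert_disjoint finite_insert)
    qed
    moreover have "int (card (B - B1)) \<le> k * v - k"
      using count[OF B(1), of b0] ab(2) unfolding B1_def v_def by (simp add: Diff_Int)
    moreover have "card B = card (B - B1) + card B1"
      using fin by (metis B1_def Int_lower1 add.commute card_Diff_subset card_mono finite_Int le_add_diff_inverse)
    moreover have "card F = card (F \<inter> P) + card (F - P)"
      using finF by (metis card_Diff_subset_Int card_mono finite_Int Int_lower1 le_add_diff_inverse)
    ultimately have "int (card A) + 2 * int (card B) \<le> int (card F) + 2" using c1 cCP by linarith
    then show ?thesis unfolding F_def by linarith
  qed
qed

section \<open>Rectification modulo a prime\<close>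

lemma set_plus_subsetI: "(\<And>a b. a \<in> A \<Longrightarrow> b \<in> B \<Longrightarrow> a + b \<in> C) \<Longrightarrow> A + B \<subseteq> C"
  by (auto elim!: set_plus_elim)

text \<open>Here \<open>B\<close> may contain \<open>M\<close>, as when both sets coincide. Removing
  \<open>M\<close> from \<open>B\<close> also removes the sum \<open>M + M\<close>: the first
  alternative is unchanged and the constant 2 of the second becomes 3.\<close>

corollary Lev_Smeliansky_le:
  fixes A B :: "int set" and M :: int
  assumes A: "A \<subseteq> {0..M}" "0 \<in> A" "M \<in> A" "0 < M" and gcd: "\<forall>d>0. (\<forall>a\<in>A. d dvd a) \<longrightarrow> d = 1"
    and B: "B \<subseteq> {0..M}" "B \<noteq> {}"
  shows "M + int (card B) \<le> int (card (A + B)) \<or> card A + 2 * card B \<le> card (A + B) + 3"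
proof (cases "M \<in> B")
  case False
  then have "B \<subseteq> {0..<M}" using B(1) by (auto simp: subset_iff less_le)
  then show ?thesis using Lev_Smeliansky[OF A gcd _ B(2)] by linarith
next
  case True
  define B' where "B' = B - {M}"
  have fin: "finite A" "finite B" "finite B'" using A(1) B(1) finite_subset unfolding B'_def by blast+
  have cB: "card B = card B' + 1" unfolding B'_def using card.remove[OF fin(2) True] by simp
  have "M + M \<notin> A + B'"
  proof
    assume "M + M \<in> A + B'"
    then obtain a b where "M + M = a + b" "a \<in> A" "b \<in> B'" by (auto elim: set_plus_elim)
    moreover from this have "a \<le> M" "b < M" using A(1) B(1) by (auto simp: B'_def subset_iff less_le)
    ultimately show False by simp
  qed
  moreover have "insert (M + M) (A + B') \<subseteq> A + B"
    using set_plus_intro[OF A(3) True] set_plus_mono2[of A A B' B] unfolding B'_def by blast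
  ultimately have c: "card (A + B') + 1 \<le> card (A + B)"
    using fin card_mono[of "A + B" "insert (M + M) (A + B')"] by (simp add: finite_set_plus)
  show ?thesis
  proof (cases "B' = {}")
    case True
    have "card A + card B \<le> card (A + B) + 1"
      using A(2) B(2) fin by (intro card_int_sumset_ge) auto
    then show ?thesis using cB True by simp
  next
    case False
    have "B' \<subseteq> {0..<M}" using B(1) unfolding B'_def by (auto simp: subset_iff less_le)
    from Lev_Smeliansky[OF A gcd this False] show ?thesis using c cB by linarith
  qed
qed

section \<open>Excluding an antipodal cluster\<close>

text \<open>The configuration to be excluded: \<open>E\<close> is the maximal rectified part of the set, \<open>Z\<close> is the rest of it, lying
  around the antipode of \<open>E\<close>, and \<open>S\<close> contains the sums modulo \<open>p\<close>. Below, \<open>q\<close> counts the sums in the arc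
  between \<open>2L\<close> and \<open>p\<close>, which \<open>2E\<close> does not reach.\<close>

locale two_clusters =
  fixes p L :: int and E Z S :: "int set"
  assumes E: "E \<subseteq> {0..L}" "0 \<in> E" "L \<in> E"
    and gcd: "\<forall>d>0. (\<forall>x\<in>E. d dvd x) \<longrightarrow> d = 1"
    and Z: "Z \<subseteq> {p - L..2 * L}" "Z \<noteq> {}" and p: "2 * L < p"
    and S: "S \<subseteq> {0..<p}" and sums: "\<And>x y. x \<in> E \<Longrightarrow> y \<in> E \<union> Z \<Longrightarrow> (x + y) mod p \<in> S"
    and sizes: "int (card S) + int (card E) + int (card Z) \<le> p" "card S + 4 \<le> 3 * card E"
      "4 * card S + 12 \<le> 9 * card E + 9 * card Z" "L + int (card E) \<le> int (card (E + E))"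
begin

definition q where "q = int (card (S \<inter> {2 * L + 1..p - 1}))"
definition D where "D = {2 * L + 1..p - 1} - S"
text \<open>Sums with \<open>Z\<close> may fall into the arc between \<open>2 * L\<close> and
  \<open>p\<close>, so it is not built in that \<open>X\<close> and \<open>Y\<close> are disjoint or
  cover \<open>E\<close>. Both are counting results below.\<close>

definition X where "X = {x \<in> E. \<forall>z\<in>Z. x + z < p}"
definition Y where "Y = {x \<in> E. \<forall>z\<in>Z. 2 * L < x + z}"

lemma fin: "finite E" "finite Z" "finite S" "finite D" "finite X" "finite Y"
proof -
  show "finite E" "finite Z" "finite S" using E(1) Z(1) S finite_subset by blast+
  then show "finite X" "finite Y" unfolding X_def Y_def by auto
  show "finite D" unfolding D_def by simp
qed

lemma E_bounds: "x \<in> E \<Longrightarrow> 0 \<le> x" "x \<in> E \<Longrightarrow> x \<le> L"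
  using E(1) by auto

lemma Z_bounds: "z \<in> Z \<Longrightarrow> p - L \<le> z" "z \<in> Z \<Longrightarrow> z \<le> 2 * L"
  using Z(1) by auto

lemma sum_in_S: "x \<in> E \<Longrightarrow> y \<in> E \<union> Z \<Longrightarrow> x + y < p \<Longrightarrow> x + y \<in> S"
  using sums[of x y] E_bounds[of x] E_bounds[of y] Z_bounds[of y] p
  by (cases "y \<in> E") auto

lemma L_pos: "0 < L"
proof (rule ccontr)
  assume "\<not> 0 < L"
  then have "E \<subseteq> {0}" using E(1) by auto
  then have "card E \<le> 1" using card_mono[of "{0}" E] by simp
  moreover have "card S \<noteq> 0" using sum_in_S[of 0 0] E(2) p fin(3) \<open>\<not> 0 < L\<close> \<open>E \<subseteq> {0}\<close> E(3) by auto
  ultimately show False using sizes(2) by linarith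
qed

lemma card_Z: "1 \<le> card Z"
  using Z(2) fin(2) by (simp add: Suc_le_eq card_gt_0_iff)

lemma q_nonneg: "0 \<le> q" by (simp add: q_def)

lemma low_sums:
  assumes "T \<subseteq> S" "T \<subseteq> {0..2 * L}"
  shows "int (card T) + q \<le> int (card S)"
proof -
  have "T \<inter> (S \<inter> {2 * L + 1..p - 1}) = {}" using assms(2) by force
  moreover have "finite T" using assms(2) finite_subset by blast
  ultimately have "int (card T) + q = int (card (T \<union> (S \<inter> {2 * L + 1..p - 1})))"
    unfolding q_def using fin(3) by (subst card_Un_disjoint) auto
  also have "\<dots> \<le> int (card S)" using assms(1) fin(3) by (simp add: card_mono)
  finally show ?thesis .
qed

text \<open>\<open>E + E\<close> stays within \<open>{0..2 * L}\<close>, so the \<open>q\<close>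
  sums in the arc come on top. With the last size hypothesis this gives the upper bound L + |E| + q
  \<le> |S| for \<open>L\<close>.\<close>

lemma card_EE: "int (card (E + E)) + q \<le> int (card S)"
proof (rule low_sums)
  show "E + E \<subseteq> S"
  proof (rule set_plus_subsetI)
    fix a b assume "a \<in> E" "b \<in> E"
    then show "a + b \<in> S" using sum_in_S[of a b] E_bounds(2)[of a] E_bounds(2)[of b] p by simp
  qed
  show "E + E \<subseteq> {0..2 * L}"
  proof (rule set_plus_subsetI)
    fix a b assume "a \<in> E" "b \<in> E"
    then show "a + b \<in> {0..2 * L}" using E_bounds[of a] E_bounds[of b] by simp
  qed
qed

lemma card_D: "int (card D) = p - 1 - 2 * L - q"
proof -
  have "{2 * L + 1..p - 1} = D \<union> (S \<inter> {2 * L + 1..p - 1})" unfolding D_def by auto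
  moreover have "card (D \<union> (S \<inter> {2 * L + 1..p - 1})) = card D + card (S \<inter> {2 * L + 1..p - 1})"
    using fin by (intro card_Un_disjoint) (auto simp: D_def)
  ultimately have "card {2 * L + 1..p - 1} = card D + card (S \<inter> {2 * L + 1..p - 1})" by simp
  then show ?thesis using p unfolding q_def by simp
qed

lemma card_holes: "int (card ({0..L} - E)) = L + 1 - int (card E)"
  using E(1) fin(1) L_pos card_mono[of "{0..L}" E] by (simp add: card_Diff_subset)

text \<open>If \<open>d - z\<close> were in \<open>E\<close>, then \<open>d = (d - z) + z\<close>
  would be a sum.\<close>

lemma diff_hole: "d \<in> D \<Longrightarrow> z \<in> Z \<Longrightarrow> d - z \<in> {0..L} - E"
  using sum_in_S[of "d - z" z] Z_bounds[of z] unfolding D_def by auto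

lemma diff_subset: "T \<subseteq> Z \<Longrightarrow> D + uminus ` T \<subseteq> {0..L} - E"
proof (rule set_plus_subsetI)
  fix a b assume "T \<subseteq> Z" "a \<in> D" "b \<in> uminus ` T"
  then obtain z where "b = - z" "z \<in> Z" by blast
  then show "a + b \<in> {0..L} - E" using diff_hole[OF \<open>a \<in> D\<close>, of z] by simp
qed

lemma D_nonempty: "D \<noteq> {}"
proof
  assume "D = {}"
  then show False using card_D card_EE sizes q_nonneg card_Z by simp
qed

lemma card_diff:
  assumes "T \<subseteq> Z" "T \<noteq> {}"
  shows "card D + card T \<le> card (D + uminus ` T) + 1"
proof -
  have "finite T" using assms(1) fin(2) finite_subset by blast
  then have "card D + card (uminus ` T) \<le> card (D + uminus ` T) + 1"
    using assms D_nonempty fin(4) by (intro card_int_sumset_ge) auto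
  then show ?thesis by (simp add: card_image)
qed

text \<open>The differences of \<open>D\<close> and \<open>Z\<close> are at least |D| + |Z| - 1
  holes of \<open>E\<close>, but only L + 1 - |E| holes exist. As all but \<open>q\<close> points of
  the arc are in \<open>D\<close>, a small \<open>L\<close> is impossible.\<close>

lemma L_lower: "int (card S) + 2 * int (card E) + 2 * int (card Z) - 3 - q \<le> 3 * L"
proof -
  have "card (D + uminus ` Z) \<le> card ({0..L} - E)" by (intro card_mono diff_subset) auto
  then have "int (card D) + int (card Z) \<le> L + 1 - int (card E) + 1"
    using card_diff[OF subset_refl Z(2)] card_holes by linarith
  then show ?thesis using card_D sizes(1) by linarith
qed

text \<open>The lower bound for \<open>L\<close> against the upper one. It ensures that two
  exceptional sets of at most \<open>q\<close> elements each do not exhaust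
  \<open>Z\<close>.\<close>

lemma many: "2 * q < int (card Z)"
  using L_lower card_EE sizes by linarith

lemma straddle: "\<rho> \<in> E \<Longrightarrow> int (card {z \<in> Z. 2 * L < \<rho> + z \<and> \<rho> + z < p}) \<le> q"
proof -
  assume "\<rho> \<in> E"
  let ?T = "{z \<in> Z. 2 * L < \<rho> + z \<and> \<rho> + z < p}"
  have "(+) \<rho> ` ?T \<subseteq> S \<inter> {2 * L + 1..p - 1}" using sum_in_S \<open>\<rho> \<in> E\<close> by auto
  then have "card ((+) \<rho> ` ?T) \<le> card (S \<inter> {2 * L + 1..p - 1})" by (intro card_mono) auto
  then show ?thesis unfolding q_def by (simp add: card_image)
qed

text \<open>If sums \<open>\<rho> + z\<close> occurred on both sides of the arc, then the holes \<open>D - z\<close> of \<open>E\<close> would lie on both sides of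
  \<open>\<rho>\<close>, and there would be too many of them.\<close>

lemma E_split: "E = X \<union> Y"
proof (rule ccontr)
  assume "E \<noteq> X \<union> Y"
  then obtain \<rho> where \<rho>: "\<rho> \<in> E" "\<rho> \<notin> X" "\<rho> \<notin> Y" unfolding X_def Y_def by blast
  define Z0 Z1 Z2 where "Z0 = {z \<in> Z. 2 * L < \<rho> + z \<and> \<rho> + z < p}"
    and "Z1 = {z \<in> Z. \<rho> + z \<le> 2 * L}" and "Z2 = {z \<in> Z. p \<le> \<rho> + z}"
  have ne: "Z1 \<noteq> {}" "Z2 \<noteq> {}" using \<rho> unfolding X_def Y_def Z1_def Z2_def by force+
  have sub: "Z1 \<subseteq> Z" "Z2 \<subseteq> Z" unfolding Z1_def Z2_def by auto
  have "Z = Z0 \<union> (Z1 \<union> Z2)" unfolding Z0_def Z1_def Z2_def by auto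
  then have "card Z \<le> card Z0 + (card Z1 + card Z2)"
    by (metis add_left_mono card_Un_le le_trans)
  moreover have "int (card Z0) \<le> q" unfolding Z0_def by (rule straddle[OF \<rho>(1)])
  moreover have "card (D + uminus ` Z1) + card (D + uminus ` Z2) \<le> card ({0..L} - E)"
  proof -
    have "x \<noteq> y" if xy: "x \<in> D + uminus ` Z1" "y \<in> D + uminus ` Z2" for x y
    proof -
      obtain d z where "d \<in> D" "z \<in> Z1" "x = d + - z" using xy(1) by (blast elim: set_plus_elim)
      then have "\<rho> < x" unfolding D_def Z1_def by auto
      moreover obtain d' z' where "d' \<in> D" "z' \<in> Z2" "y = d' + - z'" using xy(2) by (blast elim: set_plus_elim)
      then have "y < \<rho>" unfolding D_def Z2_def by auto
      ultimately show ?thesis by simp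
    qed
    then have "(D + uminus ` Z1) \<inter> (D + uminus ` Z2) = {}" by blast
    then have "card (D + uminus ` Z1) + card (D + uminus ` Z2) = card ((D + uminus ` Z1) \<union> (D + uminus ` Z2))"
      using fin sub finite_subset by (intro card_Un_disjoint[symmetric] finite_set_plus finite_imageI) auto
    also have "\<dots> \<le> card ({0..L} - E)"
      using diff_subset[OF sub(1)] diff_subset[OF sub(2)] by (intro card_mono Un_least) auto
    finally show ?thesis .
  qed
  ultimately have "2 * int (card D) + int (card Z) - q - 2 \<le> L + 1 - int (card E)"
    using card_diff[OF sub(1) ne(1)] card_diff[OF sub(2) ne(2)] card_holes by linarith
  then show False using card_D sizes card_EE q_nonneg by linarith
qed

lemma X_low: "\<rho> \<in> X \<Longrightarrow> int (card Z) - q \<le> int (card {z \<in> Z. \<rho> + z \<le> 2 * L})"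
proof -
  assume \<rho>: "\<rho> \<in> X"
  then have "Z = {z \<in> Z. 2 * L < \<rho> + z \<and> \<rho> + z < p} \<union> {z \<in> Z. \<rho> + z \<le> 2 * L}" unfolding X_def by auto
  then have "card Z \<le> card {z \<in> Z. 2 * L < \<rho> + z \<and> \<rho> + z < p} + card {z \<in> Z. \<rho> + z \<le> 2 * L}"
    by (metis card_Un_le)
  then show ?thesis using straddle[of \<rho>] \<rho> unfolding X_def by simp
qed

lemma Y_high: "\<rho> \<in> Y \<Longrightarrow> int (card Z) - q \<le> int (card {z \<in> Z. p \<le> \<rho> + z})"
proof -
  assume \<rho>: "\<rho> \<in> Y"
  then have "Z = {z \<in> Z. 2 * L < \<rho> + z \<and> \<rho> + z < p} \<union> {z \<in> Z. p \<le> \<rho> + z}" unfolding Y_def by auto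
  then have "card Z \<le> card {z \<in> Z. 2 * L < \<rho> + z \<and> \<rho> + z < p} + card {z \<in> Z. p \<le> \<rho> + z}"
    by (metis card_Un_le)
  then show ?thesis using straddle[of \<rho>] \<rho> unfolding Y_def by simp
qed

lemma zero_in_X: "0 \<in> X"
  using E Z_bounds p unfolding X_def by force

lemma L_in_Y: "L \<in> Y"
  using E Z_bounds p unfolding Y_def by force

text \<open>All but \<open>q\<close> elements \<open>z\<close> satisfy
  \<open>x + z \<le> 2 * L\<close>, and all but \<open>q\<close> satisfy
  \<open>p \<le> y + z\<close>. Those with both properties lie in \<open>{p - y..2 * L - x}\<close>,
  which must therefore be long.\<close>

lemma gap:
  assumes "x \<in> X" "y \<in> Y"
  shows "p - 1 - 2 * L + int (card Z) - 2 * q \<le> y - x"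
proof -
  let ?T = "{z \<in> Z. x + z \<le> 2 * L}" and ?U = "{z \<in> Z. p \<le> y + z}"
  have "card ?T + card ?U = card (?T \<union> ?U) + card (?T \<inter> ?U)" using fin(2) by (intro card_Un_Int) auto
  moreover have "card (?T \<union> ?U) \<le> card Z" using fin(2) by (intro card_mono) auto
  ultimately have c: "int (card Z) - 2 * q \<le> int (card (?T \<inter> ?U))" using X_low[OF assms(1)] Y_high[OF assms(2)] by linarith
  have "card (?T \<inter> ?U) \<le> card {p - y..2 * L - x}" by (intro card_mono) auto
  then show ?thesis using c many by simp
qed

lemma X_less_Y: "x \<in> X \<Longrightarrow> y \<in> Y \<Longrightarrow> x < y"
  using gap[of x y] many p by linarith

lemma card_X_Y: "card E = card X + card Y"
proof -
  have "X \<inter> Y = {}" using X_less_Y by blast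
  then show ?thesis using E_split card_Un_disjoint fin by metis
qed

text \<open>The integer theorem for \<open>E \<union> T\<close> and \<open>X\<close>, where
  \<open>T\<close> is chosen so that no sum passes \<open>2 * L\<close>. The choice of
  \<open>T\<close> may cost \<open>q\<close> elements of \<open>Z\<close>, but the \<open>q\<close>
  sums in the arc make up for it.\<close>

lemma X_bound:
  assumes x1: "x1 \<in> X" "\<And>x. x \<in> X \<Longrightarrow> x \<le> x1"
  shows "int (card E) + int (card Z) + 2 * int (card X) - 2 \<le> int (card S)"
proof -
  define T where "T = {z \<in> Z. x1 + z \<le> 2 * L}"
  have cT: "int (card Z) - q \<le> int (card T)" unfolding T_def by (rule X_low[OF x1(1)])
  have finT: "finite T" and TZ: "T \<subseteq> Z" unfolding T_def using fin(2) by auto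
  have "T \<noteq> {}" using cT many q_nonneg by auto
  define \<zeta> where "\<zeta> = Max T"
  have \<zeta>: "\<zeta> \<in> T" "\<And>z. z \<in> T \<Longrightarrow> z \<le> \<zeta>" unfolding \<zeta>_def using finT \<open>T \<noteq> {}\<close> by auto
  have \<zeta>b: "p - L \<le> \<zeta>" "x1 + \<zeta> \<le> 2 * L" using \<zeta>(1) Z_bounds unfolding T_def by auto
  have XE: "X \<subseteq> E" unfolding X_def by auto
  have EL: "z \<in> E \<Longrightarrow> z < \<zeta>" for z using E_bounds[of z] \<zeta>b p by simp
  have A: "E \<union> T \<subseteq> {0..\<zeta>}" "0 \<in> E \<union> T" "\<zeta> \<in> E \<union> T" "0 < \<zeta>"
    using EL E(2) \<zeta> TZ E_bounds Z_bounds(1) p L_pos \<zeta>b by force+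
  have B: "X \<subseteq> {0..<\<zeta>}" "X \<noteq> {}" using EL XE E_bounds x1(1) by force+
  have gcdA: "\<forall>d>0. (\<forall>a\<in>E \<union> T. d dvd a) \<longrightarrow> d = 1" using gcd by blast
  have subS: "(E \<union> T) + X \<subseteq> S" "(E \<union> T) + X \<subseteq> {0..2 * L}"
  proof -
    have *: "z \<in> S \<and> z \<in> {0..2 * L}" if zEX: "z \<in> (E \<union> T) + X" for z
    proof -
      obtain a x where ax: "z = a + x" "a \<in> E \<union> T" "x \<in> X" using zEX by (rule set_plus_elim)
      have x: "x \<in> E" "x \<le> x1" using XE x1(2)[OF ax(3)] ax(3) by blast+
      have b: "0 \<le> x + a \<and> x + a \<le> 2 * L"
      proof (cases "a \<in> E")
        case True
        then show ?thesis using E_bounds[OF x(1)] E_bounds[OF True] by simp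
      next
        case False
        then have "a \<in> T" using ax(2) by blast
        then have "x1 + a \<le> 2 * L" "p - L \<le> a" using Z_bounds(1)[of a] by (simp_all add: T_def)
        then show ?thesis using x E_bounds[OF x(1)] p L_pos by linarith
      qed
      have "x + a \<in> S"
      proof (rule sum_in_S[OF x(1)])
        show "a \<in> E \<union> Z" using ax(2) TZ by blast
        show "x + a < p" using b p by linarith
      qed
      then show ?thesis using b ax(1) by (simp add: add.commute)
    qed
    show "(E \<union> T) + X \<subseteq> S" "(E \<union> T) + X \<subseteq> {0..2 * L}" using * by blast+
  qed
  have cS: "int (card ((E \<union> T) + X)) + q \<le> int (card S)" using low_sums[OF subS] .
  have "E \<inter> T = {}" using E_bounds Z_bounds TZ p by force
  then have cET: "card (E \<union> T) = card E + card T" using fin finT by (intro card_Un_disjoint) auto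
  show ?thesis
  proof (cases "\<zeta> + int (card X) \<le> int (card ((E \<union> T) + X))")
    case False
    then have "card (E \<union> T) + 2 * card X \<le> card ((E \<union> T) + X) + 2"
      using Lev_Smeliansky[OF A gcdA B] by blast
    then show ?thesis using cET cT cS by linarith
  next
    case True
    \<comment> \<open>The diameter alternative. At most \<open>q\<close> elements of
      \<open>E\<close> are moved into the arc by \<open>\<zeta>\<close>, and those moved to at most
      \<open>2 * L\<close> belong to \<open>X\<close>. So the arc shifted back by
      \<open>\<zeta>\<close>, and the complement of \<open>X\<close> below it, contain more holes
      than \<open>E\<close> has.\<close>
    define Q where "Q = {\<rho> \<in> E. 2 * L < \<rho> + \<zeta> \<and> \<rho> + \<zeta> < p}"
    have "(\<lambda>\<rho>. \<rho> + \<zeta>) ` Q \<subseteq> S \<inter> {2 * L + 1..p - 1}"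
      using sum_in_S \<zeta>(1) TZ unfolding Q_def by auto
    then have "card ((\<lambda>\<rho>. \<rho> + \<zeta>) ` Q) \<le> card (S \<inter> {2 * L + 1..p - 1})" by (intro card_mono) auto
    then have cQ: "int (card Q) \<le> q" unfolding q_def by (simp add: card_image)
    let ?H1 = "{0..2 * L - \<zeta>} - X" and ?H2 = "{2 * L - \<zeta> + 1..p - \<zeta> - 1} - Q"
    have XH: "X \<subseteq> {0..2 * L - \<zeta>}" using x1 XE E_bounds \<zeta>b by force
    have "?H1 \<union> ?H2 \<subseteq> {0..L} - E"
    proof -
      have inX: "\<rho> \<in> X" if "\<rho> \<in> E" "\<rho> \<le> 2 * L - \<zeta>" for \<rho>
      proof -
        have "\<rho> \<notin> Y" using that \<zeta>(1) TZ unfolding Y_def by force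
        then show ?thesis using E_split that by blast
      qed
      have \<zeta>2: "\<zeta> \<le> 2 * L" using \<zeta>(1) TZ Z_bounds(2) by blast
      have "x \<in> {0..L} - E" if "x \<in> ?H1" for x
        using that inX[of x] \<zeta>b(1) p by auto
      moreover have "x \<in> {0..L} - E" if x: "x \<in> ?H2" for x
      proof -
        have "x \<notin> E" using x unfolding Q_def by auto
        then show ?thesis using x \<zeta>b(1) \<zeta>2 by auto
      qed
      ultimately show ?thesis by blast
    qed
    then have "card (?H1 \<union> ?H2) \<le> card ({0..L} - E)" by (intro card_mono) auto
    moreover have "card (?H1 \<union> ?H2) = card ?H1 + card ?H2" by (intro card_Un_disjoint) auto
    moreover have "int (card ?H1) = 2 * L - \<zeta> + 1 - int (card X)"
      using XH fin(5) card_mono[OF _ XH] \<zeta>b \<zeta>(1) TZ Z_bounds by (auto simp: card_Diff_subset)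
    moreover have "p - 1 - 2 * L - int (card Q) \<le> int (card ?H2)"
    proof -
      have "finite Q" unfolding Q_def using fin(1) by simp
      then have "card {2 * L - \<zeta> + 1..p - \<zeta> - 1} - card Q \<le> card ?H2" by (rule diff_card_le_card_Diff)
      then show ?thesis using p by simp
    qed
    ultimately have "p - \<zeta> - int (card X) - q \<le> L + 1 - int (card E)" using card_holes cQ by linarith
    then show ?thesis using True cS sizes card_EE q_nonneg by linarith
  qed
qed

text \<open>If \<open>Y\<close> is shorter than the gap, then \<open>E + X\<close> ends below
  \<open>2 * y1\<close>, where \<open>Y + Y\<close> begins. The two disjoint parts of
  \<open>E + E\<close> together are too large: \<open>X_bound\<close> and \<open>L_lower\<close>
  exclude the diameter alternative for \<open>E + X\<close>, the size of \<open>E\<close> excludes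
  the other.\<close>

lemma short_upper_cluster:
  assumes x1: "x1 \<in> X" "\<And>x. x \<in> X \<Longrightarrow> x \<le> x1" and y1: "y1 \<in> Y" "\<And>y. y \<in> Y \<Longrightarrow> y1 \<le> y"
    and short: "L - y1 < y1 - x1"
  shows False
proof -
  have XE: "X \<subseteq> E" "Y \<subseteq> E" using E_split by auto
  have "x1 < L" using X_less_Y[OF x1(1) L_in_Y] .
  then have B: "X \<subseteq> {0..<L}" "X \<noteq> {}" using x1 XE E_bounds by force+
  have disj: "(E + X) \<inter> (Y + Y) = {}"
  proof -
    have "u \<noteq> v" if uv: "u \<in> E + X" "v \<in> Y + Y" for u v
    proof -
      obtain e x where "u = e + x" "e \<in> E" "x \<in> X" using uv(1) by (rule set_plus_elim)
      then have "u \<le> L + x1" using x1(2)[of x] E_bounds(2)[of e] by simp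
      moreover obtain y y' where "v = y + y'" "y \<in> Y" "y' \<in> Y" using uv(2) by (rule set_plus_elim)
      then have "y1 + y1 \<le> v" using y1(2)[of y] y1(2)[of y'] by simp
      ultimately show ?thesis using short by simp
    qed
    then show ?thesis by blast
  qed
  have "card (E + X) + card (Y + Y) = card ((E + X) \<union> (Y + Y))"
    using disj fin by (intro card_Un_disjoint[symmetric] finite_set_plus) auto
  also have "\<dots> \<le> card (E + E)" using XE fin by (intro card_mono finite_set_plus) (auto intro: set_plus_mono2[THEN subsetD])
  finally have c: "card (E + X) + card (Y + Y) \<le> card (E + E)" .
  have "card Y + card Y \<le> card (Y + Y) + 1" using fin y1(1) by (intro card_int_sumset_ge) auto
  then have "card (E + X) + 2 * card Y \<le> card (E + E) + 1" using c by linarith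
  moreover have "L + int (card X) \<le> int (card (E + X)) \<or> card E + 2 * card X \<le> card (E + X) + 2"
    using Lev_Smeliansky[OF E L_pos gcd B] .
  ultimately show False
    using card_X_Y card_EE sizes X_bound[OF x1] L_lower q_nonneg by linarith
qed

end

lemma reflected_sum_mod: "(L - x + (L - y)) mod p = (2 * L - (x + y) mod p) mod (p :: int)"
  unfolding mod_diff_right_eq by (simp add: algebra_simps)

text \<open>The reflection \<open>x \<mapsto> L - x\<close> exchanges the roles of \<open>X\<close>
  and \<open>Y\<close>; it turns a sum \<open>v\<close> into \<open>2 * L - v\<close>.\<close>

lemma (in two_clusters) reflect:
  "two_clusters p L ((\<lambda>x. L - x) ` E) ((\<lambda>z. p + L - z) ` Z) ((\<lambda>v. (2 * L - v) mod p) ` S)"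
proof
  let ?E = "(\<lambda>x. L - x) ` E" and ?Z = "(\<lambda>z. p + L - z) ` Z" and ?S = "(\<lambda>v. (2 * L - v) mod p) ` S"
  have pp: "0 < p" using p L_pos by simp
  show "?E \<subseteq> {0..L}" using E_bounds by auto
  show "0 \<in> ?E" "L \<in> ?E" using E by force+
  show "\<forall>d>0. (\<forall>x\<in>?E. d dvd x) \<longrightarrow> d = 1"
  proof (intro allI impI)
    fix d :: int assume d: "0 < d" "\<forall>x\<in>?E. d dvd x"
    have "d dvd L" using d(2) E(2) by force
    moreover have "d dvd L - x" if "x \<in> E" for x using d(2) that by blast
    ultimately have "\<forall>x\<in>E. d dvd x" by (metis diff_diff_eq2 dvd_diff diff_add_cancel add_diff_cancel_left' diff_add_eq)
    then show "d = 1" using gcd d(1) by blast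
  qed
  show "?Z \<subseteq> {p - L..2 * L}" using Z_bounds by force
  show "?Z \<noteq> {}" using Z(2) by simp
  show "2 * L < p" by (rule p)
  show "?S \<subseteq> {0..<p}" using pp by auto
  show "(x + y) mod p \<in> ?S" if xy: "x \<in> ?E" "y \<in> ?E \<union> ?Z" for x y
  proof -
    obtain x' where x': "x = L - x'" "x' \<in> E" using xy(1) by blast
    obtain y' where y': "y' \<in> E \<union> Z" "y mod p = (L - y') mod p"
    proof (cases "y \<in> ?E")
      case True
      then show ?thesis using that by blast
    next
      case False
      then obtain z where z: "y = p + (L - z)" "z \<in> Z" using xy(2) by force
      have "y mod p = (L - z) mod p" unfolding z(1) by (rule mod_add_self1)
      then show ?thesis using that z(2) by blast
    qed
    have "(x + y) mod p = (L - x' + (L - y')) mod p"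
      unfolding x'(1) using y'(2) by (metis mod_add_right_eq)
    then show ?thesis using sums[OF x'(2) y'(1)] unfolding reflected_sum_mod by blast
  qed
  have cE: "card ?E = card E" and cZ: "card ?Z = card Z" by (simp_all add: card_image inj_on_def)
  have cS: "card ?S \<le> card S" using fin(3) by (rule card_image_le)
  have "?E + ?E = (\<lambda>v. 2 * L - v) ` (E + E)"
  proof
    show "?E + ?E \<subseteq> (\<lambda>v. 2 * L - v) ` (E + E)"
    proof (rule set_plus_subsetI)
      fix a b assume "a \<in> ?E" "b \<in> ?E"
      then obtain a' b' where ab: "a = L - a'" "b = L - b'" "a' \<in> E" "b' \<in> E" by blast
      then have "a + b = 2 * L - (a' + b')" by simp
      then show "a + b \<in> (\<lambda>v. 2 * L - v) ` (E + E)" using set_plus_intro[OF ab(3,4)] by blast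
    qed
    show "(\<lambda>v. 2 * L - v) ` (E + E) \<subseteq> ?E + ?E"
    proof
      fix w assume "w \<in> (\<lambda>v. 2 * L - v) ` (E + E)"
      then obtain v where v: "v \<in> E + E" "w = 2 * L - v" by blast
      obtain a b where ab: "v = a + b" "a \<in> E" "b \<in> E" using v(1) by (rule set_plus_elim)
      have "(L - a) + (L - b) \<in> ?E + ?E" using ab by (intro set_plus_intro imageI)
      moreover have "(L - a) + (L - b) = w" using v(2) ab(1) by simp
      ultimately show "w \<in> ?E + ?E" by (simp only:)
    qed
  qed
  then have cEE: "card (?E + ?E) = card (E + E)" by (simp add: card_image inj_on_def)
  show "int (card ?S) + int (card ?E) + int (card ?Z) \<le> p" "card ?S + 4 \<le> 3 * card ?E"
      "4 * card ?S + 12 \<le> 9 * card ?E + 9 * card ?Z" "L + int (card ?E) \<le> int (card (?E + ?E))"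
    unfolding cE cZ cEE using cS sizes by linarith+
qed

lemma (in two_clusters) impossible: False
proof -
  define x1 y1 where "x1 = Max X" and "y1 = Min Y"
  have neX: "X \<noteq> {}" and neY: "Y \<noteq> {}" using zero_in_X L_in_Y by blast+
  have x1: "x1 \<in> X" "\<And>x. x \<in> X \<Longrightarrow> x \<le> x1" unfolding x1_def using fin(5) neX by auto
  have y1: "y1 \<in> Y" "\<And>y. y \<in> Y \<Longrightarrow> y1 \<le> y" unfolding y1_def using fin(6) neY by auto
  \<comment> \<open>Either one of the outer pieces is shorter than the gap, or
    \<open>L \<ge> 3 * (y1 - x1)\<close>, which the lower bound for the gap contradicts.\<close>
  consider "L - y1 < y1 - x1" | "x1 < y1 - x1" | "y1 - x1 \<le> L - y1" "y1 - x1 \<le> x1" by linarith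
  then show False
  proof cases
    case 1
    then show False using short_upper_cluster[OF x1 y1] by blast
  next
    case 2
    interpret R: two_clusters p L "(\<lambda>x. L - x) ` E" "(\<lambda>z. p + L - z) ` Z" "(\<lambda>v. (2 * L - v) mod p) ` S"
      by (rule reflect)
    have "(\<forall>z\<in>(\<lambda>z. p + L - z) ` Z. L - x + z < p) \<longleftrightarrow> (\<forall>z\<in>Z. 2 * L < x + z)" for x
      by (simp, intro ball_cong) auto
    then have RX: "R.X = (\<lambda>x. L - x) ` Y" unfolding R.X_def Y_def by blast
    have "(\<forall>z\<in>(\<lambda>z. p + L - z) ` Z. 2 * L < L - x + z) \<longleftrightarrow> (\<forall>z\<in>Z. x + z < p)" for x
      by (simp, intro ball_cong) auto
    then have RY: "R.Y = (\<lambda>x. L - x) ` X" unfolding R.Y_def X_def by blast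
    show False
    proof (rule R.short_upper_cluster[of "L - y1" "L - x1"])
      show "L - y1 \<in> R.X" "L - x1 \<in> R.Y" unfolding RX RY using x1 y1 by blast+
      show "x \<le> L - y1" if "x \<in> R.X" for x using that y1(2) unfolding RX by auto
      show "L - x1 \<le> y" if "y \<in> R.Y" for y using that x1(2) unfolding RY by auto
      show "L - (L - x1) < L - x1 - (L - y1)" using 2 by simp
    qed
  next
    case 3
    then show False using gap[OF x1(1) y1(1)] card_EE sizes q_nonneg by linarith
  qed
qed

section \<open>From a maximal half circle to the whole set\<close>

text \<open>Points of \<open>A\<close> outside \<open>E\<close> on either side of the antipodal
  range are removed by the integer theorem for \<open>E\<close> and a longer part of
  \<open>A\<close> whose sums with \<open>E\<close> do not wrap around. What remains is the excluded
  configuration.\<close>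

lemma sumset_mod_rectifiable:
  fixes p L :: int and A S :: "int set"
  defines "E \<equiv> A \<inter> {x. 2 * x < p}"
  assumes A: "A \<subseteq> {0..<p}" and S: "S \<subseteq> {0..<p}" "\<And>x y. x \<in> A \<Longrightarrow> y \<in> A \<Longrightarrow> (x + y) mod p \<in> S"
    and sizes: "int (card S) + int (card A) \<le> p" "4 * card S + 12 \<le> 9 * card A" "card S + 4 \<le> 3 * card E"
    and L: "E \<subseteq> {0..L}" "0 \<in> E" "L \<in> E" and gcd: "\<forall>d>0. (\<forall>x\<in>E. d dvd x) \<longrightarrow> d = 1"
    and EE: "L + int (card E) \<le> int (card (E + E))"
    and half: "\<And>c. card {x \<in> A. 2 * ((x + c) mod p) < p} \<le> card E"
  shows "A = E"
proof (rule ccontr)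
  assume "A \<noteq> E"
  define Z where "Z = A - E"
  have EA: "E \<subseteq> A" unfolding E_def by blast
  have neZ: "Z \<noteq> {}" using \<open>A \<noteq> E\<close> EA unfolding Z_def by blast
  have L2: "2 * L < p" using L(3) unfolding E_def by simp
  have "finite A" using finite_subset[OF A] by simp
  then have fin: "finite A" "finite E" "finite S" using finite_subset[OF S(1)] finite_subset[OF EA] by simp_all
  have Zp: "p \<le> 2 * z" "z \<in> A" "z < p" if "z \<in> Z" for z
    using that A unfolding Z_def E_def by auto
  have L0: "0 \<le> L" using L by auto
  have Eb: "0 \<le> x" "x \<le> L" if "x \<in> E" for x using that L(1) by auto
  have big: False if "M + int (card E) \<le> int (card S)" "p \<le> 2 * M" for M
    using that sizes by linarith
  have low: "p - L \<le> a" if a: "a \<in> Z" for a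
  proof (rule ccontr)
    assume na: "\<not> p - L \<le> a"
    \<comment> \<open>Below \<open>p - L\<close> adding \<open>E\<close> does not wrap around. The
      point \<open>a\<close> makes the diameter of \<open>B\<close> at least p/2, so
      \<open>big\<close> excludes the first alternative, and |B| \<ge> |E| excludes the
      second.\<close>
    define B where "B = {x \<in> A. x < p - L}"
    have finB: "finite B" unfolding B_def using fin(1) by simp
    have aB: "a \<in> B" unfolding B_def using Zp[OF a] na by simp
    define M where "M = Max B"
    have M: "M \<in> B" "\<And>x. x \<in> B \<Longrightarrow> x \<le> M" unfolding M_def using finB aB by (auto intro: Max_in)
    have pM: "p \<le> 2 * M" using M(2)[OF aB] Zp(1)[OF a] by simp
    have EB: "E \<subseteq> B" unfolding B_def using EA Eb(2) L2 by force
    have B: "B \<subseteq> {0..M}" using M(2) A unfolding B_def by auto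
    have "E \<subseteq> {0..M}" "E \<noteq> {}" using EB B L(2) by blast+
    moreover have "0 < M" using pM L2 L0 by simp
    moreover have "\<forall>d>0. (\<forall>x\<in>B. d dvd x) \<longrightarrow> d = 1" using gcd EB by blast
    ultimately have LS: "M + int (card E) \<le> int (card (B + E)) \<or> card B + 2 * card E \<le> card (B + E) + 3"
      using Lev_Smeliansky_le[OF B _ M(1), of E] L(2) EB by blast
    have "B + E \<subseteq> S"
    proof (rule set_plus_subsetI)
      fix x e assume xe: "x \<in> B" "e \<in> E"
      have "(x + e) mod p = x + e" using xe A Eb[OF xe(2)] unfolding B_def by (intro mod_pos_pos_trivial) auto
      then show "x + e \<in> S" using S(2)[of x e] xe EA unfolding B_def by auto
    qed
    then have "card (B + E) \<le> card S" using fin(3) by (rule card_mono[rotated])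
    moreover have "card E \<le> card B" using EB finB by (intro card_mono)
    ultimately show False using LS big[OF _ pM] sizes(3) by linarith
  qed
  have high: "a \<le> 2 * L" if a: "a \<in> Z" for a
  proof (rule ccontr)
    assume na: "\<not> a \<le> 2 * L"
    \<comment> \<open>\<open>f\<close> is \<open>x \<mapsto> L - x\<close> modulo \<open>p\<close>
      with values below \<open>p - L\<close>, so that adding the reflected \<open>E\<close> does not
      wrap around.\<close>
    define f where "f x = (if x \<le> L then L - x else L + p - x)" for x
    define U where "U = {x \<in> A. x \<le> L \<or> 2 * L < x}"
    define B where "B = f ` U"
    define E' where "E' = (\<lambda>x. L - x) ` E"
    have finB: "finite B" unfolding B_def U_def using fin(1) by simp
    have EU: "E \<subseteq> U" unfolding U_def using EA Eb(2) by blast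
    have E'f: "E' = f ` E" unfolding E'_def f_def using Eb(2) by (intro image_cong) auto
    have EB: "E' \<subseteq> B" unfolding E'f B_def using EU by blast
    have fb: "0 \<le> f x" "f x < p - L" "f x mod p = (L - x) mod p" if "x \<in> U" for x
    proof -
      have "L + p - x = p + (L - x)" by simp
      then have "(L + p - x) mod p = (L - x) mod p" by (metis mod_add_self1)
      then show "f x mod p = (L - x) mod p" unfolding f_def by simp
      show "0 \<le> f x" "f x < p - L" using that A L2 L0 unfolding f_def U_def by auto
    qed
    have aU: "a \<in> U" unfolding U_def using Zp[OF a] na by simp
    define M where "M = Max B"
    have M: "M \<in> B" "\<And>x. x \<in> B \<Longrightarrow> x \<le> M" unfolding M_def using finB aU by (auto simp: B_def intro: Max_in)
    have B: "B \<subseteq> {0..M}" using M(2) fb(1) unfolding B_def by auto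
    have "f a \<le> M" using M(2) aU unfolding B_def by blast
    then have M0: "0 < M" using na Zp(3)[OF a] L0 unfolding f_def by simp
    have E': "E' \<subseteq> {0..M}" "E' \<noteq> {}" "0 \<in> B" using EB B L unfolding E'_def by force+
    have gcdB: "\<forall>d>0. (\<forall>x\<in>B. d dvd x) \<longrightarrow> d = 1"
    proof (intro allI impI)
      fix d :: int assume d: "0 < d" "\<forall>x\<in>B. d dvd x"
      then have *: "d dvd L - x" if "x \<in> E" for x using that EB unfolding E'_def by blast
      have "d dvd L" using *[OF L(2)] by simp
      then have "\<forall>x\<in>E. d dvd x" using * by (metis dvd_diff diff_diff_eq2 add_diff_cancel_left')
      then show "d = 1" using gcd d(1) by blast
    qed
    have LS: "M + int (card E') \<le> int (card (B + E')) \<or> card B + 2 * card E' \<le> card (B + E') + 3"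
      by (rule Lev_Smeliansky_le[OF B E'(3) M(1) M0 gcdB E'(1,2)])
    have cE': "card E' = card E" unfolding E'_def by (simp add: card_image inj_on_def)
    have "card (B + E') \<le> card S"
    proof (rule card_inj_on_le[where f = "\<lambda>v. (2 * L - v) mod p"])
      have bnd: "0 \<le> v \<and> v < p" if v: "v \<in> B + E'" for v
      proof -
        obtain b e where be: "v = b + e" "b \<in> B" "e \<in> E'" using v by (rule set_plus_elim)
        have "0 \<le> b" "b < p - L" using be(2) fb unfolding B_def by auto
        moreover have "0 \<le> e" "e \<le> L" using be(3) Eb unfolding E'_def by auto
        ultimately show ?thesis using be(1) by simp
      qed
      show "inj_on (\<lambda>v. (2 * L - v) mod p) (B + E')"
      proof (rule inj_onI)
        fix v w assume vw: "v \<in> B + E'" "w \<in> B + E'" and "(2 * L - v) mod p = (2 * L - w) mod p"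
        then have "p dvd (2 * L - v) - (2 * L - w)" by (simp only: mod_eq_dvd_iff)
        then have "p dvd w - v" by simp
        then have "w mod p = v mod p" by (simp only: mod_eq_dvd_iff)
        then show "v = w" using bnd[OF vw(1)] bnd[OF vw(2)] by simp
      qed
      show "(\<lambda>v. (2 * L - v) mod p) ` (B + E') \<subseteq> S"
      proof
        fix w assume "w \<in> (\<lambda>v. (2 * L - v) mod p) ` (B + E')"
        then obtain v where v: "v \<in> B + E'" "w = (2 * L - v) mod p" by blast
        obtain b e where be: "v = b + e" "b \<in> B" "e \<in> E'" using v(1) by (rule set_plus_elim)
        obtain x where x: "x \<in> U" "b = f x" using be(2) unfolding B_def by blast
        obtain y where y: "y \<in> E" "e = L - y" using be(3) unfolding E'_def by blast
        have "(b + e) mod p = (L - x + (L - y)) mod p"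
          unfolding x(2) y(2) using fb(3)[OF x(1)] by (metis mod_add_left_eq)
        then have "p dvd (b + e) - (L - x + (L - y))" by (simp only: mod_eq_dvd_iff)
        also have "(b + e) - (L - x + (L - y)) = (x + y) - (2 * L - v)" using be(1) by simp
        finally have "(x + y) mod p = w" unfolding v(2) by (simp only: mod_eq_dvd_iff)
        moreover have "(x + y) mod p \<in> S" using x y EA unfolding U_def by (intro S(2)) auto
        ultimately show "w \<in> S" by simp
      qed
    qed (rule fin(3))
    moreover have "card E' \<le> card B" using EB finB by (intro card_mono)
    ultimately have "M + int (card E) \<le> int (card S)" using LS sizes(3) unfolding cE' by linarith
    \<comment> \<open>The reflected point may be close to 0, so there is no lower bound on the
      diameter here. Instead the diameter is below p/2, hence a half circle contains
      \<open>E\<close> and \<open>a\<close>, against maximality.\<close>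
    then have M2: "2 * M < p" using big[of M] not_le by blast
    have fold: "(x + (M - L)) mod p = M - f x" if "x \<in> U" for x
    proof -
      have "f x \<le> M" using M(2) that unfolding B_def by blast
      have "p dvd (x + (M - L)) - (M - f x)"
        using fb(3)[OF that] by (simp add: mod_eq_dvd_iff algebra_simps)
      then have "(x + (M - L)) mod p = (M - f x) mod p" by (simp only: mod_eq_dvd_iff)
      also have "\<dots> = M - f x" using \<open>f x \<le> M\<close> fb(1)[OF that] M2 M0 by (intro mod_pos_pos_trivial) auto
      finally show ?thesis .
    qed
    have half': "2 * ((x + (M - L)) mod p) < p" if "x \<in> U" for x using M2 fold[OF that] fb(1)[OF that] by simp
    have "insert a E \<subseteq> {x \<in> A. 2 * ((x + (M - L)) mod p) < p}"
      using half' aU EU EA Zp(2)[OF a] by blast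
    then have "card (insert a E) \<le> card {x \<in> A. 2 * ((x + (M - L)) mod p) < p}"
      by (rule card_mono[rotated]) (use fin(1) in simp)
    then have "card (insert a E) \<le> card E" using half[of "M - L"] by (rule le_trans)
    moreover have "a \<notin> E" using a unfolding Z_def by blast
    ultimately show False using fin(2) by simp
  qed
  have "card A = card E + card Z" unfolding Z_def using EA fin by (simp add: card_Diff_subset card_mono)
  moreover have "(x + y) mod p \<in> S" if "x \<in> E" "y \<in> E \<union> Z" for x y
    using S(2)[of x y] that EA unfolding Z_def by blast
  moreover have "Z \<subseteq> {p - L..2 * L}" using low high by auto
  ultimately have "two_clusters p L E Z S"
    using L gcd neZ L2 S(1) EE sizes by unfold_locales simp_all
  then show False by (rule two_clusters.impossible)
qed

section \<open>Long intervals in dense sumsets\<close>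

text \<open>If \<open>z\<close> is not a sum, each pair \<open>i\<close>, \<open>z - i\<close>
  contains a hole, so holes make up half of \<open>{0..z}\<close>; similarly from above. Since holes
  are few, missing sums occur only near the two ends, within a total length of twice the number of
  holes.\<close>

lemma sumset_long_interval:
  fixes L :: int and B :: "int set"
  assumes B: "B \<subseteq> {0..L}" "0 \<le> L" and dense: "3 * L + 3 \<le> 4 * int (card B)"
  shows "\<exists>v. {v..<v + 2 * int (card B) - 1} \<subseteq> B + B"
proof -
  define H where "H = {0..L} - B"
  have fin: "finite B" "finite H" using finite_subset[OF B(1)] unfolding H_def by auto
  have cH: "int (card H) = L + 1 - int (card B)"
    unfolding H_def using B fin(1) card_mono[of "{0..L}" B] by (simp add: card_Diff_subset)
  define lo hi where "lo = {z \<in> {0..L}. z \<notin> B + B}" and "hi = {z \<in> {0..L}. z + L \<notin> B + B}"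
  have low: "z + 1 \<le> 2 * int (card (H \<inter> {0..z}))" if "z \<in> lo" for z
  proof -
    have "{0..z} \<subseteq> (H \<inter> {0..z}) \<union> (\<lambda>i. z - i) ` (H \<inter> {0..z})"
    proof
      fix i assume i: "i \<in> {0..z}"
      have "i \<notin> B \<or> z - i \<notin> B" using that set_plus_intro[of i B "z - i" B] unfolding lo_def by auto
      moreover have "z \<le> L" using that unfolding lo_def by simp
      moreover have "i = z - (z - i)" by simp
      ultimately show "i \<in> (H \<inter> {0..z}) \<union> (\<lambda>i. z - i) ` (H \<inter> {0..z})"
        using i unfolding H_def by (auto intro!: image_eqI[of _ _ "z - i"])
    qed
    then have "card {0..z} \<le> card ((H \<inter> {0..z}) \<union> (\<lambda>i. z - i) ` (H \<inter> {0..z}))"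
      using fin by (intro card_mono) auto
    also have "\<dots> \<le> card (H \<inter> {0..z}) + card ((\<lambda>i. z - i) ` (H \<inter> {0..z}))" by (rule card_Un_le)
    also have "card ((\<lambda>i. z - i) ` (H \<inter> {0..z})) = card (H \<inter> {0..z})" by (simp add: card_image inj_on_def)
    finally show ?thesis using that unfolding lo_def by simp
  qed
  have high: "L - z + 1 \<le> 2 * int (card (H \<inter> {z..L}))" if "z \<in> hi" for z
  proof -
    have "{z..L} \<subseteq> (H \<inter> {z..L}) \<union> (\<lambda>i. z + L - i) ` (H \<inter> {z..L})"
    proof
      fix i assume i: "i \<in> {z..L}"
      have "i \<notin> B \<or> z + L - i \<notin> B" using that set_plus_intro[of i B "z + L - i" B] unfolding hi_def by auto
      moreover have "0 \<le> z" using that unfolding hi_def by simp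
      moreover have "i = z + L - (z + L - i)" by simp
      ultimately show "i \<in> (H \<inter> {z..L}) \<union> (\<lambda>i. z + L - i) ` (H \<inter> {z..L})"
        using i unfolding H_def by (auto intro!: image_eqI[of _ _ "z + L - i"])
    qed
    then have "card {z..L} \<le> card ((H \<inter> {z..L}) \<union> (\<lambda>i. z + L - i) ` (H \<inter> {z..L}))"
      using fin by (intro card_mono) auto
    also have "\<dots> \<le> card (H \<inter> {z..L}) + card ((\<lambda>i. z + L - i) ` (H \<inter> {z..L}))" by (rule card_Un_le)
    also have "card ((\<lambda>i. z + L - i) ` (H \<inter> {z..L})) = card (H \<inter> {z..L})" by (simp add: card_image inj_on_def)
    finally show ?thesis using that unfolding hi_def by simp
  qed
  have finlh: "finite lo" "finite hi" unfolding lo_def hi_def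
    by (rule finite_subset[of _ "{0..L}"]; auto)+
  \<comment> \<open>All of \<open>{v0..<L + v1}\<close> will be sums; the default values say that
    nothing is missing at the respective end.\<close>
  define v0 where "v0 = (if lo = {} then 0 else Max lo + 1)"
  define v1 where "v1 = (if hi = {} then L + 1 else Min hi)"
  have v0: "0 \<le> v0" "v0 \<le> 2 * int (card (H \<inter> {0..<v0}))"
  proof -
    have "0 \<le> v0 \<and> v0 \<le> 2 * int (card (H \<inter> {0..<v0}))"
    proof (cases "lo = {}")
      case False
      then have "Max lo \<in> lo" using finlh by simp
      then have "Max lo + 1 \<le> 2 * int (card (H \<inter> {0..Max lo}))" "0 \<le> Max lo"
        using low by (blast, simp add: lo_def)
      moreover have "{0..Max lo} = {0..<Max lo + 1}" by auto
      ultimately show ?thesis using False unfolding v0_def by simp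
    qed (simp add: v0_def)
    then show "0 \<le> v0" "v0 \<le> 2 * int (card (H \<inter> {0..<v0}))" by blast+
  qed
  have v1: "v1 \<le> L + 1" "L + 1 - v1 \<le> 2 * int (card (H \<inter> {v1..L}))"
  proof -
    have "v1 \<le> L + 1 \<and> L + 1 - v1 \<le> 2 * int (card (H \<inter> {v1..L}))"
    proof (cases "hi = {}")
      case False
      then have "Min hi \<in> hi" using finlh by simp
      then have "L - Min hi + 1 \<le> 2 * int (card (H \<inter> {Min hi..L}))" "Min hi \<le> L"
        using high by (blast, simp add: hi_def)
      then show ?thesis using False unfolding v1_def by simp
    qed (simp add: v1_def)
    then show "v1 \<le> L + 1" "L + 1 - v1 \<le> 2 * int (card (H \<inter> {v1..L}))" by blast+
  qed
  \<comment> \<open>Density means 4 |H| \<le> L + 1, so neither end reaches the middle. The holes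
    charged to the two ends are then distinct, and their numbers add up to at most |H|.\<close>
  have "card (H \<inter> {0..<v0}) \<le> card H" "card (H \<inter> {v1..L}) \<le> card H" using fin by (simp_all add: card_mono)
  then have le: "v0 \<le> v1" using v0 v1 cH dense by linarith
  then have "(H \<inter> {0..<v0}) \<inter> (H \<inter> {v1..L}) = {}" by auto
  then have "card (H \<inter> {0..<v0}) + card (H \<inter> {v1..L}) = card ((H \<inter> {0..<v0}) \<union> (H \<inter> {v1..L}))"
    using fin by (intro card_Un_disjoint[symmetric]) auto
  also have "\<dots> \<le> card H" using fin by (intro card_mono) auto
  finally have len: "2 * int (card B) - 1 \<le> L + v1 - v0" using v0 v1 cH by linarith
  have "x \<in> B + B" if x: "v0 \<le> x" "x < L + v1" for x
  proof (cases "x \<le> L")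
    case True
    have "x \<notin> lo"
    proof
      assume "x \<in> lo"
      then have "x \<le> Max lo" "lo \<noteq> {}" using finlh by auto
      then show False using x unfolding v0_def by simp
    qed
    then show ?thesis using True x v0 unfolding lo_def by simp
  next
    case False
    have "x - L \<notin> hi"
    proof
      assume "x - L \<in> hi"
      then have "Min hi \<le> x - L" "hi \<noteq> {}" using finlh by auto
      then show False using x unfolding v1_def by simp
    qed
    then show ?thesis using False x v1 unfolding hi_def by simp
  qed
  then have "{v0..<v0 + 2 * int (card B) - 1} \<subseteq> B + B" using len by auto
  then show ?thesis by blast
qed

section \<open>Affine maps modulo p and the best dilate\<close>

lemma affine_mod_inj:
  fixes p u :: int
  assumes "coprime u p"
  shows "inj_on (\<lambda>x. (u * x + c) mod p) {0..<p}"
proof (rule inj_onI)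
  fix x y assume xy: "x \<in> {0..<p}" "y \<in> {0..<p}" and "(u * x + c) mod p = (u * y + c) mod p"
  then have "p dvd (u * x + c) - (u * y + c)" by (simp only: mod_eq_dvd_iff)
  also have "(u * x + c) - (u * y + c) = u * (x - y)" by (simp add: algebra_simps)
  finally have "p dvd x - y" using assms by (simp add: coprime_commute coprime_dvd_mult_right_iff)
  then have "x mod p = y mod p" by (simp only: mod_eq_dvd_iff)
  then show "x = y" using xy by simp
qed

lemma affine_mod_add:
  fixes p u :: int
  shows "((u * x + c) mod p + (u * y + c) mod p) mod p = (u * ((x + y) mod p) + 2 * c) mod p"
proof -
  have "((u * x + c) mod p + (u * y + c) mod p) mod p = (u * (x + y) + 2 * c) mod p"
    by (simp add: mod_add_eq algebra_simps)
  also have "\<dots> = (u * ((x + y) mod p) + 2 * c) mod p"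
    by (metis mod_add_left_eq mod_mult_right_eq)
  finally show ?thesis .
qed

text \<open>Subtracting the minimum and dividing by the gcd brings the richest half circle into the
  normal form of the integer theorem. Division by \<open>g\<close> is dilation by its inverse
  \<open>g'\<close> modulo \<open>p\<close>, so the result is again one of the competitors and
  maximality carries over.\<close>

theorem rectification:
  fixes p :: int and A S :: "int set"
  assumes p: "prime p" and A: "A \<subseteq> {0..<p}"
    and S: "S \<subseteq> {0..<p}" "\<And>x y. x \<in> A \<Longrightarrow> y \<in> A \<Longrightarrow> (x + y) mod p \<in> S"
    and sizes: "int (card S) + int (card A) \<le> p" "4 * card S + 12 \<le> 9 * card A"
    and half: "coprime u0 p" "card S + 4 \<le> 3 * card {x \<in> A. 2 * ((u0 * x + c0) mod p) < p}"
  obtains u c L where "coprime u p" "(\<lambda>x. (u * x + c) mod p) ` A \<subseteq> {0..L}" "0 \<le> L" "2 * L < p"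
    "L + int (card A) \<le> int (card S)"
proof -
  have pp: "0 < p" using p by (simp add: prime_gt_0_int)
  have fin: "finite A" "finite S" using finite_subset[OF A] finite_subset[OF S(1)] by simp_all
  define N where "N u c = card {x \<in> A. 2 * ((u * x + c) mod p) < p}" for u c
  have "\<exists>uc. coprime (fst uc) p \<and> (\<forall>uc'. coprime (fst uc') p \<longrightarrow> N (fst uc') (snd uc') \<le> N (fst uc) (snd uc))"
  proof (rule ex_has_greatest_nat[where k = "(u0, c0)" and b = "card A + 1"])
    show "coprime (fst (u0, c0)) p" using half(1) by simp
    show "\<forall>uc. coprime (fst uc) p \<longrightarrow> N (fst uc) (snd uc) < card A + 1"
      unfolding N_def using fin(1) by (auto simp: less_Suc_eq_le intro!: card_mono)
  qed
  then obtain u c where uc: "coprime u p" and max: "\<And>u' c'. coprime u' p \<Longrightarrow> N u' c' \<le> N u c" by auto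
  have N: "card S + 4 \<le> 3 * N u c" using max[OF half(1), of c0] half(2) unfolding N_def by linarith
  define f where "f x = (u * x + c) mod p" for x
  define A0 where "A0 = {x \<in> A. 2 * f x < p}"
  define E0 where "E0 = f ` A0"
  have injf: "inj_on f A" unfolding f_def using inj_on_subset[OF affine_mod_inj[OF uc] A] .
  have A0A: "A0 \<subseteq> A" unfolding A0_def by blast
  have cE0: "card E0 = N u c"
    unfolding E0_def N_def using card_image[OF inj_on_subset[OF injf A0A]] by (simp add: A0_def f_def)
  have finE0: "finite E0" unfolding E0_def A0_def using fin(1) by simp
  have E0b: "0 \<le> e" "2 * e < p" if "e \<in> E0" for e
    using that pp unfolding E0_def A0_def f_def by auto
  have "card (E0 + E0) \<le> card S"
  proof (rule surj_card_le)
    show "E0 + E0 \<subseteq> (\<lambda>v. (u * v + 2 * c) mod p) ` S"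
    proof (rule set_plus_subsetI)
      fix a b assume ab: "a \<in> E0" "b \<in> E0"
      obtain x y where xy: "a = f x" "b = f y" "x \<in> A" "y \<in> A" using ab A0A unfolding E0_def by blast
      have "a + b = (a + b) mod p" using E0b[OF ab(1)] E0b[OF ab(2)] by simp
      also have "\<dots> = (u * ((x + y) mod p) + 2 * c) mod p" unfolding xy f_def by (rule affine_mod_add)
      finally show "a + b \<in> (\<lambda>v. (u * v + 2 * c) mod p) ` S" using S(2)[OF xy(3,4)] by blast
    qed
  qed (rule fin(2))
  have "A \<noteq> {}" using sizes(2) by auto
  then have "S \<noteq> {}" using S(2) by blast
  then have "1 \<le> card S" using fin(2) by (simp add: Suc_le_eq card_gt_0_iff)
  then have n2: "2 \<le> card E0" using N cE0 by linarith
  have neE0: "E0 \<noteq> {}" using n2 by auto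
  define m where "m = Min E0"
  have m: "m \<in> E0" "\<And>e. e \<in> E0 \<Longrightarrow> m \<le> e" unfolding m_def using finE0 neE0 by auto
  define g where "g = Gcd ((\<lambda>e. e - m) ` E0)"
  have gd: "g dvd e - m" if "e \<in> E0" for e unfolding g_def using that by (intro Gcd_dvd) auto
  have "\<not> E0 \<subseteq> {m}" using n2 card_mono[of "{m}" E0] by auto
  then obtain e1 where e1: "e1 \<in> E0" "e1 \<noteq> m" by blast
  then have "m < e1" using m(2)[OF e1(1)] by simp
  have g0: "0 < g"
  proof -
    have "g \<noteq> 0" using gd[OF e1(1)] e1(2) by auto
    moreover have "0 \<le> g" unfolding g_def by simp
    ultimately show ?thesis by simp
  qed
  have "g \<le> e1 - m" using gd[OF e1(1)] \<open>m < e1\<close> by (intro zdvd_imp_le) auto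
  then have "g < p" using E0b[OF e1(1)] E0b[OF m(1)] by simp
  then have "\<not> p dvd g" using g0 zdvd_not_zless by blast
  then have "coprime g p" using p prime_imp_coprime coprime_commute by blast
  then obtain g' where g': "[g * g' = 1] (mod p)" using cong_solve_coprime_int by blast
  have copg': "coprime g' p" using g' by (metis cong_imp_coprime cong_sym coprime_1_left coprime_mult_left_iff)
  define E where "E = (\<lambda>e. (e - m) div g) ` E0"
  define L where "L = Max E"
  have Eg: "g * ((e - m) div g) = e - m" if "e \<in> E0" for e using gd[OF that] by simp
  have injE: "inj_on (\<lambda>e. (e - m) div g) E0"
    by (rule inj_onI) (metis Eg add_diff_cancel_left' diff_add_cancel)
  have cE: "card E = N u c" unfolding E_def cE0[symmetric] by (rule card_image[OF injE])
  have finE: "finite E" and neE: "E \<noteq> {}" unfolding E_def using finE0 neE0 by simp_all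
  have E_pos: "0 \<le> x" if "x \<in> E" for x
    using that m(2) g0 unfolding E_def by (auto simp: pos_imp_zdiv_nonneg_iff)
  have EL: "E \<subseteq> {0..L}" "0 \<in> E" "L \<in> E"
    using E_pos finE neE m(1) unfolding L_def E_def by (auto intro!: image_eqI[of 0 _ m])
  have gcdE: "\<forall>d>0. (\<forall>x\<in>E. d dvd x) \<longrightarrow> d = 1"
  proof (intro allI impI)
    fix d :: int assume d: "0 < d" "\<forall>x\<in>E. d dvd x"
    have "g * d dvd g"
      unfolding g_def
    proof (rule Gcd_greatest, elim imageE)
      fix z e assume "z = e - m" "e \<in> E0"
      then have "d dvd (e - m) div g" using d(2) unfolding E_def by blast
      then have "g * d dvd g * ((e - m) div g)" by simp
      then have "g * d dvd z" unfolding Eg[OF \<open>e \<in> E0\<close>] \<open>z = e - m\<close> .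
      then show "Gcd ((\<lambda>e. e - m) ` E0) * d dvd z" unfolding g_def .
    qed
    then have "d dvd 1" using g0 by simp
    then show "d = 1" using d(1) by simp
  qed
  have cEE: "card (E + E) \<le> card (E0 + E0)"
  proof (rule card_inj_on_le[where f = "\<lambda>v. g * v + 2 * m"])
    show "inj_on (\<lambda>v. g * v + 2 * m) (E + E)" using g0 by (simp add: inj_on_def)
    show "(\<lambda>v. g * v + 2 * m) ` (E + E) \<subseteq> E0 + E0"
    proof
      fix w assume "w \<in> (\<lambda>v. g * v + 2 * m) ` (E + E)"
      then obtain v where v: "v \<in> E + E" "w = g * v + 2 * m" by blast
      obtain a b where ab: "v = a + b" "a \<in> E" "b \<in> E" using v(1) by (rule set_plus_elim)
      obtain e e' where e: "a = (e - m) div g" "e \<in> E0" "b = (e' - m) div g" "e' \<in> E0"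
        using ab(2,3) unfolding E_def by blast
      have "g * v = (e - m) + (e' - m)"
        unfolding ab(1) distrib_left e(1,3) using Eg[OF e(2)] Eg[OF e(4)] by simp
      then have "w = e + e'" using v(2) by simp
      then show "w \<in> E0 + E0" using set_plus_intro[OF e(2,4)] by simp
    qed
    show "finite (E0 + E0)" using finE0 by (intro finite_set_plus)
  qed
  have L0: "0 < L"
  proof (rule ccontr)
    assume "\<not> 0 < L"
    then have "E \<subseteq> {0}" using EL(1) by auto
    then have "card E \<le> 1" using card_mono[of "{0}" E] by simp
    then show False using n2 cE cE0 by simp
  qed
  \<comment> \<open>The other alternative, 3 |E| \<le> |E + E| + 3, fails because 3 |E| \<ge> |S| +
    4.\<close>
  have EEL: "L + int (card E) \<le> int (card (E + E))"
    using Lev_Smeliansky_le[OF EL L0 gcdE EL(1) neE] N cE cEE \<open>card (E0 + E0) \<le> card S\<close> by linarith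
  have L2: "2 * L < p"
  proof -
    obtain e where e: "L = (e - m) div g" "e \<in> E0" using EL(3) unfolding E_def by blast
    have "1 * L \<le> g * L" using g0 L0 by (intro mult_right_mono) auto
    also have "g * L = e - m" unfolding e(1) by (rule Eg[OF e(2)])
    finally show ?thesis using E0b[OF e(2)] E0b[OF m(1)] by simp
  qed
  define u1 c1 where "u1 = u * g'" and "c1 = (c - m) * g'"
  have u1: "coprime u1 p" unfolding u1_def using uc copg' by simp
  define h where "h x = (u1 * x + c1) mod p" for x
  define B where "B = h ` A"
  have injh: "inj_on h A" unfolding h_def using inj_on_subset[OF affine_mod_inj[OF u1] A] .
  have cB: "card B = card A" unfolding B_def by (rule card_image[OF injh])
  have Bp: "B \<subseteq> {0..<p}" unfolding B_def h_def using pp by auto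
  have hE: "h x = (f x - m) div g" if x: "x \<in> A0" for x
  proof -
    define e where "e = (f x - m) div g"
    have fx: "f x \<in> E0" unfolding E0_def using x by blast
    have "e \<in> E" unfolding e_def E_def using fx by blast
    then have e: "0 \<le> e" "e < p" using EL(1) L2 L0 by auto
    have "[u1 * x + c1 = (f x - m) * g'] (mod p)"
    proof -
      have "[u * x + c = f x] (mod p)" unfolding f_def by (simp add: cong_def)
      then have "[(u * x + c - m) * g' = (f x - m) * g'] (mod p)" by (intro cong_mult cong_diff cong_refl)
      moreover have "(u * x + c - m) * g' = u1 * x + c1" unfolding u1_def c1_def by (simp add: algebra_simps)
      ultimately show ?thesis by simp
    qed
    also have "(f x - m) * g' = (g * g') * e" using Eg[OF fx] unfolding e_def by (metis mult.commute mult.assoc)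
    also have "[(g * g') * e = 1 * e] (mod p)" using g' by (intro cong_mult cong_refl)
    finally have "h x = e mod p" unfolding h_def cong_def by simp
    then show ?thesis using e unfolding e_def by simp
  qed
  have hA0: "h ` A0 = E"
    unfolding E_def E0_def image_image using hE by (intro image_cong) auto
  have EB: "E \<subseteq> B \<inter> {x. 2 * x < p}"
    using hA0 A0A EL(1) L2 unfolding B_def by auto
  have count: "card {x \<in> B. 2 * ((x + d) mod p) < p} = N u1 (c1 + d)" for d
  proof -
    have "{x \<in> B. 2 * ((x + d) mod p) < p} = h ` {x \<in> A. 2 * ((u1 * x + (c1 + d)) mod p) < p}"
      unfolding B_def h_def by (auto simp: mod_add_left_eq add.assoc)
    then show ?thesis unfolding N_def by (simp add: card_image[OF inj_on_subset[OF injh]])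
  qed
  have "{x \<in> B. 2 * ((x + 0) mod p) < p} = B \<inter> {x. 2 * x < p}" using Bp by force
  \<comment> \<open>For the new dilate the lower half circle contains \<open>E\<close>, and by
    maximality nothing else.\<close>
  then have "card (B \<inter> {x. 2 * x < p}) \<le> card E" using count[of 0] max[OF u1] cE by simp
  then have EB': "E = B \<inter> {x. 2 * x < p}"
    using EB fin(1) by (intro card_seteq) (auto simp: B_def)
  define S' where "S' = (\<lambda>v. (u1 * v + 2 * c1) mod p) ` S"
  have cS': "card S' = card S"
    unfolding S'_def using inj_on_subset[OF affine_mod_inj[OF u1] S(1)] by (rule card_image)
  have "B = B \<inter> {x. 2 * x < p}"
  proof (rule sumset_mod_rectifiable[where S = S' and L = L])
    show "B \<subseteq> {0..<p}" by (rule Bp)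
    show "S' \<subseteq> {0..<p}" unfolding S'_def using pp by auto
    show "(x + y) mod p \<in> S'" if xy: "x \<in> B" "y \<in> B" for x y
    proof -
      obtain a b where ab: "x = h a" "y = h b" "a \<in> A" "b \<in> A" using xy unfolding B_def by blast
      have "(x + y) mod p = (u1 * ((a + b) mod p) + 2 * c1) mod p" unfolding ab h_def by (rule affine_mod_add)
      then show ?thesis unfolding S'_def using S(2)[OF ab(3,4)] by blast
    qed
    show "int (card S') + int (card B) \<le> p" "4 * card S' + 12 \<le> 9 * card B" using sizes unfolding cS' cB .
    show "card S' + 4 \<le> 3 * card (B \<inter> {x. 2 * x < p})" using N unfolding cS' EB'[symmetric] cE .
    show "B \<inter> {x. 2 * x < p} \<subseteq> {0..L}" "0 \<in> B \<inter> {x. 2 * x < p}" "L \<in> B \<inter> {x. 2 * x < p}"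
      "\<forall>d>0. (\<forall>x\<in>B \<inter> {x. 2 * x < p}. d dvd x) \<longrightarrow> d = 1"
      "L + int (card (B \<inter> {x. 2 * x < p})) \<le> int (card (B \<inter> {x. 2 * x < p} + B \<inter> {x. 2 * x < p}))"
      unfolding EB'[symmetric] by (fact EL gcdE EEL)+
    show "card {x \<in> B. 2 * ((x + c) mod p) < p} \<le> card (B \<inter> {x. 2 * x < p})" for c
      unfolding EB'[symmetric] count cE using max[OF u1] .
  qed
  then have "B = E" unfolding EB'[symmetric] .
  show ?thesis
  proof (rule that[OF u1])
    show "(\<lambda>x. (u1 * x + c1) mod p) ` A \<subseteq> {0..L}"
      using EL(1) \<open>B = E\<close> unfolding B_def h_def by simp
    show "0 \<le> L" "2 * L < p" using L0 L2 by simp_all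
    show "L + int (card A) \<le> int (card S)"
      using EEL cEE \<open>card (E0 + E0) \<le> card S\<close> cB unfolding \<open>B = E\<close> by linarith
  qed
qed

section \<open>Fourier bias\<close>

text \<open>The hypothesis allows cancelling all but \<open>d\<close> positive values of \<open>f\<close> against negative values that are at least as
  large in modulus.\<close>

lemma sum_le_sum_subset_of_card:
  fixes f :: "'a \<Rightarrow> real"
  assumes "finite A" and "\<And>\<kappa>. 0 < \<kappa> \<Longrightarrow> card {x \<in> A. \<kappa> < f x} \<le> d + card {x \<in> A. f x \<le> - \<kappa>}"
  shows "\<exists>B\<subseteq>A. card B \<le> d \<and> sum f A \<le> sum f B"
  using assms
proof (induction "card A" arbitrary: A rule: less_induct)
  case less
  define P where "P = {x \<in> A. 0 < f x}"
  have finP: "finite P" and PA: "P \<subseteq> A" unfolding P_def using less.prems(1) by auto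
  show ?case
  proof (cases "card P \<le> d")
    case True
    have "sum f A = sum f P + sum f (A - P)" using less.prems(1) PA by (simp add: sum.subset_diff add.commute)
    moreover have "sum f (A - P) \<le> 0" by (rule sum_nonpos) (auto simp: P_def)
    ultimately show ?thesis using True PA by (intro exI[of _ P]) auto
  next
    case False
    then have neP: "P \<noteq> {}" by auto
    obtain a' where a': "a' \<in> P" "\<And>x. x \<in> P \<Longrightarrow> f a' \<le> f x"
      using ex_min_if_finite[of "f ` P"] finP neP by (metis (no_types, lifting) arg_min_if_finite(1) arg_min_least)
    define b where "b = f a'"
    have b: "0 < b" using a'(1) unfolding b_def P_def by simp
    define Q where "Q = {x \<in> A. b \<le> - f x}"
    have finQ: "finite Q" unfolding Q_def using less.prems(1) by simp
    \<comment> \<open>Prepares a level \<open>\<kappa>0\<close> so close to \<open>b\<close> that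
      \<open>f x \<le> - \<kappa>0\<close> already means \<open>f x \<le> - b\<close>; the inserted
      0 keeps it positive.\<close>
    define V where "V = insert 0 ((\<lambda>x. - f x) ` {x \<in> A. - f x < b})"
    have finV: "finite V" unfolding V_def using less.prems(1) by simp
    have "\<forall>v\<in>V. v < b" "V \<noteq> {}" unfolding V_def using b by auto
    then have V: "Max V < b" "\<And>v. v \<in> V \<Longrightarrow> v \<le> Max V" using finV by simp_all
    have V0: "0 \<le> Max V" by (rule V(2)) (simp add: V_def)
    define \<kappa>0 where "\<kappa>0 = (Max V + b) / 2"
    have \<kappa>0: "0 < \<kappa>0" "Max V < \<kappa>0" "\<kappa>0 < b" unfolding \<kappa>0_def using V(1) V0 b by auto
    have P\<kappa>: "P \<subseteq> {x \<in> A. \<kappa>0 < f x}" using a'(2) \<kappa>0(3) PA unfolding b_def by force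
    have "{x \<in> A. f x \<le> - \<kappa>0} \<subseteq> Q"
    proof
      fix x assume x: "x \<in> {x \<in> A. f x \<le> - \<kappa>0}"
      show "x \<in> Q"
      proof (rule ccontr)
        assume "x \<notin> Q"
        then have "- f x \<in> V" using x unfolding V_def Q_def by auto
        then have "- f x \<le> Max V" by (rule V(2))
        then show False using x \<kappa>0(2) by simp
      qed
    qed
    then have "card {x \<in> A. f x \<le> - \<kappa>0} \<le> card Q" using finQ by (rule card_mono[rotated])
    moreover have "card P \<le> card {x \<in> A. \<kappa>0 < f x}" using less.prems(1) by (intro card_mono[OF _ P\<kappa>]) auto
    ultimately have PQ: "card P \<le> d + card Q" using less.prems(2)[OF \<kappa>0(1)] by linarith
    then have "Q \<noteq> {}" using False by auto
    obtain a where a: "a \<in> Q" "\<And>x. x \<in> Q \<Longrightarrow> - f a \<le> - f x"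
      using ex_min_if_finite[of "(\<lambda>x. - f x) ` Q"] finQ \<open>Q \<noteq> {}\<close> by (metis (no_types, lifting) arg_min_if_finite(1) arg_min_least)
    have fa: "b \<le> - f a" "a \<in> A" and fa': "f a' = b" "a' \<in> A" using a(1) a'(1) PA unfolding Q_def b_def by auto
    have ne: "a \<noteq> a'" using fa(1) fa'(1) b by auto
    \<comment> \<open>The smallest positive value is paired with the weakest negative value that
      outweighs it. The pair contributes at most 0, and this choice preserves the counting
      hypothesis at every level.\<close>
    define A2 where "A2 = A - {a, a'}"
    have fin2: "finite A2" and A2: "A2 \<subseteq> A" unfolding A2_def using less.prems(1) by auto
    have lt: "card A2 < card A" using less.prems(1) fa(2) by (intro psubset_card_mono) (auto simp: A2_def)
    have cond: "card {x \<in> A2. \<kappa> < f x} \<le> d + card {x \<in> A2. f x \<le> - \<kappa>}" if \<kappa>: "0 < \<kappa>" for \<kappa>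
    proof -
      let ?U = "{x \<in> A. \<kappa> < f x}" and ?D = "{x \<in> A. f x \<le> - \<kappa>}"
      have finUD: "finite ?U" "finite ?D" using less.prems(1) by auto
      consider "\<kappa> < b" | "b \<le> \<kappa>" "\<kappa> \<le> - f a" | "- f a < \<kappa>" by linarith
      then show ?thesis
      proof cases
        case 1
        have eq: "{x \<in> A2. \<kappa> < f x} = ?U - {a'}" "{x \<in> A2. f x \<le> - \<kappa>} = ?D - {a}"
          using 1 \<kappa> fa fa' unfolding A2_def by auto
        have mem: "a' \<in> ?U" "a \<in> ?D" using 1 fa fa' by auto
        have "Suc (card (?U - {a'})) = card ?U" "Suc (card (?D - {a})) = card ?D"
          by (rule card_Suc_Diff1[OF finUD(1) mem(1)], rule card_Suc_Diff1[OF finUD(2) mem(2)])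
        then show ?thesis unfolding eq using less.prems(2)[OF \<kappa>] by linarith
      next
        case 2
        have "{x \<in> A2. \<kappa> < f x} \<subseteq> P - {a'}" unfolding A2_def P_def using \<kappa> by auto
        then have "card {x \<in> A2. \<kappa> < f x} \<le> card (P - {a'})" using finP by (intro card_mono) auto
        also have "\<dots> = card P - 1" using a'(1) by simp
        finally have 3: "card {x \<in> A2. \<kappa> < f x} \<le> card P - 1" .
        have "{x \<in> A2. f x \<le> - \<kappa>} = Q - {a}"
          using a(2) 2 fa' b unfolding A2_def Q_def by force
        then have "card {x \<in> A2. f x \<le> - \<kappa>} = card Q - 1" using a(1) by simp
        moreover have "1 \<le> card Q" using finQ a(1) by (metis One_nat_def Suc_leI card_gt_0_iff empty_iff)
        ultimately show ?thesis using 3 PQ by linarith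
      next
        case 3
        have "{x \<in> A2. f x \<le> - \<kappa>} = ?D" using 3 fa' b \<kappa> unfolding A2_def by auto
        moreover have "card {x \<in> A2. \<kappa> < f x} \<le> card ?U" using finUD A2 by (intro card_mono) auto
        ultimately show ?thesis using less.prems(2)[OF \<kappa>] by simp
      qed
    qed
    from less.hyps[OF lt fin2 cond] obtain B where B: "B \<subseteq> A2" "card B \<le> d" "sum f A2 \<le> sum f B" by blast
    have "A - {a} - {a'} = A2" unfolding A2_def by blast
    then have "sum f A = f a + (f a' + sum f A2)"
      using sum.remove[OF less.prems(1) fa(2), of f] sum.remove[of "A - {a}" a' f] less.prems(1) fa'(2) ne by simp
    then have "sum f A \<le> sum f B" using B(3) fa(1) fa'(1) by linarith
    then show ?thesis using B A2 by blast
  qed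
qed

lemma sum_cos_progression:
  fixes \<alpha> \<theta> :: real
  shows "2 * sin (\<theta> / 2) * (\<Sum>i<k. cos (\<alpha> + real i * \<theta>)) = sin (\<alpha> + real k * \<theta> - \<theta> / 2) - sin (\<alpha> - \<theta> / 2)"
proof (induction k)
  case (Suc k)
  have "2 * sin (\<theta> / 2) * cos (\<alpha> + real k * \<theta>) = sin (\<alpha> + real k * \<theta> + \<theta> / 2) - sin (\<alpha> + real k * \<theta> - \<theta> / 2)"
    by (simp add: sin_add sin_diff)
  moreover have eq: "\<alpha> + real (Suc k) * \<theta> - \<theta> / 2 = \<alpha> + real k * \<theta> + \<theta> / 2" by (simp add: algebra_simps)
  ultimately show ?case unfolding sum.lessThan_Suc distrib_left eq using Suc by linarith
qed simp

lemma cos_shift_period: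
  fixes p j :: int
  assumes "0 < p"
  shows "cos (2 * pi * (real_of_int (x + p * j) - \<gamma>) / p) = cos (2 * pi * (real_of_int x - \<gamma>) / p)"
proof -
  have "2 * pi * (real_of_int (x + p * j) - \<gamma>) / p = 2 * pi * (real_of_int x - \<gamma>) / p + 2 * pi * real_of_int j"
    using assms by (simp add: field_simps)
  then show ?thesis using cos_add[of "2 * pi * (real_of_int x - \<gamma>) / p" "2 * pi * real_of_int j"]
    by (simp add: cos_int_2pin sin_int_2pin)
qed

text \<open>The threshold \<open>\<tau>\<close> is the cosine at distance \<open>k / 2\<close> from
  the peak \<open>\<gamma>\<close>. The \<open>k\<close> consecutive integers around
  \<open>\<gamma>\<close> have values at least \<open>\<tau>\<close>, all other residues at most
  \<open>\<tau>\<close>; so an interval is the best set, and its sum is explicit.\<close>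

lemma sum_cos_residues_le:
  fixes p :: int and B :: "int set" and \<phi> :: real
  assumes p: "2 \<le> p" and B: "B \<subseteq> {0..<p}"
  shows "(\<Sum>x\<in>B. cos (2 * pi * x / p - \<phi>)) \<le> sin (pi * card B / p) / sin (pi / p)"
proof -
  define k where "k = card B"
  define \<gamma> where "\<gamma> = \<phi> * p / (2 * pi)"
  define f where "f x = cos (2 * pi * (real_of_int x - \<gamma>) / p)" for x
  \<comment> \<open>The first integer beyond \<open>\<gamma> - k / 2\<close>; the next
    \<open>k\<close> integers are within \<open>k / 2\<close> of \<open>\<gamma>\<close>.\<close>
  define j where "j = \<lfloor>\<gamma> - k / 2\<rfloor> + 1"
  define \<tau> where "\<tau> = cos (pi * k / p)"
  have finB: "finite B" using finite_subset[OF B] by simp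
  have kp: "int k \<le> p" using card_mono[OF _ B] p unfolding k_def by simp
  have f: "cos (2 * pi * x / p - \<phi>) = f x" for x :: int
  proof -
    have "2 * pi * (real_of_int x - \<gamma>) / p = 2 * pi * x / p - \<phi>" using p unfolding \<gamma>_def by (simp add: field_simps)
    then show ?thesis unfolding f_def by simp
  qed
  define rep where "rep x = j + (x - j) mod p" for x
  have rep: "f (rep x) = f x" for x
  proof -
    have "x = rep x + p * ((x - j) div p)" unfolding rep_def by simp
    then show ?thesis using cos_shift_period[of p "rep x" "(x - j) div p" \<gamma>] p unfolding f_def by simp
  qed
  have rep_b: "j \<le> rep x" "rep x < j + p" for x unfolding rep_def using p by simp_all
  have inj: "inj_on rep B"
  proof (rule inj_onI)
    fix x y assume xy: "x \<in> B" "y \<in> B" "rep x = rep y"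
    then have "(x - j) mod p = (y - j) mod p" unfolding rep_def by simp
    then have "p dvd (x - j) - (y - j)" by (simp only: mod_eq_dvd_iff)
    then have "p dvd x - y" by simp
    then have "x mod p = y mod p" by (simp only: mod_eq_dvd_iff)
    then show "x = y" using xy B by (auto simp: subset_iff)
  qed
  define I where "I = {j..<j + int k}"
  have jb: "\<gamma> - k / 2 < j" "j \<le> \<gamma> - k / 2 + 1" unfolding j_def by linarith+
  have in_I: "\<tau> \<le> f x" if x: "x \<in> I" for x
  proof -
    have "x \<le> j + int k - 1" "j \<le> x" using x unfolding I_def by auto
    then have "real_of_int x \<le> real_of_int j + real k - 1" "real_of_int j \<le> real_of_int x" by linarith+
    then have "\<bar>real_of_int x - \<gamma>\<bar> \<le> k / 2" using jb unfolding abs_le_iff by linarith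
    then have 1: "2 * pi * \<bar>real_of_int x - \<gamma>\<bar> / p \<le> pi * k / p"
      using p by (simp add: divide_right_mono mult_left_mono)
    have 2: "pi * k / p \<le> pi" using kp p by (simp add: divide_le_eq flip: of_int_le_iff)
    have "cos (pi * k / p) \<le> cos (2 * pi * \<bar>real_of_int x - \<gamma>\<bar> / p)"
      using 1 2 p by (intro cos_monotone_0_pi_le) auto
    also have "2 * pi * \<bar>real_of_int x - \<gamma>\<bar> / p = \<bar>2 * pi * (real_of_int x - \<gamma>) / p\<bar>" using p by (simp add: abs_mult)
    finally show ?thesis unfolding \<tau>_def f_def cos_abs_real .
  qed
  have out_I: "f x \<le> \<tau>" if x: "j + int k \<le> x" "x < j + p" for x
  proof -
    define \<theta> where "\<theta> = 2 * pi * (real_of_int x - \<gamma>) / p"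
    have "real_of_int (j + int k) \<le> x" "real_of_int x \<le> j + p - 1" using x by linarith+
    then have "k / 2 \<le> real_of_int x - \<gamma>" "real_of_int x - \<gamma> \<le> p - k / 2" using jb by simp_all
    then have "2 * pi * (k / 2) / p \<le> \<theta>" "\<theta> \<le> 2 * pi * (p - k / 2) / p"
      unfolding \<theta>_def using p by (intro divide_right_mono mult_left_mono; simp)+
    then have \<theta>: "pi * k / p \<le> \<theta>" "pi * k / p \<le> 2 * pi - \<theta>" using p by (simp_all add: field_simps)
    have 0: "0 \<le> pi * k / p" using p by simp
    show ?thesis
    proof (cases "\<theta> \<le> pi")
      case True
      then show ?thesis using cos_monotone_0_pi_le[OF 0 \<theta>(1)] unfolding \<tau>_def f_def \<theta>_def by simp
    next
      case False
      then have "cos (2 * pi - \<theta>) \<le> cos (pi * k / p)" by (intro cos_monotone_0_pi_le[OF 0 \<theta>(2)]) simp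
      then show ?thesis unfolding \<tau>_def f_def \<theta>_def[symmetric] by (simp add: cos_diff)
    qed
  qed
  have cards: "card (rep ` B) = k" "card I = k" unfolding k_def I_def using card_image[OF inj] by simp_all
  have "(\<Sum>x\<in>rep ` B. f x - \<tau>) \<le> (\<Sum>x\<in>rep ` B \<inter> I. f x - \<tau>)"
  proof -
    have "(\<Sum>x\<in>rep ` B. f x - \<tau>) = (\<Sum>x\<in>rep ` B \<inter> I. f x - \<tau>) + (\<Sum>x\<in>rep ` B - I. f x - \<tau>)"
      using finB by (intro sum.Int_Diff) auto
    moreover have "(\<Sum>x\<in>rep ` B - I. f x - \<tau>) \<le> 0"
    proof (rule sum_nonpos)
      fix x assume "x \<in> rep ` B - I"
      then have "j + int k \<le> x" "x < j + p" using rep_b unfolding I_def by force+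
      then show "f x - \<tau> \<le> 0" using out_I by simp
    qed
    ultimately show ?thesis by simp
  qed
  also have "\<dots> \<le> (\<Sum>x\<in>I. f x - \<tau>)"
    using in_I by (intro sum_mono2) (auto simp: I_def)
  finally have "sum f (rep ` B) \<le> sum f I" by (simp add: sum_subtractf cards)
  moreover have "sum f (rep ` B) = sum f B" using rep by (simp add: sum.reindex[OF inj])
  moreover have "sum f I = (\<Sum>i<k. cos (2 * pi * (j - \<gamma>) / p + real i * (2 * pi / p)))"
  proof -
    have "x \<in> (\<lambda>i. j + int i) ` {..<k}" if "x \<in> I" for x
      using that unfolding I_def by (intro image_eqI[of _ _ "nat (x - j)"]) auto
    then have "I = (\<lambda>i. j + int i) ` {..<k}" unfolding I_def by auto
    moreover have "inj_on (\<lambda>i. j + int i) {..<k}" by (simp add: inj_on_def)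
    ultimately have "sum f I = (\<Sum>i<k. f (j + int i))" by (simp add: sum.reindex)
    also have "\<dots> = (\<Sum>i<k. cos (2 * pi * (j - \<gamma>) / p + real i * (2 * pi / p)))"
      unfolding f_def
      by (intro sum.cong refl arg_cong[where f = cos]) (simp add: algebra_simps add_divide_distrib diff_divide_distrib)
    finally show ?thesis .
  qed
  moreover have "\<dots> \<le> sin (pi * k / p) / sin (pi / p)"
  proof -
    define \<alpha> where "\<alpha> = 2 * pi * (j - \<gamma>) / p"
    have s: "0 < sin (pi / p)" using p by (intro sin_gt_zero) (simp_all add: divide_less_eq)
    have sk: "0 \<le> sin (pi * k / p)" using p kp by (intro sin_ge_zero) (simp_all add: divide_le_eq flip: of_int_le_iff)
    have "2 * sin (pi / p) * (\<Sum>i<k. cos (\<alpha> + real i * (2 * pi / p))) = sin (\<alpha> + real k * (2 * pi / p) - pi / p) - sin (\<alpha> - pi / p)"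
      using sum_cos_progression[where \<theta> = "2 * pi / p" and k = k and \<alpha> = \<alpha>] by simp
    also have "\<dots> = 2 * sin (pi * k / p) * cos (\<alpha> + (pi * k / p - pi / p))"
    proof -
      have "(\<alpha> + real k * (2 * pi / p) - pi / p - (\<alpha> - pi / p)) / 2 = pi * k / p"
        "(\<alpha> + real k * (2 * pi / p) - pi / p + (\<alpha> - pi / p)) / 2 = \<alpha> + (pi * k / p - pi / p)"
        by (simp_all add: algebra_simps add_divide_distrib diff_divide_distrib)
      then show ?thesis unfolding sin_diff_sin by (simp only:)
    qed
    also have "\<dots> \<le> 2 * sin (pi * k / p) * 1" using sk by (intro mult_left_mono) auto
    finally show ?thesis unfolding \<alpha>_def using s by (simp add: field_simps)
  qed
  ultimately show ?thesis unfolding k_def[symmetric] f by linarith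
qed

text \<open>The rotation need not be a multiple of the angle between residues. Its fractional part
  only moves points forward, so rounding \<open>\<gamma>\<close> down keeps them in the half
  circle.\<close>

lemma half_circle_subset:
  fixes p :: int and \<beta> :: real
  assumes p: "0 < p"
  shows "\<exists>c. \<forall>x::int. 0 < sin (2 * pi * x / p + \<beta>) \<longrightarrow> 2 * ((x + c) mod p) < p"
proof (intro exI allI impI)
  define \<gamma> where "\<gamma> = \<beta> * p / (2 * pi)"
  fix x :: int assume pos: "0 < sin (2 * pi * x / p + \<beta>)"
  define y q where "y = (x + \<lfloor>\<gamma>\<rfloor>) mod p" and "q = (x + \<lfloor>\<gamma>\<rfloor>) div p"
  define \<theta> where "\<theta> = 2 * pi * (y + frac \<gamma>) / p"
  have y: "0 \<le> y" "y \<le> p - 1" unfolding y_def using p by (simp_all add: zless_imp_add1_zle)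
  have "x + \<lfloor>\<gamma>\<rfloor> = p * q + y" unfolding y_def q_def by simp
  then have "real_of_int x + of_int \<lfloor>\<gamma>\<rfloor> = p * q + y" by (metis of_int_add of_int_mult)
  then have xg: "real_of_int x + \<gamma> = p * q + (y + frac \<gamma>)" unfolding frac_def by linarith
  have "2 * pi * x / p + \<beta> = 2 * pi * (x + \<gamma>) / p" unfolding \<gamma>_def using p by (simp add: field_simps)
  also have "\<dots> = \<theta> + 2 * pi * q" unfolding xg \<theta>_def using p by (simp add: field_simps)
  finally have "sin (2 * pi * x / p + \<beta>) = sin \<theta>" by (simp add: sin_add)
  then have s: "0 < sin \<theta>" using pos by simp
  have fr: "0 \<le> frac \<gamma>" "frac \<gamma> < 1" by (simp_all add: frac_lt_1)
  have "y + frac \<gamma> < p" using y fr by linarith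
  then have "\<theta> < 2 * pi" unfolding \<theta>_def using p by (simp add: divide_less_eq)
  then have "\<theta> < pi" using s sin_le_zero[of \<theta>] by linarith
  then have "2 * (y + frac \<gamma>) < p" unfolding \<theta>_def using p by (simp add: divide_less_eq)
  then have "2 * real_of_int y < real_of_int p" using fr(1) unfolding distrib_left by linarith
  then have "real_of_int (2 * y) < real_of_int p" by simp
  then show "2 * ((x + \<lfloor>\<gamma>\<rfloor>) mod p) < p" unfolding y_def[symmetric] of_int_less_iff .
qed

text \<open>Rotated to be real, the sum is one of cosines. For each level \<open>\<kappa>\<close>
  two half circles, with at most \<open>N\<close> points each, both contain the points of cosine
  above \<open>\<kappa>\<close> and miss only those of cosine at most \<open>- \<kappa>\<close>.
  Inclusion-exclusion is the hypothesis of \<open>sum_le_sum_subset_of_card\<close> with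
  \<open>d = 2 * N - card B\<close>, and an arc bounds what is left.\<close>

lemma Lev_half_circle_bound:
  fixes p :: int and B :: "int set"
  assumes p: "2 \<le> p" and B: "B \<subseteq> {0..<p}" and half: "\<And>c. card {x \<in> B. 2 * ((x + c) mod p) < p} \<le> N"
  shows "\<exists>k. k + card B \<le> 2 * N \<and> k \<le> card B \<and>
    cmod (\<Sum>x\<in>B. cis (2 * pi * x / p)) \<le> sin (pi * k / p) / sin (pi / p)"
proof -
  have finB: "finite B" using finite_subset[OF B] by simp
  define Z where "Z = (\<Sum>x\<in>B. cis (2 * pi * x / p))"
  define \<phi> where "\<phi> = Arg Z"
  define f where "f x = cos (2 * pi * x / p - \<phi>)" for x :: int
  have "complex_of_real (cmod Z) * cis \<phi> = Z" using rcis_cmod_Arg[of Z] unfolding \<phi>_def rcis_def .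
  then have "cis (- \<phi>) * Z = cis (- \<phi>) * (complex_of_real (cmod Z) * cis \<phi>)" by simp
  also have "\<dots> = complex_of_real (cmod Z)" by (simp add: mult.left_commute cis_mult)
  finally have "cmod Z = Re (cis (- \<phi>) * Z)" by simp
  also have "cis (- \<phi>) * Z = (\<Sum>x\<in>B. cis (2 * pi * x / p - \<phi>))"
    unfolding Z_def sum_distrib_left cis_mult by (simp add: add.commute)
  finally have Zf: "cmod Z = sum f B" unfolding f_def by simp
  have arc: "card {x \<in> B. 0 < sin (2 * pi * x / p + \<beta>)} \<le> N" for \<beta>
  proof -
    obtain c where "\<forall>x::int. 0 < sin (2 * pi * x / p + \<beta>) \<longrightarrow> 2 * ((x + c) mod p) < p"
      using half_circle_subset[of p \<beta>] p by auto
    then have "card {x \<in> B. 0 < sin (2 * pi * x / p + \<beta>)} \<le> card {x \<in> B. 2 * ((x + c) mod p) < p}"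
      using finB by (intro card_mono) auto
    then show ?thesis using half[of c] by linarith
  qed
  \<comment> \<open>Two half circles cover everything, so the natural subtraction
    \<open>2 * N - card B\<close> is not truncated.\<close>
  have dN: "card B \<le> 2 * N"
  proof -
    let ?h = "(p + 1) div 2"
    have "B \<subseteq> {x \<in> B. 2 * ((x + 0) mod p) < p} \<union> {x \<in> B. 2 * ((x + - ?h) mod p) < p}"
    proof
      fix x assume x: "x \<in> B"
      then have x': "0 \<le> x" "x < p" using B by auto
      show "x \<in> {x \<in> B. 2 * ((x + 0) mod p) < p} \<union> {x \<in> B. 2 * ((x + - ?h) mod p) < p}"
      proof (cases "2 * x < p")
        case True
        then show ?thesis using x x' by simp
      next
        case False
        moreover have "p \<le> 2 * ?h" "2 * ?h \<le> p + 1" by presburger+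
        ultimately have "0 \<le> x - ?h" "2 * (x - ?h) < p" "x - ?h < p" using x' p by presburger+
        then show ?thesis using x by simp
      qed
    qed
    then have "card B \<le> card ({x \<in> B. 2 * ((x + 0) mod p) < p} \<union> {x \<in> B. 2 * ((x + - ?h) mod p) < p})"
      using finB by (intro card_mono) auto
    also have "\<dots> \<le> card {x \<in> B. 2 * ((x + 0) mod p) < p} + card {x \<in> B. 2 * ((x + - ?h) mod p) < p}"
      by (rule card_Un_le)
    also have "\<dots> \<le> N + N" by (intro add_mono half)
    finally show ?thesis by simp
  qed
  have cond: "card {x \<in> B. \<kappa> < f x} \<le> (2 * N - card B) + card {x \<in> B. f x \<le> - \<kappa>}" if \<kappa>: "0 < \<kappa>" for \<kappa>
  proof (cases "\<kappa> < 1")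
    case False
    then have "\<not> \<kappa> < f x" for x using cos_le_one[of "2 * pi * x / p - \<phi>"] unfolding f_def by linarith
    then show ?thesis by simp
  next
    case True
    define s where "s = arccos \<kappa>"
    have s: "cos s = \<kappa>" "0 < sin s"
    proof -
      show "cos s = \<kappa>" unfolding s_def using True \<kappa> by (simp add: cos_arccos)
      have "sin s = sqrt (1 - \<kappa>\<^sup>2)" unfolding s_def using True \<kappa> by (simp add: sin_arccos)
      then show "0 < sin s" using True \<kappa> by (simp add: power_less_one_iff)
    qed
    define P1 P2 where "P1 = {x \<in> B. 0 < sin (2 * pi * x / p + (s - \<phi>))}"
      and "P2 = {x \<in> B. 0 < sin (2 * pi * x / p + (pi - s - \<phi>))}"
    \<comment> \<open>The open half circles centred at \<open>\<plusminus> (pi / 2 - s)\<close> meet in \<open>cos \<psi> > \<kappa>\<close> and leave out only \<open>cos \<psi> \<le> - \<kappa>\<close>.\<close>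
    have two: "(\<kappa> < cos \<psi> \<longrightarrow> 0 < sin (s + \<psi>) \<and> 0 < sin (s - \<psi>)) \<and>
      (- \<kappa> < cos \<psi> \<longrightarrow> 0 < sin (s + \<psi>) \<or> 0 < sin (s - \<psi>))" for \<psi>
    proof -
      define a b where "a = sin (s + \<psi>)" and "b = sin (s - \<psi>)"
      have sum: "a + b = 2 * sin s * cos \<psi>" unfolding a_def b_def by (simp add: sin_add sin_diff)
      have "a * b = (sin s * cos \<psi>)\<^sup>2 - (cos s * sin \<psi>)\<^sup>2"
        unfolding a_def b_def sin_add sin_diff by (simp add: power2_eq_square algebra_simps)
      also have "\<dots> = (1 - (cos s)\<^sup>2) * (cos \<psi>)\<^sup>2 - (cos s)\<^sup>2 * (1 - (cos \<psi>)\<^sup>2)"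
        unfolding power_mult_distrib sin_squared_eq ..
      finally have prod: "a * b = (cos \<psi>)\<^sup>2 - \<kappa>\<^sup>2" unfolding s(1) by (simp add: algebra_simps)
      have "0 < a \<and> 0 < b" if "\<kappa> < cos \<psi>"
      proof -
        have "\<kappa>\<^sup>2 < (cos \<psi>)\<^sup>2" using that \<kappa> by (intro power_strict_mono) auto
        then have "0 < a * b" using prod by simp
        moreover have "0 < a + b" unfolding sum using s(2) that \<kappa> by simp
        ultimately show ?thesis by (auto simp: zero_less_mult_iff)
      qed
      moreover have "0 < a \<or> 0 < b" if "- \<kappa> < cos \<psi>"
      proof (rule ccontr)
        assume neg: "\<not> (0 < a \<or> 0 < b)"
        then have "0 \<le> a * b" by (simp add: mult_nonpos_nonpos)
        then have "\<kappa>\<^sup>2 \<le> (cos \<psi>)\<^sup>2" using prod by simp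
        then have "\<bar>\<kappa>\<bar> \<le> \<bar>cos \<psi>\<bar>" by (simp only: abs_le_square_iff)
        then have "0 < cos \<psi>" using that \<kappa> by linarith
        then have "0 < a + b" unfolding sum using s(2) by simp
        then show False using neg by linarith
      qed
      ultimately show ?thesis unfolding a_def b_def by blast
    qed
    have arg1: "2 * pi * x / p + (s - \<phi>) = s + (2 * pi * x / p - \<phi>)" for x :: int by simp
    have arg2: "sin (2 * pi * x / p + (pi - s - \<phi>)) = sin (s - (2 * pi * x / p - \<phi>))" for x :: int
    proof -
      have "2 * pi * x / p + (pi - s - \<phi>) = pi - (s - (2 * pi * x / p - \<phi>))" by simp
      then show ?thesis by (simp only: sin_pi_minus)
    qed
    have sub1: "{x \<in> B. \<kappa> < f x} \<subseteq> P1 \<inter> P2" unfolding P1_def P2_def arg1 arg2 f_def using two by blast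
    have "x \<in> P1 \<union> P2" if x: "x \<in> B" "\<not> f x \<le> - \<kappa>" for x
      unfolding P1_def P2_def arg1 arg2 using x two[of "2 * pi * x / p - \<phi>"] by (auto simp: f_def)
    then have sub2: "B \<subseteq> (P1 \<union> P2) \<union> {x \<in> B. f x \<le> - \<kappa>}" by blast
    have fin: "finite P1" "finite P2" unfolding P1_def P2_def using finB by auto
    have "card B \<le> card ((P1 \<union> P2) \<union> {x \<in> B. f x \<le> - \<kappa>})" using fin finB by (intro card_mono[OF _ sub2]) auto
    also have "\<dots> \<le> card (P1 \<union> P2) + card {x \<in> B. f x \<le> - \<kappa>}" by (rule card_Un_le)
    finally have "card B \<le> card (P1 \<union> P2) + card {x \<in> B. f x \<le> - \<kappa>}" .
    moreover have "card {x \<in> B. \<kappa> < f x} \<le> card (P1 \<inter> P2)" using fin by (intro card_mono[OF _ sub1]) auto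
    moreover have "card P1 + card P2 = card (P1 \<union> P2) + card (P1 \<inter> P2)" using fin by (rule card_Un_Int)
    moreover have "card P1 \<le> N" "card P2 \<le> N" unfolding P1_def P2_def by (rule arc)+
    ultimately show ?thesis by linarith
  qed
  from sum_le_sum_subset_of_card[OF finB cond] obtain B' where B': "B' \<subseteq> B" "card B' \<le> 2 * N - card B" "sum f B \<le> sum f B'"
    by blast
  have "sum f B' \<le> sin (pi * card B' / p) / sin (pi / p)"
    unfolding f_def using B' B by (intro sum_cos_residues_le[OF p]) auto
  moreover have "card B' \<le> card B" using B' finB by (intro card_mono)
  moreover have "card B' + card B \<le> 2 * N" using B'(2) dN by linarith
  ultimately show ?thesis using B'(3) Zf unfolding Z_def by (intro exI[of _ "card B'"]) auto
qed

section \<open>Characters modulo p\<close>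

lemma sum_cis_residues:
  fixes p x :: int
  assumes p: "0 < p"
  shows "(\<Sum>t\<in>{0..<p}. cis (2 * pi * (t * x) / p)) = (if p dvd x then of_int p else 0)"
proof -
  define w where "w = cis (2 * pi * x / p)"
  have "{0..<p} = int ` {..<nat p}"
    using p by (auto simp: image_iff intro!: bexI[of _ "nat _"])
  then have "(\<Sum>t\<in>{0..<p}. cis (2 * pi * (t * x) / p)) = (\<Sum>i<nat p. cis (2 * pi * (int i * x) / p))"
    by (simp add: sum.reindex)
  also have "\<dots> = (\<Sum>i<nat p. w ^ i)"
    unfolding w_def Complex.DeMoivre by (intro sum.cong refl arg_cong[where f = cis]) simp
  finally have eq: "(\<Sum>t\<in>{0..<p}. cis (2 * pi * (t * x) / p)) = (\<Sum>i<nat p. w ^ i)" .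
  show ?thesis
  proof (cases "p dvd x")
    case True
    then obtain q where "x = p * q" by blast
    then have "2 * pi * x / p = 2 * pi * q" using p by simp
    then have "w = 1" unfolding w_def by simp
    then show ?thesis unfolding eq using True p by simp
  next
    case False
    have "w \<noteq> 1"
    proof
      assume "w = 1"
      then have "cos (2 * pi * x / p) = 1" unfolding w_def by (metis cis.sel(1) one_complex.sel(1))
      then obtain n :: int where "2 * pi * x / p = real_of_int n * 2 * pi" unfolding cos_one_2pi_int by blast
      then have "real_of_int x = p * n" using p by (simp add: field_simps)
      then have "x = p * n" by (metis of_int_eq_iff of_int_mult)
      then show False using False by simp
    qed
    moreover have "w ^ nat p = 1"
    proof -
      have "real (nat p) * (2 * pi * x / p) = 2 * pi * x" using p by simp
      then show ?thesis unfolding w_def Complex.DeMoivre by simp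
    qed
    ultimately show ?thesis unfolding eq using False by (simp add: geometric_sum)
  qed
qed

text \<open>All n^2 pairs have their sum in \<open>S\<close>. In the character expansion of this
  count the term of 0 gives n^2 s, so the others carry n^2 (p - s). One coefficient of
  \<open>A\<close> is bounded by the maximum, the remaining product by Cauchy-Schwarz and
  Parseval.\<close>

lemma large_Fourier_coefficient:
  fixes p :: int and A S :: "int set"
  assumes p: "2 \<le> p" and A: "A \<subseteq> {0..<p}" and S: "S \<subseteq> {0..<p}" "\<And>x y. x \<in> A \<Longrightarrow> y \<in> A \<Longrightarrow> (x + y) mod p \<in> S"
    and sizes: "int (card S) + int (card A) \<le> p" "card A \<le> card S" "0 < card A"
  shows "\<exists>t\<in>{1..<p}. (real (card A))\<^sup>2 \<le> real (card S) * cmod (\<Sum>a\<in>A. cis (2 * pi * (t * a) / p))"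
proof -
  define F where "F X t = (\<Sum>a\<in>X. cis (2 * pi * (t * a) / p))" for X and t :: int
  define n s P where "n = real (card A)" and "s = real (card S)" and "P = real_of_int p"
  have pp: "0 < p" using p by simp
  have fin: "finite A" "finite S" using finite_subset[OF A] finite_subset[OF S(1)] by simp_all
  have cis_comb: "cis (2 * pi * (t * a) / p) * cis (2 * pi * (t * b) / p) = cis (2 * pi * (t * (a + b)) / p)"
    and cis_neg: "cnj (cis (2 * pi * (t * a) / p)) = cis (2 * pi * (t * (- a)) / p)" for t a b :: int
    by (simp_all add: cis_mult cis_cnj distrib_left add_divide_distrib)
  have Parseval: "(\<Sum>t\<in>{0..<p}. (cmod (F X t))\<^sup>2) = P * card X" if X: "X \<subseteq> {0..<p}" for X
  proof -
    have finX: "finite X" using finite_subset[OF X] by simp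
    have "complex_of_real (\<Sum>t\<in>{0..<p}. (cmod (F X t))\<^sup>2) = (\<Sum>t\<in>{0..<p}. F X t * cnj (F X t))"
      by (simp only: of_real_sum complex_norm_square)
    also have "\<dots> = (\<Sum>t\<in>{0..<p}. \<Sum>a\<in>X. \<Sum>b\<in>X. cis (2 * pi * (t * (a + - b)) / p))"
      unfolding F_def cnj_sum cis_neg sum_product cis_comb ..
    also have "\<dots> = (\<Sum>a\<in>X. \<Sum>b\<in>X. \<Sum>t\<in>{0..<p}. cis (2 * pi * (t * (a + - b)) / p))"
      by (rule trans[OF sum.swap], rule sum.cong[OF refl], rule sum.swap)
    also have "\<dots> = (\<Sum>a\<in>X. \<Sum>b\<in>X. if b = a then of_int p else 0)"
    proof (intro sum.cong refl)
      fix a b assume "a \<in> X" "b \<in> X"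
      then have ab: "0 \<le> a" "a < p" "0 \<le> b" "b < p" using X by auto
      have "p dvd a + - b \<longleftrightarrow> a mod p = b mod p" by (simp add: mod_eq_dvd_iff)
      then have "p dvd a + - b \<longleftrightarrow> b = a" using ab by auto
      then show "(\<Sum>t\<in>{0..<p}. cis (2 * pi * (t * (a + - b)) / p)) = (if b = a then of_int p else 0)"
        unfolding sum_cis_residues[OF pp] by simp
    qed
    also have "\<dots> = of_int p * of_nat (card X)" using finX by (simp add: sum.delta)
    also have "\<dots> = complex_of_real (P * card X)" unfolding P_def by simp
    finally show ?thesis by (simp only: of_real_eq_iff)
  qed
  have F0: "F X 0 = of_nat (card X)" for X unfolding F_def by simp
  have expand: "F A t * F A t * cnj (F S t) = (\<Sum>a\<in>A. \<Sum>b\<in>A. \<Sum>v\<in>S. cis (2 * pi * (t * (a + b + - v)) / p))" for t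
  proof -
    have "F A t * F A t = (\<Sum>a\<in>A. \<Sum>b\<in>A. cis (2 * pi * (t * (a + b)) / p))"
      unfolding F_def sum_product cis_comb ..
    moreover have "cnj (F S t) = (\<Sum>v\<in>S. cis (2 * pi * (t * (- v)) / p))"
      unfolding F_def cnj_sum cis_neg ..
    ultimately have "F A t * F A t * cnj (F S t) =
      (\<Sum>a\<in>A. \<Sum>b\<in>A. cis (2 * pi * (t * (a + b)) / p)) * (\<Sum>v\<in>S. cis (2 * pi * (t * (- v)) / p))"
      by (simp only:)
    then show ?thesis unfolding sum_distrib_right unfolding sum_distrib_left cis_comb .
  qed
  have "(\<Sum>t\<in>{0..<p}. F A t * F A t * cnj (F S t)) =
    (\<Sum>t\<in>{0..<p}. \<Sum>a\<in>A. \<Sum>b\<in>A. \<Sum>v\<in>S. cis (2 * pi * (t * (a + b + - v)) / p))"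
    unfolding expand ..
  also have "\<dots> = (\<Sum>a\<in>A. \<Sum>b\<in>A. \<Sum>v\<in>S. \<Sum>t\<in>{0..<p}. cis (2 * pi * (t * (a + b + - v)) / p))"
    by (rule trans[OF sum.swap], rule sum.cong[OF refl], rule trans[OF sum.swap], rule sum.cong[OF refl], rule sum.swap)
  also have "\<dots> = (\<Sum>a\<in>A. \<Sum>b\<in>A. of_int p)"
  proof (intro sum.cong refl)
    fix a b assume ab: "a \<in> A" "b \<in> A"
    have "p dvd a + b + - v \<longleftrightarrow> v = (a + b) mod p" if "v \<in> S" for v
    proof -
      have "v mod p = v" using that S(1) by auto
      then show ?thesis using mod_eq_dvd_iff[of "a + b" p v] by auto
    qed
    then have "(\<Sum>v\<in>S. \<Sum>t\<in>{0..<p}. cis (2 * pi * (t * (a + b + - v)) / p)) = (\<Sum>v\<in>S. if v = (a + b) mod p then of_int p else 0)"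
      unfolding sum_cis_residues[OF pp] by (intro sum.cong refl) auto
    also have "\<dots> = of_int p" using fin(2) S(2)[OF ab] by (simp add: sum.delta)
    finally show "(\<Sum>v\<in>S. \<Sum>t\<in>{0..<p}. cis (2 * pi * (t * (a + b + - v)) / p)) = of_int p" .
  qed
  also have "\<dots> = complex_of_real (n\<^sup>2 * P)" unfolding n_def P_def by (simp add: power2_eq_square)
  finally have triple: "(\<Sum>t\<in>{0..<p}. F A t * F A t * cnj (F S t)) = complex_of_real (n\<^sup>2 * P)" .
  have split: "sum h {0..<p} = h 0 + sum h {1..<p}" for h :: "int \<Rightarrow> 'b::comm_monoid_add"
  proof -
    have "{0..<p} = insert 0 {1..<p}" using p by auto
    then show ?thesis by simp
  qed
  have "\<exists>t\<in>{1..<p}. \<forall>t'\<in>{1..<p}. cmod (F A t') \<le> cmod (F A t)"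
  proof -
    define V where "V = (\<lambda>t. cmod (F A t)) ` {1..<p}"
    have "finite V" "V \<noteq> {}" unfolding V_def using p by auto
    then have "Max V \<in> V" "\<forall>v\<in>V. v \<le> Max V" by simp_all
    then have "\<exists>v\<in>V. \<forall>v'\<in>V. v' \<le> v" by blast
    then show ?thesis unfolding V_def by simp
  qed
  then obtain t where t: "t \<in> {1..<p}" and max: "\<And>t'. t' \<in> {1..<p} \<Longrightarrow> cmod (F A t') \<le> cmod (F A t)" by blast
  define M where "M = cmod (F A t)"
  have M0: "0 \<le> M" unfolding M_def by simp
  have ns: "0 < n" "n \<le> s" "s + n \<le> P"
  proof -
    show "0 < n" "n \<le> s" using sizes unfolding n_def s_def by simp_all
    have "real_of_int (int (card S) + int (card A)) \<le> P" using sizes(1) unfolding P_def by (simp only: of_int_le_iff)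
    then show "s + n \<le> P" unfolding n_def s_def by simp
  qed
  have "complex_of_real (n\<^sup>2 * P) = of_real (n\<^sup>2 * s) + (\<Sum>t\<in>{1..<p}. F A t * F A t * cnj (F S t))"
    using triple unfolding split F0 n_def s_def by (simp add: power2_eq_square)
  then have "(\<Sum>t\<in>{1..<p}. F A t * F A t * cnj (F S t)) = of_real (n\<^sup>2 * (P - s))"
    by (simp add: algebra_simps)
  then have "cmod (of_real (n\<^sup>2 * (P - s))) = cmod (\<Sum>t\<in>{1..<p}. F A t * F A t * cnj (F S t))" by simp
  moreover have "0 \<le> n\<^sup>2 * (P - s)" using ns by simp
  ultimately have "n\<^sup>2 * (P - s) = cmod (\<Sum>t\<in>{1..<p}. F A t * F A t * cnj (F S t))"
    by (simp only: norm_of_real abs_of_nonneg)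
  also have "\<dots> \<le> (\<Sum>t\<in>{1..<p}. cmod (F A t * F A t * cnj (F S t)))" by (rule norm_sum)
  also have "\<dots> \<le> (\<Sum>t\<in>{1..<p}. M * (cmod (F A t) * cmod (F S t)))"
    unfolding norm_mult complex_mod_cnj mult.assoc M_def using max by (intro sum_mono mult_right_mono) auto
  also have "\<dots> = M * (\<Sum>t\<in>{1..<p}. cmod (F A t) * cmod (F S t))" by (simp add: sum_distrib_left)
  also have "\<dots> \<le> M * (s * (P - s))"
  proof (rule mult_left_mono[OF _ M0], rule power2_le_imp_le)
    have par: "(\<Sum>t\<in>{1..<p}. (cmod (F X t))\<^sup>2) = card X * (P - card X)" if "X \<subseteq> {0..<p}" for X
      using Parseval[OF that] unfolding split F0 by (simp add: power2_eq_square algebra_simps)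
    have "(\<Sum>t\<in>{1..<p}. cmod (F A t) * cmod (F S t))\<^sup>2 \<le> (n * (P - n)) * (s * (P - s))"
      using Cauchy_Schwarz_ineq_sum[of "\<lambda>t. cmod (F A t)" "\<lambda>t. cmod (F S t)" "{1..<p}"]
      unfolding par[OF A] par[OF S(1)] n_def s_def .
    also have "\<dots> \<le> (s * (P - s)) * (s * (P - s))"
    proof (rule mult_right_mono)
      \<comment> \<open>This is where \<open>s + n \<le> P\<close> enters: it makes x (P - x) at
        least as large at \<open>s\<close> as at \<open>n\<close>.\<close>
      have "0 \<le> (s - n) * (P - s - n)" using ns by simp
      then show "n * (P - n) \<le> s * (P - s)" by (simp add: algebra_simps)
      show "0 \<le> s * (P - s)" using ns by simp
    qed
    finally show "(\<Sum>t\<in>{1..<p}. cmod (F A t) * cmod (F S t))\<^sup>2 \<le> (s * (P - s))\<^sup>2" by (simp add: power2_eq_square)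
    show "0 \<le> s * (P - s)" using ns by simp
  qed
  finally have "n\<^sup>2 * (P - s) \<le> (s * M) * (P - s)" by (simp add: algebra_simps)
  then have "n\<^sup>2 \<le> s * M" using ns by simp
  then show ?thesis using t unfolding n_def s_def M_def F_def by blast
qed

text \<open>By concavity and sin 0 = 0 the quotient sin x / x decreases; the form without division
  includes the endpoint 0.\<close>

lemma sin_chord:
  fixes a b :: real
  assumes "0 \<le> a" "a \<le> b" "b \<le> pi"
  shows "a * sin b \<le> b * sin a"
proof (cases "b = 0")
  case False
  have "concave_on {0..pi} (sin :: real \<Rightarrow> real)"
  proof (rule f''_le0_imp_concave)
    show "(sin has_real_derivative cos x) (at x)" for x :: real by (auto intro!: derivative_eq_intros)
    show "(cos has_real_derivative - sin x) (at x)" for x :: real by (auto intro!: derivative_eq_intros)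
  qed (auto simp: sin_ge_zero)
  then have "(1 - a / b) * sin 0 + a / b * sin b \<le> sin ((1 - a / b) *\<^sub>R 0 + (a / b) *\<^sub>R b)"
    using assms False by (intro concave_onD) (auto simp: divide_le_eq)
  then have "a / b * sin b \<le> sin a" using False by simp
  then show ?thesis using assms False by (simp add: field_simps)
qed (use assms in simp)

section \<open>The numerical hypothesis\<close>

text \<open>Since x / sin x increases, replacing \<open>\<eta>\<close> by the density n/P, which is
  at least \<open>\<eta>\<close>, only increases \<open>T\<close>. Solving the hypothesis for
  \<open>K\<close> then gives both bounds.\<close>

lemma doubling_parameter_bounds:
  fixes n s P \<eta> :: real
  assumes n: "1 \<le> n" "n \<le> s" "s + n \<le> P" and \<eta>: "0 < \<eta>" "\<eta> * P \<le> n"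
    and hyp: "s \<le> (2 + (- 5/4 + 1/4 * sqrt (9 + 8 * \<eta> * P * sin (pi / P) / sin (pi * \<eta> / 3)))) * n - 3"
  shows "3 * n \<le> 2 * (s + 3) \<Longrightarrow>
      (s + 3) * (2 * (s + 3) - 3 * n) * sin (pi * n / (3 * P)) \<le> n ^ 3 * sin (pi / P)"
    and "4 * s + 12 \<le> 9 * n"
proof -
  define x y K where "x = pi * \<eta> / 3" and "y = pi * n / (3 * P)" and "K = (s + 3) / n"
  define T where "T = \<eta> * P * sin (pi / P) / sin x"
  have P: "2 \<le> P" using n by simp
  have y: "0 < y" "y \<le> pi / 6" unfolding y_def using n P by (simp_all add: divide_simps)
  have xy: "0 < x" "x \<le> y" unfolding x_def y_def using \<eta> P by (simp_all add: divide_simps mult.commute)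
  have sx: "0 < sin x" "0 < sin y" using xy y pi_gt_zero by (intro sin_gt_zero; linarith)+
  have sP: "0 < sin (pi / P)" using P by (intro sin_gt_zero) (simp_all add: divide_less_eq)
  have "x * sin y \<le> y * sin x" using xy y pi_gt_zero by (intro sin_chord) auto
  then have "pi * (\<eta> * P * sin y) \<le> pi * (n * sin x)"
    unfolding x_def y_def using P by (simp add: field_simps)
  then have "\<eta> * P * sin y \<le> n * sin x" by simp
  then have "\<eta> * P * sin y * sin (pi / P) \<le> n * sin x * sin (pi / P)" using sP by (intro mult_right_mono) auto
  then have T: "T * sin y \<le> n * sin (pi / P)" unfolding T_def using sx by (simp add: field_simps)
  have T0: "0 \<le> T" unfolding T_def using \<eta> P sP sx by simp
  have "8 * \<eta> * P * sin (pi / P) / sin (pi * \<eta> / 3) = 8 * T" unfolding T_def x_def by simp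
  then have "s + 3 \<le> (2 + (- 5/4 + 1/4 * sqrt (9 + 8 * T))) * n" using hyp by simp
  then have "K \<le> 2 + (- 5/4 + 1/4 * sqrt (9 + 8 * T))" unfolding K_def using n by (simp add: divide_le_eq)
  then have K: "4 * K - 3 \<le> sqrt (9 + 8 * T)" by simp
  have KT: "K * (2 * K - 3) \<le> T" if "3 \<le> 2 * K"
  proof -
    have "(4 * K - 3)\<^sup>2 \<le> (sqrt (9 + 8 * T))\<^sup>2" using K that by (intro power_mono) auto
    then show ?thesis using T0 by (simp add: power2_eq_square algebra_simps)
  qed
  have Ky: "K * (2 * K - 3) * sin y \<le> n * sin (pi / P)" if "3 \<le> 2 * K"
  proof -
    have "K * (2 * K - 3) * sin y \<le> T * sin y" using KT[OF that] sx by (intro mult_right_mono) auto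
    then show ?thesis using T by linarith
  qed
  have nK: "n * K = s + 3" unfolding K_def using n by simp
  show "(s + 3) * (2 * (s + 3) - 3 * n) * sin (pi * n / (3 * P)) \<le> n ^ 3 * sin (pi / P)" if "3 * n \<le> 2 * (s + 3)"
  proof -
    have "3 \<le> 2 * K" unfolding K_def using that n by (simp add: le_divide_eq)
    have "(s + 3) * (2 * (s + 3) - 3 * n) * sin y = n\<^sup>2 * (K * (2 * K - 3) * sin y)"
      unfolding nK[symmetric] by (simp add: power2_eq_square algebra_simps)
    also have "\<dots> \<le> n\<^sup>2 * (n * sin (pi / P))" using Ky[OF \<open>3 \<le> 2 * K\<close>] by (intro mult_left_mono) auto
    finally show ?thesis unfolding y_def by (simp add: power2_eq_square power3_eq_cube mult.assoc)
  qed
  show "4 * s + 12 \<le> 9 * n"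
  proof (rule ccontr)
    assume "\<not> 4 * s + 12 \<le> 9 * n"
    then have K94: "9 / 4 < K" unfolding K_def using n by (simp add: less_divide_eq)
    have "9 / 4 * (3 / 2) \<le> K * (2 * K - 3)" using K94 by (intro mult_mono) auto
    then have "27 / 8 * sin y \<le> K * (2 * K - 3) * sin y" using sx by (intro mult_right_mono) auto
    also have "\<dots> \<le> n * sin (pi / P)" using Ky K94 by simp
    also have "\<dots> \<le> n * (pi / P)" using n P by (intro mult_left_mono sin_x_le_x) auto
    also have "n * (pi / P) = 3 * y" unfolding y_def by simp
    finally have 1: "27 / 8 * sin y \<le> 3 * y" .
    \<comment> \<open>As n \<le> P/2, \<open>y\<close> is at most \<open>pi / 6\<close>, where the
      sine is 1/2; the chord up to there gives 3 y \<le> \<pi> sin y.\<close>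
    have "y * sin (pi / 6) \<le> pi / 6 * sin y" using y by (intro sin_chord) auto
    then have "3 * y \<le> pi * sin y" by (simp add: sin_30)
    then have "27 / 8 * sin y \<le> pi * sin y" using 1 by linarith
    then have "27 / 8 \<le> pi" using sx by simp
    then show False using pi_approx(2) by simp
  qed
qed

text \<open>An arc of k \<le> c/3 points, c = 2 (s + 3) - 3 n, is compared with one of n/3 points.
  If c \<ge> n, concavity gives n^3 sin(\<pi>/P) \<le> s c sin y, while \<open>hyp\<close> has s + 3
  in place of s on the smaller side. If c < n, the arc is at most n/3 and the large coefficient
  forces s too high for s + 3 < 2 n.\<close>

lemma no_spread_out_coefficient:
  fixes n s N P k M :: real
  assumes n: "1 \<le> n" "n \<le> s" "s + n \<le> P" and k: "0 \<le> k" "k + n \<le> 2 * N" "k \<le> n" "3 * N \<le> s + 3"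
    and M: "n\<^sup>2 \<le> s * M" "M \<le> sin (pi * k / P) / sin (pi / P)"
    and hyp: "3 * n \<le> 2 * (s + 3) \<Longrightarrow>
      (s + 3) * (2 * (s + 3) - 3 * n) * sin (pi * n / (3 * P)) \<le> n ^ 3 * sin (pi / P)"
  shows False
proof -
  define y where "y = pi * n / (3 * P)"
  have P: "2 \<le> P" using n by simp
  have y: "0 < y" "y \<le> pi / 6" unfolding y_def using n P by (simp_all add: divide_simps)
  have sy: "0 < sin y" using y pi_gt_zero by (intro sin_gt_zero; linarith)
  have sP: "0 < sin (pi / P)" using P by (intro sin_gt_zero) (simp_all add: divide_less_eq)
  have kn: "3 * k \<le> 2 * (s + 3) - 3 * n" using k(2,4) by argo
  have s3: "3 * n \<le> 2 * (s + 3)" using kn k(1) by argo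
  have "n\<^sup>2 * sin (pi / P) \<le> s * M * sin (pi / P)" using M(1) sP by (intro mult_right_mono) auto
  also have "\<dots> = s * (M * sin (pi / P))" by simp
  also have "\<dots> \<le> s * sin (pi * k / P)"
    using M(2) sP n by (intro mult_left_mono) (simp_all add: le_divide_eq)
  finally have up: "n\<^sup>2 * sin (pi / P) \<le> s * sin (pi * k / P)" .
  have k0: "0 \<le> pi * k / P" using k(1) P by simp
  have kpi: "pi * k / P \<le> pi" using k(3) n P by (simp add: divide_le_eq)
  consider "3 * k \<le> n" "2 * (s + 3) - 3 * n < n" | "n \<le> 2 * (s + 3) - 3 * n" using kn by argo
  then show False
  proof cases
    case 1
    have "sin (pi * k / P) \<le> sin y"
    proof (rule sin_monotone_2pi_le)
      show "- (pi / 2) \<le> pi * k / P" using k0 pi_gt_zero by linarith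
      show "pi * k / P \<le> y" unfolding y_def using 1(1) P by (simp add: divide_simps)
      show "y \<le> pi / 2" using y by simp
    qed
    then have "s * sin (pi * k / P) \<le> s * sin y" using n by (intro mult_left_mono) auto
    then have up': "n\<^sup>2 * sin (pi / P) \<le> s * sin y" using up by linarith
    show False
    proof (cases "y \<le> pi / P")
      \<comment> \<open>Here n \<le> 3, and n^2 \<le> s < 2 n - 3 is absurd.\<close>
      case True
      have "sin y \<le> sin (pi / P)" using True y P by (intro sin_monotone_2pi_le) (auto simp: divide_simps)
      then have "s * sin y \<le> s * sin (pi / P)" using n by (intro mult_left_mono) auto
      then have "n\<^sup>2 * sin (pi / P) \<le> s * sin (pi / P)" using up' by linarith
      then have "n\<^sup>2 \<le> s" using sP by simp
      then have "(n - 1)\<^sup>2 + 2 < 0 + 0" using 1(2) by (simp add: power2_eq_square algebra_simps)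
      then show False using zero_le_power2[of "n - 1"] by linarith
    next
      case False
      then have "pi / P * sin y \<le> y * sin (pi / P)" using y P pi_gt_zero by (intro sin_chord) auto
      moreover have "y * sin (pi / P) = pi / P * (n / 3 * sin (pi / P))" unfolding y_def by simp
      ultimately have "pi / P * sin y \<le> pi / P * (n / 3 * sin (pi / P))" by simp
      moreover have "0 < pi / P" using P by simp
      ultimately have "sin y \<le> n / 3 * sin (pi / P)" by (simp only: mult_le_cancel_left_pos)
      then have c: "3 * sin y \<le> n * sin (pi / P)" by simp
      have "n * (3 * sin y) \<le> n * (n * sin (pi / P))" using c n by (intro mult_left_mono) auto
      also have "\<dots> \<le> s * sin y" using up' by (simp add: power2_eq_square mult.assoc)
      finally have "(3 * n) * sin y \<le> s * sin y" by (simp add: mult.left_commute mult.assoc)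
      then have "3 * n \<le> s" using sy by simp
      then show False using 1(2) n by argo
    qed
  next
    case 2
    define c where "c = 2 * (s + 3) - 3 * n"
    have "n * sin (pi * k / P) \<le> c * sin y"
    proof (cases "pi * k / P \<le> y")
      case True
      have "sin (pi * k / P) \<le> sin y"
      proof (rule sin_monotone_2pi_le)
        show "- (pi / 2) \<le> pi * k / P" using k0 pi_gt_zero by linarith
        show "y \<le> pi / 2" using y by simp
      qed (rule True)
      moreover have "0 \<le> sin (pi * k / P)" using k0 kpi by (rule sin_ge_zero)
      ultimately show ?thesis using 2 n sy unfolding c_def by (intro mult_mono) auto
    next
      case False
      then have "y * sin (pi * k / P) \<le> pi * k / P * sin y" using y kpi by (intro sin_chord) auto
      moreover have "y * sin (pi * k / P) = pi / (3 * P) * (n * sin (pi * k / P))" unfolding y_def by simp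
      moreover have "pi * k / P * sin y = pi / (3 * P) * (3 * k * sin y)" by simp
      ultimately have "pi / (3 * P) * (n * sin (pi * k / P)) \<le> pi / (3 * P) * (3 * k * sin y)" by simp
      moreover have "0 < pi / (3 * P)" using P by simp
      ultimately have "n * sin (pi * k / P) \<le> 3 * k * sin y" by (simp only: mult_le_cancel_left_pos)
      also have "\<dots> \<le> c * sin y" using kn sy unfolding c_def by (intro mult_right_mono) auto
      finally show ?thesis .
    qed
    then have "s * (n * sin (pi * k / P)) \<le> s * (c * sin y)" using n by (intro mult_left_mono) auto
    moreover have "n * (n\<^sup>2 * sin (pi / P)) \<le> n * (s * sin (pi * k / P))" using up n by (intro mult_left_mono) auto
    ultimately have "n ^ 3 * sin (pi / P) \<le> s * (c * sin y)"
      by (simp add: power3_eq_cube power2_eq_square mult.assoc mult.left_commute)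
    moreover have "(s + 3) * (c * sin y) \<le> n ^ 3 * sin (pi / P)"
      using hyp[OF s3] unfolding c_def y_def by (simp add: mult.assoc)
    ultimately have "(s + 3) * (c * sin y) \<le> s * (c * sin y)" by linarith
    moreover have "0 < c * sin y" using 2 n sy unfolding c_def by (intro mult_pos_pos) auto
    ultimately show False by (simp add: distrib_right)
  qed
qed

section \<open>A half circle with many points\<close>

theorem half_circle_concentration:
  fixes p :: int and A S :: "int set"
  assumes p: "prime p" and A: "A \<subseteq> {0..<p}"
    and S: "S \<subseteq> {0..<p}" "\<And>x y. x \<in> A \<Longrightarrow> y \<in> A \<Longrightarrow> (x + y) mod p \<in> S"
    and sizes: "int (card S) + int (card A) \<le> p" "card A \<le> card S" "0 < card A"
    and hyp: "3 * real (card A) \<le> 2 * (real (card S) + 3) \<Longrightarrow>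
      (real (card S) + 3) * (2 * (real (card S) + 3) - 3 * real (card A)) * sin (pi * real (card A) / (3 * of_int p))
        \<le> real (card A) ^ 3 * sin (pi / of_int p)"
  shows "\<exists>u c. coprime u p \<and> card S + 4 \<le> 3 * card {x \<in> A. 2 * ((u * x + c) mod p) < p}"
proof (rule ccontr)
  assume none: "\<not> ?thesis"
  have p2: "2 \<le> p" using p by (rule prime_ge_2_int)
  obtain t where t: "t \<in> {1..<p}"
    "(real (card A))\<^sup>2 \<le> real (card S) * cmod (\<Sum>a\<in>A. cis (2 * pi * (t * a) / p))"
    using large_Fourier_coefficient[OF p2 A S sizes] by blast
  have "\<not> p dvd t" using t(1) zdvd_not_zless[of t p] by auto
  then have cop: "coprime t p" using p prime_imp_coprime coprime_commute by blast
  \<comment> \<open>The largest integer with 3 N < |S| + 4. Below, \<open>+ 0\<close> puts the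
    dilation into the affine form of \<open>affine_mod_inj\<close>.\<close>
  define N where "N = (card S + 3) div 3"
  define B where "B = (\<lambda>a. (t * a + 0) mod p) ` A"
  have inj: "inj_on (\<lambda>a. (t * a + 0) mod p) A" using inj_on_subset[OF affine_mod_inj[OF cop] A] .
  have cB: "card B = card A" unfolding B_def by (rule card_image[OF inj])
  have half: "card {x \<in> B. 2 * ((x + c) mod p) < p} \<le> N" for c
  proof -
    have "{x \<in> B. 2 * ((x + c) mod p) < p} = (\<lambda>a. (t * a + 0) mod p) ` {a \<in> A. 2 * ((t * a + c) mod p) < p}"
      unfolding B_def by (auto simp: mod_add_left_eq)
    moreover have "inj_on (\<lambda>a. (t * a + 0) mod p) {a \<in> A. 2 * ((t * a + c) mod p) < p}"
      by (rule inj_on_subset[OF inj]) blast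
    ultimately have "card {x \<in> B. 2 * ((x + c) mod p) < p} = card {a \<in> A. 2 * ((t * a + c) mod p) < p}"
      by (simp only: card_image)
    moreover have "3 * card {a \<in> A. 2 * ((t * a + c) mod p) < p} < card S + 4" using none cop by (meson not_le)
    ultimately show ?thesis unfolding N_def by linarith
  qed
  have "B \<subseteq> {0..<p}" unfolding B_def using p2 by auto
  from Lev_half_circle_bound[OF p2 this half] obtain k where k: "k + card B \<le> 2 * N" "k \<le> card B"
    "cmod (\<Sum>x\<in>B. cis (2 * pi * x / p)) \<le> sin (pi * k / p) / sin (pi / p)" by blast
  have "(\<Sum>x\<in>B. cis (2 * pi * x / p)) = (\<Sum>a\<in>A. cis (2 * pi * (t * a) / p))"
  proof -
    have "cis (2 * pi * ((t * a + 0) mod p) / p) = cis (2 * pi * (t * a) / p)" for a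
    proof -
      define q where "q = t * a div p"
      have "t * a = (t * a + 0) mod p + p * q" unfolding q_def by simp
      then have "real_of_int (t * a) = real_of_int ((t * a + 0) mod p) + p * q" by (metis of_int_add of_int_mult)
      then have "2 * pi * (t * a) / p = 2 * pi * ((t * a + 0) mod p) / p + 2 * pi * q"
        using p2 by (simp add: field_simps)
      then have "cis (2 * pi * (t * a) / p) = cis (2 * pi * ((t * a + 0) mod p) / p) * cis (2 * pi * q)"
        by (simp only: cis_mult)
      then show ?thesis by simp
    qed
    then show ?thesis unfolding B_def by (simp only: sum.reindex[OF inj] o_def)
  qed
  then have M: "cmod (\<Sum>a\<in>A. cis (2 * pi * (t * a) / p)) \<le> sin (pi * k / p) / sin (pi / p)" using k(3) by simp
  show False
  proof (rule no_spread_out_coefficient[OF _ _ _ _ _ _ _ t(2) M hyp])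
    show "1 \<le> real (card A)" "real (card A) \<le> real (card S)" using sizes by simp_all
    have "real_of_int (int (card S) + int (card A)) \<le> p" using sizes(1) by (simp only: of_int_le_iff)
    then show "real (card S) + real (card A) \<le> p" by simp
    show "0 \<le> real k" "real k \<le> real (card A)" using k cB by simp_all
    have "real (k + card A) \<le> real (2 * N)" using k(1) unfolding cB by (simp only: of_nat_le_iff)
    then show "real k + real (card A) \<le> 2 * real N" by simp
    have "3 * N \<le> card S + 3" unfolding N_def by simp
    then have "real (3 * N) \<le> real (card S + 3)" by (simp only: of_nat_le_iff)
    then show "3 * real N \<le> real (card S) + 3" by simp
  qed
qed

section \<open>Arithmetic progressions modulo p\<close>

lemma ap_mod_image: "ap_mod p a g k = (\<lambda>i. (a + i * g) mod p) ` {..<k}"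
  unfolding ap_mod_def by auto

lemma card_ap_mod_le: "card (ap_mod p a g k) \<le> k"
  unfolding ap_mod_image using card_image_le[of "{..<k}"] by simp

lemma card_ap_mod:
  assumes "coprime g p" "k \<le> p"
  shows "card (ap_mod p a g k) = k"
proof -
  have "inj_on (\<lambda>i. (a + i * g) mod p) {..<k}"
  proof (rule inj_onI)
    fix i j assume ij: "i \<in> {..<k}" "j \<in> {..<k}" and "(a + i * g) mod p = (a + j * g) mod p"
    then have "[a + i * g = a + j * g] (mod p)" by (simp add: cong_def)
    then have "[i * g = j * g] (mod p)" by (simp only: cong_add_lcancel_nat)
    then have "[i = j] (mod p)" using assms(1) by (simp add: cong_mult_rcancel_nat)
    then show "i = j" using ij assms(2) by (simp add: cong_def)
  qed
  then show ?thesis unfolding ap_mod_image by (simp add: card_image)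
qed

theorem theorem1p4:
  fixes p :: nat and \<eta> :: real and A :: "nat set" and r :: int
  assumes "prime p"
    and "0 < \<eta>" and "\<eta> < 1"
    and "A \<subseteq> {0..<p}"
    and "real (card A) \<ge> \<eta> * real p" and "\<eta> * real p > 0"
    and "int (card (sumset_mod p A A)) = 2 * int (card A) + r"
    and "card (sumset_mod p A A) < p"
    and "real (card (sumset_mod p A A)) \<le>
           (2 + (- 5/4 + 1/4 * sqrt (9 + 8 * \<eta> * real p * sin (pi / real p) / sin (pi * \<eta> / 3))))
             * real (card A) - 3"
    and "real (card A) \<le> (real p - of_int r) / 3"
  shows "\<exists>g PA P2A. is_AP_mod p PA g \<and> is_AP_mod p P2A g \<and>
           A \<subseteq> PA \<and> int (card PA) \<le> int (card A) + r + 1 \<and>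
           P2A \<subseteq> sumset_mod p A A \<and> card P2A \<ge> 2 * card A - 1"
proof -
  define n where "n = card A"
  define Q where "Q = int p"
  define A' S where "A' = int ` A" and "S = int ` sumset_mod p A A"
  have p0: "0 < p" using assms(1) by (rule prime_gt_0_nat)
  have n1: "1 \<le> n" unfolding n_def using assms(5,6) by (simp add: Suc_le_eq)
  have primeQ: "prime Q" unfolding Q_def using assms(1) by simp
  have cards: "card A' = n" "card S = card (sumset_mod p A A)"
    unfolding A'_def S_def n_def by (simp_all add: card_image)
  have A'Q: "A' \<subseteq> {0..<Q}" unfolding A'_def Q_def using assms(4) by auto
  have SQ: "S \<subseteq> {0..<Q}" unfolding S_def Q_def sumset_mod_def using p0 by auto
  have sums: "(x + y) mod Q \<in> S" if "x \<in> A'" "y \<in> A'" for x y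
  proof -
    obtain a b where "x = int a" "y = int b" "a \<in> A" "b \<in> A" using \<open>x \<in> A'\<close> \<open>y \<in> A'\<close> unfolding A'_def by blast
    then have "(x + y) mod Q = int ((a + b) mod p)" "(a + b) mod p \<in> sumset_mod p A A"
      unfolding Q_def sumset_mod_def by (auto simp: zmod_int)
    then show ?thesis unfolding S_def by simp
  qed
  have sr: "int (card S) = 2 * int n + r" unfolding cards n_def by (rule assms(7))
  have size: "int (card S) + int n \<le> Q"
  proof -
    have "3 * real n + of_int r \<le> real p" using assms(10) unfolding n_def by simp
    then have "real_of_int (3 * int n + r) \<le> real_of_int (int p)" by simp
    then have "3 * int n + r \<le> int p" by (simp only: of_int_le_iff)
    then show ?thesis unfolding sr Q_def by simp
  qed
  have nS: "n \<le> card S"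
  proof -
    obtain a where a: "a \<in> A'" using cards(1) n1 by fastforce
    have "inj_on (\<lambda>x. (1 * x + a) mod Q) A'" using inj_on_subset[OF affine_mod_inj[of 1 Q a] A'Q] by simp
    moreover have "(\<lambda>x. (1 * x + a) mod Q) ` A' \<subseteq> S" using sums[OF _ a] by auto
    moreover have "finite S" using finite_subset[OF SQ] by simp
    ultimately show ?thesis using card_inj_on_le[of "\<lambda>x. (1 * x + a) mod Q" A' S] unfolding cards(1) by blast
  qed
  have sz: "1 \<le> real n" "real n \<le> real (card S)" "real (card S) + real n \<le> real p"
  proof -
    show "1 \<le> real n" "real n \<le> real (card S)" using n1 nS by simp_all
    have "int (card S + n) \<le> int p" using size unfolding Q_def by simp
    then show "real (card S) + real n \<le> real p" by linarith
  qed
  note bounds = doubling_parameter_bounds[OF sz assms(2) assms(5)[folded n_def] assms(9)[folded cards(2) n_def]]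
  have dens: "4 * card S + 12 \<le> 9 * n"
    using bounds(2) by linarith
  obtain u0 c0 where "coprime u0 Q" "card S + 4 \<le> 3 * card {x \<in> A'. 2 * ((u0 * x + c0) mod Q) < Q}"
    using half_circle_concentration[OF primeQ A'Q SQ sums] size nS n1 bounds(1)
    unfolding cards(1) Q_def by auto
  from rectification[OF primeQ A'Q SQ sums size[folded cards(1)] dens[folded cards(1)] this]
  obtain u c L where ucL: "coprime u Q" "(\<lambda>x. (u * x + c) mod Q) ` A' \<subseteq> {0..L}" "0 \<le> L" "2 * L < Q"
    "L + int (card A') \<le> int (card S)" by blast
  define h where "h x = (u * x + c) mod Q" for x
  define B where "B = h ` A'"
  have cB: "card B = n"
    unfolding B_def h_def cards(1)[symmetric] by (rule card_image[OF inj_on_subset[OF affine_mod_inj[OF ucL(1)] A'Q]])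
  have Bsub: "B \<subseteq> {0..L}" using ucL(2) unfolding B_def h_def .
  \<comment> \<open>From L + n \<le> s and 4 s + 12 \<le> 9 n follows 4 L \<le> 5 n - 12, well
    within the required density.\<close>
  have dense: "3 * L + 3 \<le> 4 * int (card B)" unfolding cB using ucL(5) dens cards(1) n1 by linarith
  obtain v where v: "{v..<v + 2 * int n - 1} \<subseteq> B + B"
    using sumset_long_interval[OF Bsub ucL(3) dense] unfolding cB by (elim exE)
  obtain u' where u': "[u * u' = 1] (mod Q)" using ucL(1) cong_solve_coprime_int by blast
  have copu': "coprime u' Q" using u' by (metis cong_imp_coprime cong_sym coprime_1_left coprime_mult_left_iff)
  \<comment> \<open>The inverse of \<open>h\<close> is y \<mapsto> (y - c) u' modulo p. It turns
    steps of 1 into steps of \<open>g\<close>, the point 0 into \<open>a0\<close>, and the start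
    \<open>v\<close> of the interval of sums, where c enters twice, into \<open>a2\<close>.\<close>
  define g a0 a2 where "g = nat (u' mod Q)" and "a0 = nat ((- c * u') mod Q)"
    and "a2 = nat ((2 * (- c * u') + v * u') mod Q)"
  have Q0: "0 < Q" unfolding Q_def using p0 by simp
  have ints: "[int g = u'] (mod Q)" "[int a0 = - c * u'] (mod Q)" "[int a2 = 2 * (- c * u') + v * u'] (mod Q)"
    unfolding g_def a0_def a2_def cong_def using Q0 by simp_all
  have inv: "[x = - c * u' + h x * u'] (mod Q)" for x
  proof -
    have "[h x = u * x + c] (mod Q)" unfolding h_def cong_def by simp
    then have "[- c * u' + h x * u' = - c * u' + (u * x + c) * u'] (mod Q)" by (intro cong_add cong_mult cong_refl)
    also have "- c * u' + (u * x + c) * u' = u * u' * x" by (simp add: algebra_simps)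
    also have "[u * u' * x = 1 * x] (mod Q)" using u' by (intro cong_mult cong_refl)
    finally show ?thesis by (simp add: cong_sym)
  qed
  have copg: "coprime g p"
  proof -
    have "coprime (int g) Q" using ints(1) copu' by (metis cong_imp_coprime cong_sym)
    then show ?thesis unfolding Q_def by simp
  qed
  have "g mod p \<noteq> 0"
  proof
    assume "g mod p = 0"
    then have "p dvd g" by blast
    then have "is_unit p" using copg by (metis coprime_commute coprime_common_divisor dvd_refl)
    then show False using assms(1) by auto
  qed
  define PA P2A where "PA = ap_mod p a0 g (nat L + 1)" and "P2A = ap_mod p a2 g (2 * n - 1)"
  \<comment> \<open>2 n \<le> s + n \<le> p, so the lower progression has no repetitions.\<close>
  have np: "2 * n - 1 \<le> p" "1 \<le> 2 * n - 1"
    using size nS n1 unfolding Q_def by linarith+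
  have Lp: "nat L + 1 \<le> p" using ucL(3,4) unfolding Q_def by linarith
  have "A \<subseteq> PA"
  proof
    fix x assume x: "x \<in> A"
    define b where "b = h (int x)"
    have "b \<in> B" unfolding b_def B_def A'_def using x by blast
    then have b: "0 \<le> b" "b \<le> L" using Bsub by auto
    have "[int x = int a0 + b * int g] (mod Q)"
      using inv[of "int x"] cong_add[OF ints(2) cong_mult[OF cong_refl[of b] ints(1)]]
      unfolding b_def by (metis cong_sym cong_trans)
    then have "int x mod Q = int ((a0 + nat b * g) mod p)"
      using b(1) unfolding cong_def Q_def by (simp add: zmod_int)
    moreover have "int x mod Q = int x" using x assms(4) unfolding Q_def by auto
    ultimately have "x = (a0 + nat b * g) mod p" by simp
    then show "x \<in> PA" unfolding PA_def ap_mod_image using b by (intro image_eqI[of _ _ "nat b"]) auto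
  qed
  moreover have "P2A \<subseteq> sumset_mod p A A"
  proof
    fix z assume "z \<in> P2A"
    then obtain i where i: "i < 2 * n - 1" "z = (a2 + i * g) mod p" unfolding P2A_def ap_mod_image by blast
    have "v + int i \<in> B + B" using v i(1) by (intro subsetD[OF v]) auto
    then obtain b b' where "v + int i = b + b'" "b \<in> B" "b' \<in> B" by (rule set_plus_elim)
    then obtain x y where xy: "v + int i = h (int x) + h (int y)" "x \<in> A" "y \<in> A"
      unfolding B_def A'_def by blast
    have "[int x + int y = (- c * u' + h (int x) * u') + (- c * u' + h (int y) * u')] (mod Q)"
      by (intro cong_add inv)
    also have "(- c * u' + h (int x) * u') + (- c * u' + h (int y) * u') = (2 * (- c * u') + v * u') + int i * u'"
      using arg_cong[OF xy(1), of "\<lambda>w. w * u'"] by (simp add: algebra_simps)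
    also have "[(2 * (- c * u') + v * u') + int i * u' = int a2 + int i * int g] (mod Q)"
      by (intro cong_add cong_mult cong_refl cong_sym[OF ints(3)] cong_sym[OF ints(1)])
    finally have "int ((x + y) mod p) = int z" unfolding i(2) cong_def Q_def by (simp add: zmod_int)
    then have "z = (x + y) mod p" by simp
    then show "z \<in> sumset_mod p A A" unfolding sumset_mod_def using xy by blast
  qed
  moreover have "is_AP_mod p PA g" "is_AP_mod p P2A g"
    unfolding is_AP_mod_def PA_def P2A_def using \<open>g mod p \<noteq> 0\<close> np Lp by (intro conjI exI; force)+
  \<comment> \<open>L + 1 \<le> s - n + 1, and s = 2 n + r.\<close>
  moreover have "int (card PA) \<le> int (card A) + r + 1"
    using card_ap_mod_le[of p a0 g "nat L + 1"] ucL(3,5) sr unfolding PA_def cards(1) n_def by linarith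
  moreover have "2 * card A - 1 \<le> card P2A"
    unfolding P2A_def n_def[symmetric] card_ap_mod[OF copg np(1)] ..
  ultimately show ?thesis by blast
qed

end
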